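(* Let $(G,V,\|\cdot\|)$ be a sub-Finsler Lie group with Lie algebra $\mathfrak g$. Then for all $\lambda\in\mathfrak g^*$ and all $g\in G$ there exists a normal curve $\gamma:[0,1]\to G$ with $\gamma(0)=g$ and with associated covector $\lambda$.
   Context: A polarization of a Lie group $G$ is a linear subspace $V$ of its Lie algebra $\mathfrak g$; it is bracket-generating if the Lie algebra generated by $V$ is $\mathfrak g$. A sub-Finsler Lie group is a triple $(G,V,\|\cdot\|)$ with $G$ a Lie group, $V$ a bracket-generating polarization and $\|\cdot\|$ a norm on $V$. For an interval $I$, an absolutely continuous curve $\gamma:I\to G$ is horizontal if $\dot\gamma(t)\in \mathrm dL_{\gamma(t)}V$ for a.e. $t$ ($L$ = left translation); its control is $u(t)=\mathrm dL_{\gamma(t)}^{-1}\dot\gamma(t)\in V$. The energy is $\mathrm E:V\to\mathbb R$, $\mathrm E(v)=\frac12\|v\|^2$. The subdifferential of $\mathrm E$ at $w\in V$ is $\partial_w\mathrm E=\{\eta\in V^*:\eta(v-w)\le \mathrm E(v)-\mathrm E(w)\ \forall v\in V\}$. A horizontal curve $\gamma:I\to G$ with control $u\in L^2(I,V)$ is a normal curve with associated covector $\lambda\in\mathfrak g^*$ if $\lambda\circ\mathrm{Ad}_{\gamma(t)}|_V\in\partial_{u(t)}\mathrm E$ for a.e. $t\in I$. *)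

theory Defs
  imports "HOL-Analysis.Analysis"
begin

section \<open>Smooth maps and smooth manifolds\<close>

text \<open>Differentiability is taken within a linear subspace \<open>E\<close>, the model space of a manifold. In
  every use below \<open>W\<close> is relatively open in \<open>E\<close>, and only derivatives in directions
  \<open>v \<in> E\<close> matter; these are uniquely determined. For \<open>E = UNIV\<close> this is ordinary
  differentiability.\<close>

primrec Ck_on :: "'a::euclidean_space set \<Rightarrow> nat \<Rightarrow> 'a set \<Rightarrow> ('a \<Rightarrow> 'b::euclidean_space) \<Rightarrow> bool" where
  "Ck_on E 0 W f \<longleftrightarrow> continuous_on W f"
| "Ck_on E (Suc k) W f \<longleftrightarrow>
     (\<forall>x\<in>W. f differentiable (at x within E)) \<and>
     (\<forall>v\<in>E. Ck_on E k W (\<lambda>x. frechet_derivative f (at x within E) v))"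

definition smooth_on :: "'a::euclidean_space set \<Rightarrow> 'a set \<Rightarrow> ('a \<Rightarrow> 'b::euclidean_space) \<Rightarrow> bool" where
  "smooth_on E W f \<longleftrightarrow> (\<forall>k. Ck_on E k W f)"

text \<open>A chart is a pair of a domain and a coordinate map; the coordinate map is only meaningful on
  the domain.\<close>

type_synonym ('m, 'e) chart = "'m set \<times> ('m \<Rightarrow> 'e)"

abbreviation chart_inv :: "('m, 'e) chart \<Rightarrow> 'e \<Rightarrow> 'm" where
  "chart_inv c \<equiv> inv_into (fst c) (snd c)"

text \<open>Manifolds of dimension \<open>n \<ge> 1\<close> are modelled on \<open>E = UNIV\<close> with \<open>DIM('e) = n\<close>. Since every
  type of class \<^class>\<open>euclidean_space\<close> has positive dimension, the model space \<open>E = {0}\<close> is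
  admitted in order to cover dimension zero.\<close>

locale smooth_manifold =
  fixes E :: "'e::euclidean_space set"
    and A :: "('m::{t2_space, second_countable_topology}, 'e) chart set"
  assumes model_space: "E = UNIV \<or> E = {0}"
    and charts_cover: "(\<Union>c\<in>A. fst c) = UNIV"
    and chart_domain_open: "c \<in> A \<Longrightarrow> open (fst c)"
    and chart_image_open: "c \<in> A \<Longrightarrow> openin (top_of_set E) (snd c ` fst c)"
    and chart_homeomorphism:
      "c \<in> A \<Longrightarrow> homeomorphism (fst c) (snd c ` fst c) (snd c) (chart_inv c)"
    and chart_transition:
      "c \<in> A \<Longrightarrow> c' \<in> A \<Longrightarrow> smooth_on E (snd c ` (fst c \<inter> fst c')) (snd c' \<circ> chart_inv c)"

definition prod_atlas :: "('m, 'e) chart set \<Rightarrow> ('n, 'f) chart set \<Rightarrow> ('m \<times> 'n, 'e \<times> 'f) chart set" where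
  "prod_atlas A B = {(fst c \<times> fst d, map_prod (snd c) (snd d)) | c d. c \<in> A \<and> d \<in> B}"

definition smooth_map ::
  "'e::euclidean_space set \<Rightarrow> ('m::topological_space, 'e) chart set \<Rightarrow>
   ('n::topological_space, 'f::euclidean_space) chart set \<Rightarrow> ('m \<Rightarrow> 'n) \<Rightarrow> bool" where
  "smooth_map E A B f \<longleftrightarrow> continuous_on UNIV f \<and>
     (\<forall>c\<in>A. \<forall>d\<in>B. smooth_on E (snd c ` (fst c \<inter> f -` fst d)) (snd d \<circ> f \<circ> chart_inv c))"

text \<open>At each point one chart is selected, and the tangent space at \<open>p\<close> is identified with \<open>E\<close>
  through the chart selected at \<open>p\<close>. Differentials of maps and velocities of curves are read in
  the selected charts.\<close>

definition chart_at :: "('m, 'e) chart set \<Rightarrow> 'm \<Rightarrow> ('m, 'e) chart" where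
  "chart_at A p = (SOME c. c \<in> A \<and> p \<in> fst c)"

definition differential ::
  "'e::euclidean_space set \<Rightarrow> ('m, 'e) chart set \<Rightarrow> ('n, 'f::euclidean_space) chart set \<Rightarrow>
   ('m \<Rightarrow> 'n) \<Rightarrow> 'm \<Rightarrow> 'e \<Rightarrow> 'f" where
  "differential E A B f p =
     frechet_derivative (snd (chart_at B (f p)) \<circ> f \<circ> chart_inv (chart_at A p))
       (at (snd (chart_at A p) p) within E)"

definition velocity ::
  "('m, 'e::euclidean_space) chart set \<Rightarrow> real set \<Rightarrow> (real \<Rightarrow> 'm) \<Rightarrow> real \<Rightarrow> 'e" where
  "velocity A I \<gamma> t = vector_derivative (snd (chart_at A (\<gamma> t)) \<circ> \<gamma>) (at t within I)"

definition has_velocity_at ::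
  "('m, 'e::euclidean_space) chart set \<Rightarrow> real set \<Rightarrow> (real \<Rightarrow> 'm) \<Rightarrow> real \<Rightarrow> bool" where
  "has_velocity_at A I \<gamma> t \<longleftrightarrow> (snd (chart_at A (\<gamma> t)) \<circ> \<gamma>) differentiable (at t within I)"


section \<open>Absolutely continuous curves\<close>

text \<open>The finite set \<open>D\<close> lists the end points \<open>(x, y)\<close> of non-overlapping subintervals.\<close>

definition abs_continuous_on :: "real \<Rightarrow> real \<Rightarrow> (real \<Rightarrow> 'a::metric_space) \<Rightarrow> bool" where
  "abs_continuous_on a b f \<longleftrightarrow>
     (\<forall>\<epsilon>>0. \<exists>\<delta>>0. \<forall>D. finite D \<and> (\<forall>(x, y)\<in>D. a \<le> x \<and> x < y \<and> y \<le> b) \<and>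
        disjoint_family_on (\<lambda>(x, y). {x<..<y}) D \<and> (\<Sum>(x, y)\<in>D. y - x) < \<delta>
        \<longrightarrow> (\<Sum>(x, y)\<in>D. dist (f x) (f y)) < \<epsilon>)"

text \<open>On a compact interval this is absolute continuity; on other intervals it is local absolute
  continuity.\<close>

definition abs_continuous_curve ::
  "('m::topological_space, 'e::euclidean_space) chart set \<Rightarrow> real set \<Rightarrow> (real \<Rightarrow> 'm) \<Rightarrow> bool" where
  "abs_continuous_curve A I \<gamma> \<longleftrightarrow> continuous_on I \<gamma> \<and>
     (\<forall>c\<in>A. \<forall>a b. a \<le> b \<and> {a..b} \<subseteq> I \<and> \<gamma> ` {a..b} \<subseteq> fst c \<longrightarrow> abs_continuous_on a b (snd c \<circ> \<gamma>))"


section \<open>Lie groups\<close>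

locale lie_group = smooth_manifold E A + group mul unit ginv
  for E :: "'e::euclidean_space set"
    and A :: "('g::{t2_space, second_countable_topology}, 'e) chart set"
    and mul :: "'g \<Rightarrow> 'g \<Rightarrow> 'g" and unit :: 'g and ginv :: "'g \<Rightarrow> 'g" +
  assumes mul_smooth: "smooth_map (E \<times> E) (prod_atlas A A) A (\<lambda>(x, y). mul x y)"
    and ginv_smooth: "smooth_map E A A ginv"
begin

text \<open>The underlying vector space of the Lie algebra is the tangent space at \<open>unit\<close>, that is, \<open>E\<close>.\<close>

definition dL :: "'g \<Rightarrow> 'e \<Rightarrow> 'e" where
  "dL g = differential E A A (mul g) unit"

definition Ad :: "'g \<Rightarrow> 'e \<Rightarrow> 'e" where
  "Ad g = differential E A A (\<lambda>x. mul (mul g x) (ginv g)) unit"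

text \<open>The left-invariant vector field \<open>p \<mapsto> dL\<^sub>p v\<close>, written in the single chart selected at
  \<open>unit\<close>: the differential of left translation by the point with coordinates \<open>x\<close>.\<close>

definition left_invariant_field :: "'e \<Rightarrow> 'e \<Rightarrow> 'e" where
  "left_invariant_field v x =
     (let c = chart_at A unit in
       frechet_derivative (\<lambda>y. snd c (mul (chart_inv c x) (chart_inv c y)))
         (at (snd c unit) within E) v)"

text \<open>The commutator of left-invariant vector fields at \<open>unit\<close>: in coordinates,
  \<open>[X, Y] = DY(X) - DX(Y)\<close>.\<close>

definition bracket :: "'e \<Rightarrow> 'e \<Rightarrow> 'e" where
  "bracket v w =
     (let z = snd (chart_at A unit) unit; X = left_invariant_field v; Y = left_invariant_field w in
       frechet_derivative Y (at z within E) (X z) - frechet_derivative X (at z within E) (Y z))"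

definition lie_subalgebra :: "'e set \<Rightarrow> bool" where
  "lie_subalgebra W \<longleftrightarrow> subspace W \<and> W \<subseteq> E \<and> (\<forall>v\<in>W. \<forall>w\<in>W. bracket v w \<in> W)"

definition bracket_generating :: "'e set \<Rightarrow> bool" where
  "bracket_generating V \<longleftrightarrow> lie_subalgebra hull V = E"

end


section \<open>Sub-Finsler Lie groups and normal curves\<close>

definition norm_on :: "'a::real_vector set \<Rightarrow> ('a \<Rightarrow> real) \<Rightarrow> bool" where
  "norm_on V N \<longleftrightarrow>
     (\<forall>v\<in>V. 0 \<le> N v) \<and> (\<forall>v\<in>V. N v = 0 \<longleftrightarrow> v = 0) \<and>
     (\<forall>r. \<forall>v\<in>V. N (r *\<^sub>R v) = \<bar>r\<bar> * N v) \<and> (\<forall>v\<in>V. \<forall>w\<in>V. N (v + w) \<le> N v + N w)"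

text \<open>Linear functionals on a subspace \<open>W\<close>; their values outside \<open>W\<close> are irrelevant.\<close>

definition dual_space :: "'a::real_vector set \<Rightarrow> ('a \<Rightarrow> real) set" where
  "dual_space W = {\<eta>. (\<forall>v\<in>W. \<forall>w\<in>W. \<eta> (v + w) = \<eta> v + \<eta> w) \<and> (\<forall>r. \<forall>v\<in>W. \<eta> (r *\<^sub>R v) = r * \<eta> v)}"

locale sub_finsler_lie_group = lie_group E A mul unit ginv
  for E :: "'e::euclidean_space set"
    and A :: "('g::{t2_space, second_countable_topology}, 'e) chart set"
    and mul :: "'g \<Rightarrow> 'g \<Rightarrow> 'g" and unit :: 'g and ginv :: "'g \<Rightarrow> 'g" +
  fixes V :: "'e set" and N :: "'e \<Rightarrow> real"
  assumes polarization: "subspace V" "V \<subseteq> E"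
    and generating: "bracket_generating V"
    and norm_V: "norm_on V N"
begin

definition horizontal_curve :: "real set \<Rightarrow> (real \<Rightarrow> 'g) \<Rightarrow> bool" where
  "horizontal_curve I \<gamma> \<longleftrightarrow> is_interval I \<and> abs_continuous_curve A I \<gamma> \<and>
     (AE t in lebesgue_on I. has_velocity_at A I \<gamma> t \<and> velocity A I \<gamma> t \<in> dL (\<gamma> t) ` V)"

definition control :: "real set \<Rightarrow> (real \<Rightarrow> 'g) \<Rightarrow> real \<Rightarrow> 'e" where
  "control I \<gamma> t = inv_into E (dL (\<gamma> t)) (velocity A I \<gamma> t)"

definition energy :: "'e \<Rightarrow> real" where
  "energy v = (N v)\<^sup>2 / 2"

definition subdifferential :: "'e \<Rightarrow> ('e \<Rightarrow> real) set" where
  "subdifferential w = {\<eta> \<in> dual_space V. \<forall>v\<in>V. \<eta> (v - w) \<le> energy v - energy w}"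

text \<open>The second and third conjuncts say that the control belongs to \<open>L\<^sup>2(I, V)\<close>.\<close>

definition normal_curve :: "real set \<Rightarrow> (real \<Rightarrow> 'g) \<Rightarrow> ('e \<Rightarrow> real) \<Rightarrow> bool" where
  "normal_curve I \<gamma> \<xi> \<longleftrightarrow> horizontal_curve I \<gamma> \<and>
     control I \<gamma> \<in> borel_measurable (lebesgue_on I) \<and>
     integrable (lebesgue_on I) (\<lambda>t. (N (control I \<gamma> t))\<^sup>2) \<and>
     (AE t in lebesgue_on I. \<xi> \<circ> Ad (\<gamma> t) \<in> subdifferential (control I \<gamma> t))"

end

end

theory Submission
  imports Defs "HOL-Complex_Analysis.Great_Picard"
begin

text \<open>Let \<open>C\<close> be the dual norm of \<open>\<xi> \<circ> Ad g\<close> on \<open>V\<close> and \<open>K\<close> the ball of radius \<open>C\<close> in \<open>V\<close>. A curve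
  whose control maximizes \<open>\<xi> \<circ> Ad \<gamma>\<close> over \<open>K\<close> satisfies a differential inclusion with compact convex
  values depending upper semicontinuously on \<open>\<gamma>\<close>. Locally it is solved in the chart at the unit by
  limits of Euler polygons, on a time interval that depends only on \<open>K\<close> because the inclusion is
  left-invariant up to the change of covector; hence solutions extend to \<open>[0, 1]\<close>. Since
  \<open>ad u u = 0\<close>, the maximum of \<open>\<xi> \<circ> Ad \<gamma>\<close> over \<open>K\<close> is constant along solutions, so it stays equal to
  its initial value \<open>C\<^sup>2\<close>. This forces the control to have norm \<open>C\<close> and \<open>\<xi> \<circ> Ad \<gamma>\<close> to have dual norm
  \<open>C\<close>, and then the subdifferential condition is \<open>C b \<le> (C\<^sup>2 + b\<^sup>2) / 2\<close>.\<close>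

section \<open>Lipschitz functions of one real variable\<close>

text \<open>The norm need be neither smooth nor strictly convex, so the covector does not determine
  the control: the maximizers form a convex set that may have many points, and a selection from it
  is in general discontinuous. This rules out an ordinary differential equation with continuous
  right-hand side. Fixing the ball \<open>K\<close> in advance, instead of maximizing
  \<open>\<xi> (Ad (\<gamma> t) v) - energy v\<close> over \<open>V\<close>, gives one bound for all
  velocities; the correct size of the control is recovered from the conserved maximum. Solutions and
  conserved quantity are merely Lipschitz, so two facts about Lipschitz functions on the line are
  needed: differentiability almost everywhere, and constancy when the derivative vanishes almost
  everywhere. In the conservation argument the maximum is compared with the pairing for one frozen
  control, which touches it from below. The radius \<open>C = 0\<close> and the model space
  \<open>{0}\<close> lead to constant curves.\<close>

text \<open>Vitali covering: the intervals on which \<open>f\<close> has quotient at most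
  \<open>p\<close> form a fine cover of \<open>S\<close>, so disjoint ones exhaust \<open>S\<close>
  up to a null set, which a Lipschitz map keeps null. Their images are intervals at most
  \<open>p\<close> times as long. The point \<open>x\<close> is only asked to lie in
  \<open>cball c r\<close>, because a difference quotient has \<open>x\<close> as an end point and
  not as the centre.\<close>

lemma emeasure_image_le_small_quotient:
  fixes f :: "real \<Rightarrow> real"
  assumes mono: "strict_mono f" and lip: "L-lipschitz_on UNIV f"
    and p: "0 < p"
    and SL: "S \<in> sets lebesgue"
    and quot: "\<And>x d. x \<in> S \<Longrightarrow> 0 < d \<Longrightarrow>
      \<exists>c r. 0 < r \<and> r < d \<and> x \<in> cball c r \<and> f (c + r) - f (c - r) \<le> p * (2 * r)"
  shows "emeasure lebesgue (f ` S) \<le> ennreal p * emeasure lebesgue S"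
proof (cases "emeasure lebesgue S = \<infinity>")
  case True
  then show ?thesis using p by (simp add: ennreal_mult_top)
next
  case False
  have cont: "continuous_on UNIV f" using lip by (rule lipschitz_on_continuous_on)
  have img: "f ` cball c r = {f (c - r)..f (c + r)}" if "0 < r" for c r
  proof
    show "f ` cball c r \<subseteq> {f (c - r)..f (c + r)}"
      using strict_mono_less_eq[OF mono] by (auto simp: dist_real_def abs_le_iff)
    show "{f (c - r)..f (c + r)} \<subseteq> f ` cball c r"
    proof
      fix y assume "y \<in> {f (c - r)..f (c + r)}"
      then obtain x where "c - r \<le> x" "x \<le> c + r" "f x = y"
        using IVT'[of f "c - r" y "c + r", OF _ _ _ continuous_on_subset[OF cont subset_UNIV]]
          less_imp_le[OF \<open>0 < r\<close>] by auto
      then show "y \<in> f ` cball c r" by (auto simp: dist_real_def abs_le_iff intro!: image_eqI[of _ _ x])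
    qed
  qed
  have key: "emeasure lebesgue (f ` S) \<le> ennreal p * (emeasure lebesgue S + ennreal e)" if "0 < e" for e
  proof -
    \<comment> \<open>An open set barely larger than \<open>S\<close>: the covering balls are kept
      inside it, which bounds their total length.\<close>
    obtain T where T: "open T" "S \<subseteq> T" "T - S \<in> lmeasurable" "emeasure lebesgue (T - S) < ennreal e"
      using sets_lebesgue_outer_open[OF SL \<open>0 < e\<close>] by metis
    define K where "K = {(c, r). 0 < r \<and> cball c r \<subseteq> T \<and> f (c + r) - f (c - r) \<le> p * (2 * r)}"
    have fine: "\<exists>i. i \<in> K \<and> x \<in> cball (fst i) (snd i) \<and> snd i < d" if "x \<in> S" "0 < d" for x d
    proof -
      obtain e where e: "0 < e" "ball x e \<subseteq> T"
        using T(1,2) \<open>x \<in> S\<close> open_contains_ball by blast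
      obtain c r where cr: "0 < r" "r < min d (e / 2)" "x \<in> cball c r" "f (c + r) - f (c - r) \<le> p * (2 * r)"
        using quot[OF \<open>x \<in> S\<close>, of "min d (e / 2)"] e \<open>0 < d\<close> by auto
      have "cball c r \<subseteq> ball x e"
        using cr by (auto simp: dist_real_def)
      with cr e show ?thesis by (intro exI[of _ "(c, r)"]) (auto simp: K_def)
    qed
    have pos: "0 < snd i" if "i \<in> K" for i
      using that by (auto simp: K_def)
    obtain C where C: "countable C" "C \<subseteq> K"
      "pairwise (\<lambda>i j. disjnt (cball (fst i) (snd i)) (cball (fst j) (snd j))) C"
      "negligible (S - (\<Union>i \<in> C. cball (fst i) (snd i)))"
      by (rule Vitali_covering_theorem_cballs[of K snd S fst]) (use pos fine in blast)+
    define U where "U = (\<Union>i \<in> C. cball (fst i) (snd i))"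
    have disj: "disjoint_family_on (\<lambda>i. cball (fst i) (snd i)) C"
      using C(3) by (auto simp: disjoint_family_on_def pairwise_def disjnt_def)
    have disjf: "disjoint_family_on (\<lambda>i. f ` cball (fst i) (snd i)) C"
      unfolding disjoint_family_on_def
    proof (intro ballI impI)
      fix i j assume "i \<in> C" "j \<in> C" "i \<noteq> j"
      then have "cball (fst i) (snd i) \<inter> cball (fst j) (snd j) = {}"
        using disj by (auto simp: disjoint_family_on_def)
      then show "f ` cball (fst i) (snd i) \<inter> f ` cball (fst j) (snd j) = {}"
        using strict_mono_eq[OF mono] by (metis image_Int image_empty injI)
    qed
    have meas: "(\<lambda>i. f ` cball (fst i) (snd i)) ` C \<subseteq> sets lebesgue"
      using img C(2) by (auto simp: K_def)
    have neg: "negligible (f ` (S - U))"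
      using C(4) lipschitz_onD[OF lip]
      by (intro negligible_locally_Lipschitz_image)
         (auto simp: U_def dist_norm intro!: exI[of _ UNIV] exI[of _ L])
    have "emeasure lebesgue (f ` S) \<le> emeasure lebesgue (f ` (S - U) \<union> f ` U)"
    proof (rule emeasure_mono)
      have "f ` U = (\<Union>i\<in>C. f ` cball (fst i) (snd i))" by (auto simp: U_def)
      then show "f ` (S - U) \<union> f ` U \<in> sets lebesgue"
        using sets.Un[OF negligible_imp_sets[OF neg] sets.countable_UN'[OF C(1) meas]] by simp
    qed auto
    also have "\<dots> \<le> emeasure lebesgue (f ` (S - U)) + emeasure lebesgue (f ` U)"
    proof (rule emeasure_subadditive)
      have "f ` U = (\<Union>i\<in>C. f ` cball (fst i) (snd i))" by (auto simp: U_def)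
      then show "f ` U \<in> sets lebesgue"
        using sets.countable_UN'[OF C(1) meas] by simp
    qed (rule negligible_imp_sets[OF neg])
    also have "emeasure lebesgue (f ` (S - U)) = 0"
      using neg negligible_iff_emeasure0[OF negligible_imp_sets[OF neg]] by blast
    also have "f ` U = (\<Union>i\<in>C. f ` cball (fst i) (snd i))" by (auto simp: U_def)
    also have "emeasure lebesgue \<dots> = (\<integral>\<^sup>+i. emeasure lebesgue (f ` cball (fst i) (snd i)) \<partial>count_space C)"
      by (rule emeasure_UN_countable[OF _ C(1) disjf]) (use meas in auto)
    also have "\<dots> \<le> (\<integral>\<^sup>+i. ennreal p * emeasure lebesgue (cball (fst i) (snd i)) \<partial>count_space C)"
    proof (rule nn_integral_mono)
      fix i assume "i \<in> space (count_space C)"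
      then have i: "0 < snd i" "f (fst i + snd i) - f (fst i - snd i) \<le> p * (2 * snd i)"
        using C(2) by (auto simp: K_def)
      have le: "f (fst i - snd i) \<le> f (fst i + snd i)"
        using strict_mono_less_eq[OF mono] i by auto
      have "emeasure lebesgue (f ` cball (fst i) (snd i)) = ennreal (f (fst i + snd i) - f (fst i - snd i))"
        using img[OF i(1)] le by simp
      also have "\<dots> \<le> ennreal (p * (2 * snd i))" using i by (intro ennreal_leI)
      also have "\<dots> = ennreal p * emeasure lebesgue (cball (fst i) (snd i))"
        using i p by (simp add: cball_eq_atLeastAtMost ennreal_mult)
      finally show "emeasure lebesgue (f ` cball (fst i) (snd i)) \<le> \<dots>" .
    qed
    also have "\<dots> = ennreal p * (\<integral>\<^sup>+i. emeasure lebesgue (cball (fst i) (snd i)) \<partial>count_space C)"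
      by (rule nn_integral_cmult) auto
    also have "(\<integral>\<^sup>+i. emeasure lebesgue (cball (fst i) (snd i)) \<partial>count_space C) = emeasure lebesgue U"
      unfolding U_def using disj C(1) by (intro emeasure_UN_countable[symmetric]) auto
    also have "emeasure lebesgue U \<le> emeasure lebesgue T"
      using C(2) T(1) by (intro emeasure_mono) (auto simp: U_def K_def subset_iff)
    also have "emeasure lebesgue T \<le> emeasure lebesgue S + ennreal e"
    proof -
      have "emeasure lebesgue T = emeasure lebesgue (S \<union> (T - S))"
        using T by (simp add: Un_absorb1)
      also have "\<dots> \<le> emeasure lebesgue S + emeasure lebesgue (T - S)"
        using SL T by (intro emeasure_subadditive) auto
      also have "\<dots> \<le> emeasure lebesgue S + ennreal e"
        using less_imp_le[OF T(4)] by (rule add_left_mono)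
      finally show ?thesis .
    qed
    finally show ?thesis by (simp add: mult_left_mono)
  qed
  show ?thesis
  proof (rule ennreal_le_epsilon)
    fix e :: real assume "0 < e"
    have "emeasure lebesgue (f ` S) \<le> ennreal p * (emeasure lebesgue S + ennreal (e / p))"
      using key[of "e / p"] \<open>0 < e\<close> p by simp
    also have "\<dots> = ennreal p * emeasure lebesgue S + ennreal e"
      using p \<open>0 < e\<close> by (simp add: distrib_left ennreal_mult[symmetric])
    finally show "emeasure lebesgue (f ` S) \<le> ennreal p * emeasure lebesgue S + ennreal e" .
  qed
qed


section \<open>Lipschitz functions whose derivative vanishes almost everywhere\<close>

text \<open>The slope \<open>L + 1\<close> exceeds the Lipschitz constant by one, so difference
  quotients of \<open>F\<close> lie between 1 and \<open>2 * L + 1\<close>. Monotonicity turns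
  images of intervals into intervals, whose lengths can be compared.\<close>

lemma lipschitz_add_linear_strict_mono:
  fixes f :: "real \<Rightarrow> real"
  assumes lip: "L-lipschitz_on UNIV f"
    and F_def: "\<And>x. F x = f x + (L + 1) * x"
  shows "x \<le> y \<Longrightarrow> y - x \<le> F y - F x" and "strict_mono F" and "(2 * L + 1)-lipschitz_on UNIV F"
proof -
  have L: "0 \<le> L" using lip by (rule lipschitz_on_nonneg)
  have d: "\<bar>f y - f x\<bar> \<le> L * (y - x)" if "x \<le> y" for x y
    using lipschitz_onD[OF lip, of y x] that by (simp add: dist_real_def)
  show *: "y - x \<le> F y - F x" if "x \<le> y" for x y
    using d[OF that] by (simp add: F_def algebra_simps)
  show "strict_mono F"
  proof (rule strict_monoI)
    fix x y :: real assume "x < y"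
    then show "F x < F y" using *[of x y] by simp
  qed
  have "\<bar>F y - F x\<bar> \<le> (2 * L + 1) * (y - x)" if "x \<le> y" for x y
    using *[OF that] d[OF that] that by (simp add: F_def algebra_simps)
  then have "\<bar>F x - F y\<bar> \<le> (2 * L + 1) * \<bar>x - y\<bar>" for x y
    using abs_minus_commute by (cases "x \<le> y") (smt (verit))+
  then show "(2 * L + 1)-lipschitz_on UNIV F"
    using L by (auto intro!: lipschitz_onI simp: dist_real_def)
qed

text \<open>Off the null set the quotients of \<open>F\<close> tend to \<open>L + 1\<close>, so the
  covering estimate bounds the length \<open>F b - F a\<close> of the image of \<open>{a..b}\<close>
  by \<open>(L + 1 + e) * (b - a)\<close>; the exceptional points have null image. Removing the
  linear part leaves \<open>f b - f a \<le> e * (b - a)\<close>.\<close>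

lemma lipschitz_derivative_zero_ae_le:
  fixes f :: "real \<Rightarrow> real"
  assumes lip: "L-lipschitz_on UNIV f" and ab: "a \<le> b" and N: "negligible N"
    and der: "\<And>x. x \<in> {a<..<b} - N \<Longrightarrow> (f has_real_derivative 0) (at x)"
  shows "f b \<le> f a"
proof -
  define F where "F = (\<lambda>x. f x + (L + 1) * x)"
  have Feq: "F x = f x + (L + 1) * x" for x by (simp add: F_def)
  note F = lipschitz_add_linear_strict_mono[OF lip Feq]
  have L: "0 \<le> L" using lip by (rule lipschitz_on_nonneg)
  define S where "S = {a<..<b} - N"
  have SL: "S \<in> sets lebesgue" using N by (auto simp: S_def negligible_imp_sets)
  have negS: "negligible ({a..b} - S)"
    by (rule negligible_subset[of "N \<union> {a, b}"]) (use N in \<open>auto simp: S_def\<close>)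
  have img: "F ` {a..b} = {F a..F b}"
  proof
    show "F ` {a..b} \<subseteq> {F a..F b}" using strict_mono_less_eq[OF F(2)] by auto
    show "{F a..F b} \<subseteq> F ` {a..b}"
      using IVT'[of F a _ b] ab continuous_on_subset[OF lipschitz_on_continuous_on[OF F(3)] subset_UNIV]
      by (auto simp: image_iff) (metis atLeastAtMost_iff)
  qed
  have negF: "negligible (F ` ({a..b} - S))"
    using negS lipschitz_onD[OF F(3)]
    by (intro negligible_locally_Lipschitz_image)
       (auto simp: dist_norm intro!: exI[of _ UNIV] exI[of _ "2 * L + 1"])
  have FS: "F ` S = {F a..F b} - F ` ({a..b} - S)"
    unfolding img[symmetric] using strict_mono_eq[OF F(2)] by (auto simp: S_def)
  have FSm: "F ` S \<in> sets lebesgue"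
    unfolding FS by (rule sets.Diff[OF _ negligible_imp_sets[OF negF]]) simp
  have le: "F b - F a \<le> (L + 1 + e) * (b - a)" if "0 < e" for e
  proof -
    have "emeasure lebesgue (F ` S) \<le> ennreal (L + 1 + e) * emeasure lebesgue S"
    proof (rule emeasure_image_le_small_quotient[OF F(2,3) _ SL])
      show "0 < L + 1 + e" using L that by simp
      fix x d :: real assume "x \<in> S" "0 < d"
      then have "(f has_real_derivative 0) (at x)" using der by (auto simp: S_def)
      then have "\<forall>\<^sub>F h in at 0. \<bar>(f (x + h) - f x) / h - 0\<bar> < e"
        unfolding DERIV_def using tendstoD[of _ _ "at 0" e] that by (fastforce simp: dist_real_def)
      then obtain \<delta> where \<delta>: "\<delta> > 0" "\<And>h. h \<noteq> 0 \<Longrightarrow> \<bar>h\<bar> < \<delta> \<Longrightarrow> \<bar>(f (x + h) - f x) / h\<bar> < e"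
        unfolding eventually_at by (auto simp: dist_real_def)
      define h where "h = min d \<delta> / 2"
      have h: "0 < h" "h < d" "h < \<delta>" using \<delta>(1) \<open>0 < d\<close> by (auto simp: h_def)
      have "\<bar>(f (x + h) - f x) / h\<bar> < e" using \<delta>(2)[of h] h by simp
      then have "(f (x + h) - f x) / h < e" by linarith
      then have "f (x + h) - f x < e * h" using h by (simp add: field_simps)
      then have "F (x + h) - F x \<le> (L + 1 + e) * h" by (simp add: F_def algebra_simps)
      then have "F (x + h / 2 + h / 2) - F (x + h / 2 - h / 2) \<le> (L + 1 + e) * (2 * (h / 2))" by (simp add: add.commute)
      moreover have "0 < h / 2" "h / 2 < d" "x \<in> cball (x + h / 2) (h / 2)"
        using h by (auto simp: dist_real_def)
      ultimately show "\<exists>c r. 0 < r \<and> r < d \<and> x \<in> cball c r \<and> F (c + r) - F (c - r) \<le> (L + 1 + e) * (2 * r)"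
        by blast
    qed
    also have "emeasure lebesgue S \<le> emeasure lebesgue {a..b}"
      by (rule emeasure_mono) (auto simp: S_def)
    finally have 1: "emeasure lebesgue (F ` S) \<le> ennreal ((L + 1 + e) * (b - a))"
      using L that ab by (simp add: ennreal_mult mult_left_mono)
    have "emeasure lebesgue {F a..F b} = emeasure lebesgue (F ` S \<union> F ` ({a..b} - S))"
      unfolding img[symmetric] by (rule arg_cong[of _ _ "emeasure lebesgue"]) (auto simp: S_def)
    also have "\<dots> \<le> emeasure lebesgue (F ` S) + emeasure lebesgue (F ` ({a..b} - S))"
      by (rule emeasure_subadditive[OF FSm negligible_imp_sets[OF negF]])
    also have "emeasure lebesgue (F ` ({a..b} - S)) = 0"
      using negF negligible_iff_emeasure0[OF negligible_imp_sets[OF negF]] by blast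
    finally have "ennreal (F b - F a) \<le> ennreal ((L + 1 + e) * (b - a))"
      using order_trans[OF _ 1] strict_mono_less_eq[OF F(2), of a b] ab by simp
    then show ?thesis using L that ab by (simp add: ennreal_le_iff)
  qed
  have "f b - f a \<le> e" if "0 < e" for e
  proof -
    have "f b - f a \<le> e / (b - a + 1) * (b - a)"
      using le[of "e / (b - a + 1)"] that ab by (simp add: F_def algebra_simps)
    also have "\<dots> \<le> e" using that ab by (simp add: field_simps)
    finally show ?thesis .
  qed
  then show ?thesis using field_le_epsilon[of "f b" "f a"] by (simp add: algebra_simps)
qed

lemma lipschitz_derivative_zero_ae:
  fixes f :: "real \<Rightarrow> real"
  assumes "L-lipschitz_on UNIV f" "a \<le> b" "negligible N"
    and "\<And>x. x \<in> {a<..<b} - N \<Longrightarrow> (f has_real_derivative 0) (at x)"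
  shows "f b = f a"
proof (rule antisym)
  show "f b \<le> f a" using assms by (rule lipschitz_derivative_zero_ae_le)
  have "(\<lambda>x. - f x) b \<le> (\<lambda>x. - f x) a"
  proof (rule lipschitz_derivative_zero_ae_le[OF _ assms(2,3)])
    show "L-lipschitz_on UNIV (\<lambda>x. - f x)" using assms(1) by simp
    show "((\<lambda>x. - f x) has_real_derivative 0) (at x)" if "x \<in> {a<..<b} - N" for x
      using DERIV_minus[OF assms(4)[OF that]] by simp
  qed
  then show "f a \<le> f b" by simp
qed

text \<open>Adding a linear function makes \<open>f\<close> a bi-Lipschitz homeomorphism \<open>F\<close>. On the set where \<open>F\<close> has
  difference quotients below \<open>p\<close> and above \<open>q > p\<close>, the bound on the measure of the image applies to \<open>F\<close>
  with \<open>p\<close> and to its inverse with \<open>1 / q\<close>, so the set has measure at most \<open>p / q\<close> times its measure.\<close>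

lemma lipschitz_real_differentiable_ae:
  fixes f :: "real \<Rightarrow> real"
  assumes lip: "L-lipschitz_on UNIV f"
  shows "negligible {x. \<not> f differentiable (at x)}"
proof -
  define F where "F = (\<lambda>x. f x + (L + 1) * x)"
  have Feq: "F x = f x + (L + 1) * x" for x by (simp add: F_def)
  note F = lipschitz_add_linear_strict_mono[OF lip Feq]
  have L: "0 \<le> L" using lip by (rule lipschitz_on_nonneg)
  have contF: "continuous_on UNIV F" by (rule lipschitz_on_continuous_on[OF F(3)])
  have injF: "inj F" using F(2) by (rule strict_mono_imp_inj_on)
  have surjF: "\<exists>x. F x = y" for y
  proof -
    define r where "r = \<bar>y - F 0\<bar>"
    have "F (- r) \<le> y" "y \<le> F r" using F(1)[of "-r" 0] F(1)[of 0 r] by (auto simp: r_def)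
    then show ?thesis
      using IVT'[of F "-r" y r] continuous_on_subset[OF contF subset_UNIV] by (auto simp: r_def)
  qed
  define G where "G = inv F"
  have GF [simp]: "G (F x) = x" for x using injF by (simp add: G_def)
  have FG [simp]: "F (G y) = y" for y using surjF by (metis GF)
  have Gmono: "strict_mono G"
    by (rule strict_monoI) (metis FG F(2) strict_mono_less)
  have "\<bar>G x - G y\<bar> \<le> \<bar>x - y\<bar>" for x y
  proof -
    have "\<bar>a - b\<bar> \<le> \<bar>F a - F b\<bar>" for a b
      using F(1)[of a b] F(1)[of b a] by (smt (verit))
    from this[of "G x" "G y"] show ?thesis by simp
  qed
  then have Glip: "1-lipschitz_on UNIV G" by (auto intro!: lipschitz_onI simp: dist_real_def)
  have contG: "continuous_on UNIV G" by (rule lipschitz_on_continuous_on[OF Glip])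
  define Q where "Q x h = (F (x + h) - F x) / h" for x h
  have Qge: "1 \<le> Q x h" if "h \<noteq> 0" for x h
    using F(1)[of x "x + h"] F(1)[of "x + h" x] that by (cases "h > 0") (auto simp: Q_def field_simps)
  have Qle: "Q x h \<le> 2 * L + 1" if "h \<noteq> 0" for x h
  proof -
    have "\<bar>F (x + h) - F x\<bar> \<le> (2 * L + 1) * \<bar>h\<bar>"
      using lipschitz_onD[OF F(3), of "x + h" x] by (simp add: dist_real_def)
    then have "\<bar>Q x h\<bar> \<le> 2 * L + 1" using that by (simp add: Q_def abs_divide field_simps)
    then show ?thesis by simp
  qed
  have contQ: "continuous_on UNIV (\<lambda>x. Q x h)" if "h \<noteq> 0" for h
  proof -
    have "continuous_on UNIV (\<lambda>x. F (x + h))"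
      by (rule continuous_on_compose2[OF contF]) (auto intro!: continuous_intros)
    then show ?thesis
      unfolding Q_def using that contF by (intro continuous_intros) auto
  qed
  \<comment> \<open>As unions of open sets over all small \<open>h\<close>, the sets
    \<open>D p n\<close> and \<open>U q n\<close> are open, which gives measurability of
    \<open>X p q R\<close> without restricting \<open>h\<close> to a countable set.\<close>
  define D where "D p n = (\<Union>h\<in>{h. h \<noteq> 0 \<and> \<bar>h\<bar> < 1 / Suc n}. {x. Q x h < p})" for p n
  define U where "U q n = (\<Union>h\<in>{h. h \<noteq> 0 \<and> \<bar>h\<bar> < 1 / Suc n}. {x. q < Q x h})" for q n
  have opD: "open (D p n)" for p n
    unfolding D_def using contQ by (intro open_UN ballI open_Collect_less) (auto intro!: continuous_intros)
  have opU: "open (U p n)" for p n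
    unfolding U_def using contQ by (intro open_UN ballI open_Collect_less) (auto intro!: continuous_intros)
  \<comment> \<open>Quotients below \<open>p\<close> and above \<open>q\<close> both occur here at
    arbitrarily small scales. The bound by \<open>R\<close> makes the measure \<open>m\<close>
    finite, so that \<open>m \<le> p / q * m\<close> forces \<open>m = 0\<close>.\<close>
  define X where "X p q R = {-real R<..<real R} \<inter> (\<Inter>n. D p n) \<inter> (\<Inter>n. U q n)" for p q and R :: nat
  have null: "negligible (X p q R)" if pq: "0 < p" "p < q" for p q R
  proof -
    have "X p q R \<in> sets borel"
      unfolding X_def using opD opU by (intro sets.Int sets.countable_INT) auto
    then have XL: "X p q R \<in> sets lebesgue" and "G -` X p q R \<in> sets borel"
      using measurable_sets_borel[OF borel_measurable_continuous_onI[OF contG]] by auto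
    moreover have "G -` X p q R = F ` X p q R" by (auto simp: image_iff) (metis FG)
    ultimately have FXL: "F ` X p q R \<in> sets lebesgue" by auto
    have 1: "emeasure lebesgue (F ` X p q R) \<le> ennreal p * emeasure lebesgue (X p q R)"
    proof (rule emeasure_image_le_small_quotient[OF F(2,3) \<open>0 < p\<close> XL])
      fix x d :: real assume x: "x \<in> X p q R" and "0 < d"
      then obtain n where n: "1 / Suc n < d" using nat_approx_posE by metis
      obtain h where h: "h \<noteq> 0" "\<bar>h\<bar> < 1 / Suc n" "Q x h < p"
        using x by (auto simp: X_def D_def)
      \<comment> \<open>Whatever the sign of \<open>h\<close>, the interval with end points
        \<open>x\<close> and \<open>x + h\<close> has centre \<open>x + h / 2\<close> and radius
        \<open>\<bar>h\<bar> / 2\<close>.\<close>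
      have "{x + h / 2 - \<bar>h\<bar> / 2, x + h / 2 + \<bar>h\<bar> / 2} = {x, x + h}" "x + h / 2 - \<bar>h\<bar> / 2 < x + h / 2 + \<bar>h\<bar> / 2"
        using h(1) by (auto simp: abs_if)
      then have eq: "F (x + h / 2 + \<bar>h\<bar> / 2) - F (x + h / 2 - \<bar>h\<bar> / 2) = Q x h * \<bar>h\<bar>"
        using h(1) by (auto simp: doubleton_eq_iff Q_def abs_if add.commute split: if_splits)
      have "Q x h * \<bar>h\<bar> \<le> p * (2 * (\<bar>h\<bar> / 2))" using h by simp
      moreover have "0 < \<bar>h\<bar> / 2" "\<bar>h\<bar> / 2 < d" "x \<in> cball (x + h / 2) (\<bar>h\<bar> / 2)"
        using h n by (auto simp: dist_real_def)
      ultimately show "\<exists>c r. 0 < r \<and> r < d \<and> x \<in> cball c r \<and> F (c + r) - F (c - r) \<le> p * (2 * r)"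
        using eq by metis
    qed
    have 2: "emeasure lebesgue (G ` (F ` X p q R)) \<le> ennreal (1 / q) * emeasure lebesgue (F ` X p q R)"
    proof (rule emeasure_image_le_small_quotient[OF Gmono Glip _ FXL])
      show "0 < 1 / q" using pq by simp
      fix y d :: real assume y: "y \<in> F ` X p q R" and "0 < d"
      then obtain x where x: "x \<in> X p q R" "y = F x" by auto
      \<comment> \<open>\<open>F\<close> stretches by at most \<open>2 * L + 1\<close>, so the
        interval between \<open>F x\<close> and \<open>F (x + h)\<close> becomes shorter than
        \<open>d\<close>.\<close>
      obtain n where n: "1 / Suc n < d / (2 * L + 1)"
        using nat_approx_posE[of "d / (2 * L + 1)"] \<open>0 < d\<close> L by auto
      obtain h where h: "h \<noteq> 0" "\<bar>h\<bar> < 1 / Suc n" "q < Q x h"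
        using x by (auto simp: X_def U_def)
      define r where "r = \<bar>F (x + h) - F x\<bar> / 2"
      have r2: "2 * r = Q x h * \<bar>h\<bar>"
        using Qge[OF h(1), of x] h(1) by (simp add: r_def Q_def abs_divide[symmetric] zero_less_divide_iff abs_if split: if_splits) (auto simp: field_simps)
      have r0: "0 < r" using r2 Qge[OF h(1), of x] h(1) by (smt (verit) mult_pos_pos zero_less_abs_iff)
      have "2 * r \<le> (2 * L + 1) * \<bar>h\<bar>" unfolding r2 using Qle[OF h(1)] by (intro mult_right_mono) auto
      also have "\<dots> < (2 * L + 1) * (d / (2 * L + 1))"
        using h(2) n L by (intro mult_strict_left_mono) auto
      also have "\<dots> = d" using L by simp
      finally have rd: "r < d" using r0 by simp
      define c where "c = (F x + F (x + h)) / 2"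
      have "{c - r, c + r} = {F x, F (x + h)}" "c - r < c + r"
        using r0 by (auto simp: c_def r_def abs_if field_simps)
      then have "G (c + r) - G (c - r) = \<bar>h\<bar>"
        using strict_mono_less[OF Gmono, of "c - r" "c + r"] by (auto simp: doubleton_eq_iff)
      also have "\<bar>h\<bar> \<le> 1 / q * (2 * r)"
        unfolding r2 using h pq by (simp add: field_simps)
      finally have "G (c + r) - G (c - r) \<le> 1 / q * (2 * r)" .
      moreover have "y \<in> cball c r" by (auto simp: x c_def r_def dist_real_def abs_if field_simps)
      ultimately show "\<exists>c r. 0 < r \<and> r < d \<and> y \<in> cball c r \<and> G (c + r) - G (c - r) \<le> 1 / q * (2 * r)"
        using r0 rd by blast
    qed
    have fin: "emeasure lebesgue (X p q R) < \<infinity>"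
    proof -
      have "emeasure lebesgue (X p q R) \<le> emeasure lebesgue {-real R<..<real R}"
        by (rule emeasure_mono) (auto simp: X_def)
      then show ?thesis by (rule order_le_less_trans) simp
    qed
    then obtain m where m: "emeasure lebesgue (X p q R) = ennreal m" "0 \<le> m"
      by (metis ennreal_cases infinity_ennreal_def less_irrefl)
    have "G ` (F ` X p q R) = X p q R" by (auto simp: image_image)
    then have "ennreal m \<le> ennreal (1 / q) * (ennreal p * ennreal m)"
      using order_trans[OF 2 mult_left_mono[OF 1]] m by simp
    also have "\<dots> = ennreal (p / q * m)" using pq m by (simp add: ennreal_mult[symmetric])
    finally have "m \<le> p / q * m" using pq m by (simp add: ennreal_le_iff)
    then have "m * (q - p) \<le> 0" using pq by (simp add: field_simps)
    then have "m = 0" using pq m by (simp add: mult_le_0_iff)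
    then show ?thesis using m XL by (simp add: negligible_iff_emeasure0)
  qed
  define I where "I = {(p :: real, q :: real, R :: nat). p \<in> \<rat> \<and> q \<in> \<rat> \<and> 0 < p \<and> p < q}"
  have cI: "countable I"
    by (rule countable_subset[of _ "\<rat> \<times> \<rat> \<times> UNIV"])
       (auto simp: I_def intro!: countable_SIGMA countable_rat)
  have "negligible (\<Union>((\<lambda>(p, q, R). X p q R) ` I))"
    using null cI by (intro negligible_countable_Union) (auto simp: I_def)
  moreover have "{x. \<not> f differentiable (at x)} \<subseteq> \<Union>((\<lambda>(p, q, R). X p q R) ` I)"
  proof
    fix x assume "x \<in> {x. \<not> f differentiable (at x)}"
    then have nd: "\<not> f differentiable (at x)" by simp
    define l where "l = Liminf (at 0) (\<lambda>h. ereal (Q x h))"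
    define u where "u = Limsup (at 0) (\<lambda>h. ereal (Q x h))"
    have ev: "\<forall>\<^sub>F h::real in at 0. h \<noteq> 0" by (simp add: eventually_at_filter)
    \<comment> \<open>The bounds 1 and \<open>2 * L + 1\<close> keep both limits finite; if they
      agreed, \<open>F\<close> and hence \<open>f\<close> would be differentiable at
      \<open>x\<close>.\<close>
    have l1: "ereal 1 \<le> l" unfolding l_def
      by (rule Liminf_bounded) (use Qge in \<open>auto intro: eventually_mono[OF ev]\<close>)
    have u1: "u \<le> ereal (2 * L + 1)" unfolding u_def
      by (rule Limsup_bounded) (use Qle in \<open>auto intro: eventually_mono[OF ev]\<close>)
    have lu: "l \<le> u" unfolding l_def u_def by (rule Liminf_le_Limsup) simp
    have "l \<noteq> u"
    proof
      assume "l = u"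
      then obtain l' where l': "l = ereal l'" using l1 u1 by (cases l) auto
      have "((\<lambda>h. ereal (Q x h)) \<longlongrightarrow> l) (at 0)"
        by (rule Liminf_eq_Limsup) (use \<open>l = u\<close> in \<open>auto simp: l_def u_def\<close>)
      then have "(Q x \<longlongrightarrow> l') (at 0)" unfolding l' by simp
      then have "(F has_real_derivative l') (at x)" unfolding DERIV_def Q_def .
      then have "((\<lambda>y. F y - (L + 1) * y) has_real_derivative l' - (L + 1) * 1) (at x)"
        by (intro DERIV_diff DERIV_cmult) auto
      then have "(f has_real_derivative l' - (L + 1) * 1) (at x)" by (simp add: F_def)
      then show False using nd real_differentiable_def by blast
    qed
    then have "l < u" using lu by simp
    obtain p where p: "l < ereal (of_rat p)" "ereal (of_rat p) < u"
      using ereal_dense3[OF \<open>l < u\<close>] by metis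
    obtain q where q: "ereal (of_rat p) < ereal (of_rat q)" "ereal (of_rat q) < u"
      using ereal_dense3[OF p(2)] by metis
    have "x \<in> D (of_rat p) n" for n
    proof (rule ccontr)
      assume "x \<notin> D (of_rat p) n"
      then have "ereal (of_rat p) \<le> ereal (Q x h)" if "h \<noteq> 0" "\<bar>h\<bar> < 1 / Suc n" for h
        using that by (force simp: D_def)
      then have "\<forall>\<^sub>F h in at 0. ereal (of_rat p) \<le> ereal (Q x h)"
        unfolding eventually_at by (intro exI[of _ "1 / Suc n"]) (auto simp: dist_real_def)
      then have "ereal (of_rat p) \<le> l" unfolding l_def by (rule Liminf_bounded)
      then show False using p by simp
    qed
    moreover have "x \<in> U (of_rat q) n" for n
    proof (rule ccontr)
      assume "x \<notin> U (of_rat q) n"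
      then have "ereal (Q x h) \<le> ereal (of_rat q)" if "h \<noteq> 0" "\<bar>h\<bar> < 1 / Suc n" for h
        using that by (force simp: U_def)
      then have "\<forall>\<^sub>F h in at 0. ereal (Q x h) \<le> ereal (of_rat q)"
        unfolding eventually_at by (intro exI[of _ "1 / Suc n"]) (auto simp: dist_real_def)
      then have "u \<le> ereal (of_rat q)" unfolding u_def by (rule Limsup_bounded)
      then show False using q by simp
    qed
    moreover obtain R :: nat where "\<bar>x\<bar> < real R" using reals_Archimedean2 by blast
    ultimately have "x \<in> X (of_rat p) (of_rat q) R" by (auto simp: X_def)
    moreover have "(of_rat p, of_rat q, R) \<in> I"
    proof -
      \<comment> \<open>Positivity of \<open>p\<close>, required in \<open>I\<close>, comes from the
        lower bound 1 on all quotients.\<close>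
      have "ereal 1 < ereal (of_rat p)" using l1 p(1) by (rule order_le_less_trans)
      then have "(1::real) < of_rat p" by simp
      moreover have "(of_rat p :: real) < of_rat q" using q(1) by simp
      ultimately show ?thesis by (simp add: I_def del: of_rat_less)
    qed
    ultimately show "x \<in> \<Union>((\<lambda>(p, q, R). X p q R) ` I)" by force
  qed
  ultimately show ?thesis by (rule negligible_subset)
qed

lemma lipschitz_differentiable_ae:
  fixes f :: "real \<Rightarrow> 'a::euclidean_space"
  assumes lip: "L-lipschitz_on UNIV f"
  shows "negligible {x. \<not> f differentiable (at x)}"
proof (rule negligible_subset)
  show "{x. \<not> f differentiable (at x)} \<subseteq> (\<Union>b\<in>Basis. {x. \<not> (\<lambda>y. f y \<bullet> b) differentiable (at x)})"
    using differentiable_componentwise_within[of f _ UNIV] by auto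
  have "negligible {x. \<not> (\<lambda>y. f y \<bullet> b) differentiable (at x)}" if b: "b \<in> Basis" for b
  proof (rule lipschitz_real_differentiable_ae)
    have "\<bar>(f x - f y) \<bullet> b\<bar> \<le> L * \<bar>x - y\<bar>" for x y
      using lipschitz_onD[OF lip, of x y] Basis_le_norm[OF b, of "f x - f y"]
      by (simp add: dist_norm)
    then show "L-lipschitz_on UNIV (\<lambda>y. f y \<bullet> b)"
      using lipschitz_on_nonneg[OF lip] by (auto intro!: lipschitz_onI simp: dist_real_def inner_diff_left)
  qed
  then show "negligible (\<Union>b\<in>Basis. {x. \<not> (\<lambda>y. f y \<bullet> b) differentiable (at x)})"
    by (intro negligible_Union) auto
qed

section \<open>Krasovskii solutions of differential inclusions\<close>

fun euler_nodes :: "('a::real_vector \<Rightarrow> 'a) \<Rightarrow> 'a \<Rightarrow> nat \<Rightarrow> nat \<Rightarrow> 'a" where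
  "euler_nodes v x0 n 0 = x0"
| "euler_nodes v x0 n (Suc k) =
    euler_nodes v x0 n k + (1 / Suc n) *\<^sub>R v (euler_nodes v x0 n k)"

definition euler_polygon :: "('a::real_vector \<Rightarrow> 'a) \<Rightarrow> 'a \<Rightarrow> nat \<Rightarrow> real \<Rightarrow> 'a" where
  "euler_polygon v x0 n t =
    (let k = nat \<lfloor>t * real (Suc n)\<rfloor>
     in euler_nodes v x0 n k + (t - real k / real (Suc n)) *\<^sub>R v (euler_nodes v x0 n k))"

text \<open>Half-space bounds on the field add up to half-space bounds on displacements. Unlike the
  values of a discontinuous field, such bounds survive refinement of the polygons.\<close>

lemma euler_nodes_inner_le:
  assumes "j \<le> k" and "\<And>i. j \<le> i \<Longrightarrow> i < k \<Longrightarrow> w \<bullet> v (euler_nodes v x0 n i) \<le> b"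
  shows "w \<bullet> (euler_nodes v x0 n k - euler_nodes v x0 n j) \<le> b * (real (k - j) / real (Suc n))"
  using assms
proof (induction k rule: dec_induct)
  case base
  then show ?case by simp
next
  case (step k)
  have "w \<bullet> (euler_nodes v x0 n (Suc k) - euler_nodes v x0 n j) =
    w \<bullet> (euler_nodes v x0 n k - euler_nodes v x0 n j) + (1 / Suc n) * (w \<bullet> v (euler_nodes v x0 n k))"
    by (simp add: inner_add_right inner_diff_right)
  also have "\<dots> \<le> b * (real (k - j) / real (Suc n)) + (1 / Suc n) * b"
    using step by (intro add_mono mult_left_mono) auto
  also have "\<dots> = b * (real (Suc k - j) / real (Suc n))"
    using step(1) by (simp add: of_nat_diff diff_divide_distrib add_divide_distrib algebra_simps)
  finally show ?case .
qed

lemma euler_nodes_norm_le: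
  assumes "j \<le> k" and "\<And>x. norm (v x) \<le> M"
  shows "norm (euler_nodes v x0 n k - euler_nodes v x0 n j) \<le> M * (real (k - j) / real (Suc n))"
  using assms(1)
proof (induction k rule: dec_induct)
  case base
  then show ?case by simp
next
  case (step k)
  have "norm (euler_nodes v x0 n (Suc k) - euler_nodes v x0 n j) \<le>
    norm (euler_nodes v x0 n k - euler_nodes v x0 n j) + norm ((1 / Suc n) *\<^sub>R v (euler_nodes v x0 n k))"
    using norm_triangle_ineq[of "euler_nodes v x0 n k - euler_nodes v x0 n j"
        "(1 / Suc n) *\<^sub>R v (euler_nodes v x0 n k)"] by (simp add: algebra_simps)
  also have "\<dots> \<le> M * (real (k - j) / real (Suc n)) + (1 / Suc n) * M"
    unfolding norm_scaleR using step(3) assms(2) by (intro add_mono mult_mono) auto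
  also have "\<dots> = M * (real (Suc k - j) / real (Suc n))"
    using step(1) by (simp add: of_nat_diff diff_divide_distrib add_divide_distrib algebra_simps)
  finally show ?case .
qed

lemma nat_floor_bounds:
  assumes "0 \<le> t"
  shows "nat \<lfloor>t * real (Suc n)\<rfloor> / Suc n \<le> t" "t \<le> (nat \<lfloor>t * real (Suc n)\<rfloor> + 1) / Suc n"
proof -
  have "real (nat \<lfloor>t * real (Suc n)\<rfloor>) \<le> t * real (Suc n)" "t * Suc n \<le> real (nat \<lfloor>t * real (Suc n)\<rfloor>) + 1"
    using assms by auto
  then show "nat \<lfloor>t * real (Suc n)\<rfloor> / Suc n \<le> t" "t \<le> (nat \<lfloor>t * real (Suc n)\<rfloor> + 1) / Suc n"
    by (simp_all add: field_simps)
qed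

lemma euler_polygon_near_node:
  assumes "0 \<le> t" and "\<And>x. norm (v x) \<le> M"
  shows "norm (euler_polygon v x0 n t - euler_nodes v x0 n (nat \<lfloor>t * real (Suc n)\<rfloor>)) \<le> M / Suc n"
proof -
  have "norm (euler_polygon v x0 n t - euler_nodes v x0 n (nat \<lfloor>t * real (Suc n)\<rfloor>)) =
    \<bar>t - nat \<lfloor>t * real (Suc n)\<rfloor> / Suc n\<bar> * norm (v (euler_nodes v x0 n (nat \<lfloor>t * real (Suc n)\<rfloor>)))"
    by (simp add: euler_polygon_def Let_def)
  also have "\<dots> \<le> (1 / Suc n) * M"
    using nat_floor_bounds[OF assms(1), of n] assms(2) by (intro mult_mono) (auto simp: add_divide_distrib)
  finally show ?thesis by simp
qed

lemma euler_polygon_lipschitz: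
  assumes v: "\<And>x. norm (v x) \<le> M" and st: "0 \<le> s" "s \<le> t"
  shows "norm (euler_polygon v x0 n t - euler_polygon v x0 n s) \<le> M * (t - s)"
proof -
  let ?X = "euler_nodes v x0 n"
  define j k where "j = nat \<lfloor>s * real (Suc n)\<rfloor>" and "k = nat \<lfloor>t * real (Suc n)\<rfloor>"
  have t: "0 \<le> t" using st by simp
  have jk: "j \<le> k" using st by (auto simp: j_def k_def intro!: nat_mono floor_mono mult_right_mono)
  note bs = nat_floor_bounds[OF st(1), of n, folded j_def] and bt = nat_floor_bounds[OF t, of n, folded k_def]
  have ps: "euler_polygon v x0 n s = ?X j + (s - j / Suc n) *\<^sub>R v (?X j)"
    and pt: "euler_polygon v x0 n t = ?X k + (t - real k / real (Suc n)) *\<^sub>R v (?X k)"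
    by (simp_all add: euler_polygon_def j_def k_def Let_def)
  show ?thesis
  proof (cases "j = k")
    case True
    then have "euler_polygon v x0 n t - euler_polygon v x0 n s = (t - s) *\<^sub>R v (?X k)"
      by (simp add: ps pt algebra_simps)
    then show ?thesis using st v[of "?X k"] by (simp add: mult.commute[of M] mult_left_mono)
  next
    case False
    then have Suc: "Suc j \<le> k" using jk by simp
    \<comment> \<open>The displacement is split at the nodes \<open>k\<close> and
      \<open>Suc j\<close>; the durations of the three pieces add up to
      \<open>t - s\<close>.\<close>
    have "euler_polygon v x0 n t - euler_polygon v x0 n s =
      (t - real k / real (Suc n)) *\<^sub>R v (?X k) + ((?X k - ?X (Suc j)) + ((j + 1) / Suc n - s) *\<^sub>R v (?X j))"
      by (simp add: ps pt algebra_simps add_divide_distrib)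
    also have "norm \<dots> \<le> norm ((t - real k / real (Suc n)) *\<^sub>R v (?X k)) + (norm (?X k - ?X (Suc j)) + norm (((j + 1) / Suc n - s) *\<^sub>R v (?X j)))"
      by (intro norm_triangle_mono order_refl)
    also have "\<dots> \<le> (t - real k / real (Suc n)) * M + (M * (real (k - Suc j) / real (Suc n)) + ((j + 1) / Suc n - s) * M)"
      unfolding norm_scaleR using bs bt v euler_nodes_norm_le[where v = v and M = M, OF Suc v]
      by (intro add_mono mult_mono) (auto simp del: of_nat_Suc euler_nodes.simps)
    also have "\<dots> = M * (t - s)"
      using Suc by (simp add: of_nat_diff diff_divide_distrib add_divide_distrib algebra_simps)
    finally show ?thesis .
  qed
qed

text \<open>The vector field need not be continuous; the limit of Euler polygons solves the inclusion
  \<open>x' \<in> \<Inter>\<epsilon>. closure (convex hull (v ` ball x \<epsilon>))\<close>, expressed here by half-spaces.\<close>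

theorem krasovskii_solution_exists:
  fixes v :: "'a::euclidean_space \<Rightarrow> 'a"
  assumes v: "\<And>x. norm (v x) \<le> M"
  shows "\<exists>x. x 0 = x0 \<and> M-lipschitz_on {0..T} x \<and>
    (\<forall>t\<in>{0..T}. \<forall>w b \<epsilon>. 0 < \<epsilon> \<longrightarrow> (\<forall>y\<in>ball (x t) \<epsilon>. w \<bullet> v y \<le> b) \<longrightarrow>
      (\<exists>\<delta>>0. \<forall>s\<in>{0..T}. \<forall>s'\<in>{0..T}.
        t - \<delta> < s \<longrightarrow> s \<le> s' \<longrightarrow> s' < t + \<delta> \<longrightarrow> w \<bullet> (x s' - x s) \<le> b * (s' - s)))"
proof -
  let ?X = "euler_nodes v x0" and ?p = "euler_polygon v x0"
  have M: "0 \<le> M" using v[of 0] norm_ge_zero order_trans by blast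
  have lip: "norm (?p n t - ?p n s) \<le> M * \<bar>t - s\<bar>" if "s \<in> {0..T}" "t \<in> {0..T}" for n s t
    using euler_polygon_lipschitz[where v = v and M = M, OF v, of s t x0 n] euler_polygon_lipschitz[where v = v and M = M, OF v, of t s x0 n] that
    by (cases "s \<le> t") (auto simp: norm_minus_commute)
  have p0: "?p n 0 = x0" for n by (simp add: euler_polygon_def)
  have bnd: "norm (?p n t) \<le> norm x0 + M * \<bar>T\<bar>" if "t \<in> {0..T}" for n t
  proof -
    have "norm (?p n t - ?p n 0) \<le> M * t" using lip[of 0 t n] that by auto
    moreover have "M * t \<le> M * \<bar>T\<bar>" using \<open>t \<in> {0..T}\<close> M by (intro mult_left_mono) auto
    ultimately show ?thesis
      using norm_triangle_sub[of "?p n t" x0] by (simp add: p0)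
  qed
  have equi: "\<exists>d>0. \<forall>n s. s \<in> {0..T} \<and> norm (t - s) < d \<longrightarrow> norm (?p n t - ?p n s) < e"
    if t: "t \<in> {0..T}" and "0 < e" for t e :: real
  proof -
    have "norm (?p n t - ?p n s) < e" if "s \<in> {0..T} \<and> norm (t - s) < e / (M + 1)" for n s
    proof -
      have "norm (?p n t - ?p n s) \<le> M * \<bar>t - s\<bar>" using lip[of s t n] that t by simp
      also have "\<dots> \<le> M * (e / (M + 1))" using that M by (intro mult_left_mono) auto
      also have "\<dots> < e" using M \<open>0 < e\<close> by (simp add: field_simps)
      finally show ?thesis .
    qed
    then show ?thesis
      using M \<open>0 < e\<close> by (intro exI[of _ "e / (M + 1)"]) auto
  qed
  obtain x r where x: "continuous_on {0..T} x" "strict_mono (r :: nat \<Rightarrow> nat)"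
    "\<And>e. 0 < e \<Longrightarrow> \<exists>N. \<forall>n\<ge>N. \<forall>t\<in>{0..T}. norm (?p (r n) t - x t) < e"
    using Arzela_Ascoli[OF compact_Icc bnd equi] by metis
  have lim: "(\<lambda>n. ?p (r n) t) \<longlonglongrightarrow> x t" if "t \<in> {0..T}" for t
    unfolding LIMSEQ_iff using x(3) that by blast
  have r: "filterlim r at_top sequentially" using x(2) by (rule filterlim_subseq)
  have inv: "(\<lambda>n. M / Suc (r n)) \<longlonglongrightarrow> 0"
    using filterlim_compose[OF LIMSEQ_Suc[OF lim_const_over_n[of M]] r] by simp
  \<comment> \<open>The field is evaluated at the nodes, so the nodes have to converge as well as
    the polygons.\<close>
  have limX: "(\<lambda>n. ?X (r n) (nat \<lfloor>t * real (Suc (r n))\<rfloor>)) \<longlonglongrightarrow> x t" if "t \<in> {0..T}" for t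
  proof -
    have "(\<lambda>n. ?X (r n) (nat \<lfloor>t * real (Suc (r n))\<rfloor>) - ?p (r n) t) \<longlonglongrightarrow> 0"
      using euler_polygon_near_node[where v = v and M = M, OF _ v, of t x0] that
      by (intro Lim_null_comparison[OF _ inv] always_eventually) (auto simp: norm_minus_commute)
    from tendsto_add[OF this lim[OF that]] show ?thesis by simp
  qed
  have x0: "x 0 = x0" if "0 \<le> T"
    using LIMSEQ_unique[OF lim[of 0]] that by (simp add: p0)
  \<comment> \<open>For \<open>T < 0\<close> the interval is empty and the limit curve says nothing
    about \<open>x 0\<close>; a constant then supplies the initial value.\<close>
  define x' where "x' = (if 0 \<le> T then x else (\<lambda>_. x0))"
  have x'x: "x' t = x t" if "t \<in> {0..T}" for t using that by (auto simp: x'_def)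
  show ?thesis
  proof (intro exI[of _ x'] conjI ballI allI impI)
    show "x' 0 = x0" using x0 by (simp add: x'_def)
    show "M-lipschitz_on {0..T} x'"
    proof (rule lipschitz_onI)
      fix s t assume st: "s \<in> {0..T}" "t \<in> {0..T}"
      have "norm (x s - x t) \<le> M * \<bar>s - t\<bar>"
        using lip[OF st(2,1)]
        by (intro tendsto_upperbound[OF tendsto_norm[OF tendsto_diff[OF lim lim]]]) (use st in auto)
      then show "dist (x' s) (x' t) \<le> M * dist s t" using st by (simp add: x'x dist_norm)
    qed (rule M)
    fix t w b \<epsilon>
    assume t: "t \<in> {0..T}" and "0 < (\<epsilon>::real)" and wb: "\<forall>y\<in>ball (x' t) \<epsilon>. w \<bullet> v y \<le> b"
    \<comment> \<open>Error budget: \<open>\<epsilon> / 4\<close> from the limit to the polygon at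
      \<open>t\<close>, \<open>\<epsilon> / 8\<close> from the polygon to its node, and at most
      \<open>M * \<delta> + M / Suc (r n)\<close>, below
      \<open>\<epsilon> / 4 + \<epsilon> / 8\<close>, from there to the node \<open>i\<close>. The
      total stays below \<open>\<epsilon>\<close>.\<close>
    define \<delta> where "\<delta> = \<epsilon> / (4 * (M + 1))"
    have \<delta>: "0 < \<delta>" "M * \<delta> \<le> \<epsilon> / 4" using \<open>0 < \<epsilon>\<close> M by (auto simp: \<delta>_def field_simps)
    have "w \<bullet> (x s' - x s) \<le> b * (s' - s)"
      if s: "s \<in> {0..T}" "s' \<in> {0..T}" "t - \<delta> < s" "s \<le> s'" "s' < t + \<delta>" for s s'
    proof -
      let ?j = "\<lambda>n. nat \<lfloor>s * real (Suc (r n))\<rfloor>" and ?k = "\<lambda>n. nat \<lfloor>s' * real (Suc (r n))\<rfloor>"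
      have fl: "(\<lambda>n. real (nat \<lfloor>u * real (Suc (r n))\<rfloor>) / Suc (r n)) \<longlonglongrightarrow> u" if "0 \<le> u" for u
      proof -
        have "(\<lambda>n. real (nat \<lfloor>u * real (Suc (r n))\<rfloor>) / Suc (r n) - u) \<longlonglongrightarrow> 0"
          using nat_floor_bounds[OF that]
          by (intro Lim_null_comparison[OF _ filterlim_compose[OF LIMSEQ_Suc[OF lim_const_over_n[of 1]] r]] always_eventually)
             (auto simp: abs_le_iff add_divide_distrib algebra_simps)
        from tendsto_add[OF this tendsto_const[of u]] show ?thesis by simp
      qed
      have ev: "\<forall>\<^sub>F n in sequentially. w \<bullet> (?X (r n) (?k n) - ?X (r n) (?j n)) \<le> b * (real (?k n - ?j n) / real (Suc (r n)))"
      proof -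
        have e1: "\<forall>\<^sub>F n in sequentially. norm (?p (r n) t - x t) < \<epsilon> / 4"
          using tendstoD[OF lim[OF t], of "\<epsilon> / 4"] \<open>0 < \<epsilon>\<close> by (simp add: dist_norm)
        have e2: "\<forall>\<^sub>F n in sequentially. M / Suc (r n) < \<epsilon> / 8"
          using order_tendstoD(2)[OF inv, of "\<epsilon> / 8"] \<open>0 < \<epsilon>\<close> by simp
        show ?thesis
        proof (rule eventually_mono[OF eventually_conj[OF e1 e2]])
          fix n assume n: "norm (?p (r n) t - x t) < \<epsilon> / 4 \<and> M / Suc (r n) < \<epsilon> / 8"
          define n0 where "n0 = nat \<lfloor>t * real (Suc (r n))\<rfloor>"
          have jk: "?j n \<le> ?k n" using s by (auto intro!: nat_mono floor_mono mult_right_mono)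
          have "w \<bullet> v (?X (r n) i) \<le> b" if i: "?j n \<le> i" "i < ?k n" for i
          proof (rule wb[rule_format])
            have t0: "0 \<le> t" using t by simp
            note bt = nat_floor_bounds[OF t0, of "r n", folded n0_def]
            have i1: "real i / Suc (r n) \<le> s'"
            proof -
              have "real i / Suc (r n) \<le> real (?k n) / Suc (r n)" using i by (intro divide_right_mono) auto
              then show ?thesis using nat_floor_bounds(1)[of s' "r n"] s by simp
            qed
            \<comment> \<open>Rounding down may put node \<open>i\<close> before time
              \<open>s\<close>, but by at most one step.\<close>
            have i2: "s - 1 / Suc (r n) \<le> real i / Suc (r n)"
            proof -
              have "real (?j n) / Suc (r n) \<le> real i / Suc (r n)" using i by (intro divide_right_mono) auto
              then show ?thesis using nat_floor_bounds(2)[of s "r n"] s by (simp add: add_divide_distrib)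
            qed
            have diff: "norm (?X (r n) i - ?X (r n) n0) \<le> M * \<bar>real i / Suc (r n) - real n0 / Suc (r n)\<bar>"
            proof (cases "n0 \<le> i")
              case True
              have "real n0 / Suc (r n) \<le> real i / Suc (r n)" using True by (intro divide_right_mono) auto
              then show ?thesis using euler_nodes_norm_le[where v = v and M = M, OF True v, of x0 "r n"] True
                by (simp add: of_nat_diff diff_divide_distrib)
            next
              case False
              then have "real i / Suc (r n) \<le> real n0 / Suc (r n)" by (intro divide_right_mono) auto
              then show ?thesis using euler_nodes_norm_le[where v = v and M = M, OF _ v, of i n0 x0 "r n"] False
                by (simp add: of_nat_diff diff_divide_distrib norm_minus_commute)
            qed
            have "\<bar>real i / Suc (r n) - real n0 / Suc (r n)\<bar> \<le> \<delta> + 1 / Suc (r n)"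
              using i1 i2 bt s by (simp add: abs_le_iff add_divide_distrib)
            then have "M * \<bar>real i / Suc (r n) - real n0 / Suc (r n)\<bar> \<le> M * \<delta> + M / Suc (r n)"
              using mult_left_mono[OF _ M, of _ "\<delta> + 1 / Suc (r n)"] by (simp add: distrib_left)
            then have 1: "norm (?X (r n) i - ?X (r n) n0) < \<epsilon> / 4 + \<epsilon> / 8" using diff \<delta>(2) n by linarith
            have 2: "norm (?p (r n) t - ?X (r n) n0) < \<epsilon> / 8"
              using euler_polygon_near_node[where v = v and M = M, OF t0 v, of x0 "r n"] n
              unfolding n0_def by linarith
            have "norm (x t - ?X (r n) i) \<le> norm (x t - ?p (r n) t) + norm (?p (r n) t - ?X (r n) n0) + norm (?X (r n) n0 - ?X (r n) i)"
              using norm_triangle_ineq[of "x t - ?p (r n) t" "?p (r n) t - ?X (r n) n0"]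
                norm_triangle_ineq[of "x t - ?X (r n) n0" "?X (r n) n0 - ?X (r n) i"] by simp
            then show "?X (r n) i \<in> ball (x' t) \<epsilon>"
              using 1 2 n \<open>0 < \<epsilon>\<close> t
              unfolding mem_ball dist_norm x'x[OF t] norm_minus_commute[of "x t" "?p (r n) t"]
                norm_minus_commute[of "?X (r n) n0"] by linarith
          qed
          from euler_nodes_inner_le[where v = v, OF jk this]
          show "w \<bullet> (?X (r n) (?k n) - ?X (r n) (?j n)) \<le> b * (real (?k n - ?j n) / real (Suc (r n)))" .
        qed
      qed
      have eqd: "real (?k n - ?j n) / Suc (r n) = real (?k n) / Suc (r n) - real (?j n) / Suc (r n)" for n
      proof -
        have "?j n \<le> ?k n" using s by (auto intro!: nat_mono floor_mono mult_right_mono)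
        then show ?thesis by (simp add: of_nat_diff diff_divide_distrib)
      qed
      have "(\<lambda>n. b * (real (?k n - ?j n) / real (Suc (r n)))) \<longlonglongrightarrow> b * (s' - s)"
        unfolding eqd using s by (intro tendsto_intros fl) auto
      moreover have "(\<lambda>n. w \<bullet> (?X (r n) (?k n) - ?X (r n) (?j n))) \<longlonglongrightarrow> w \<bullet> (x s' - x s)"
        using s by (intro tendsto_intros limX) auto
      ultimately show ?thesis using ev by (intro tendsto_le[OF sequentially_bot])
    qed
    then show "\<exists>\<delta>>0. \<forall>s\<in>{0..T}. \<forall>s'\<in>{0..T}. t - \<delta> < s \<longrightarrow> s \<le> s' \<longrightarrow> s' < t + \<delta> \<longrightarrow> w \<bullet> (x' s' - x' s) \<le> b * (s' - s)"
      using \<delta>(1) by (intro exI[of _ \<delta>]) (simp add: x'x)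
  qed
qed

section \<open>Smooth maps between Euclidean spaces\<close>

lemma smooth_on_has_derivative:
  assumes "smooth_on UNIV W f" "x \<in> W"
  shows "(f has_derivative frechet_derivative f (at x)) (at x)"
proof -
  have "Ck_on UNIV (Suc 0) W f" using assms(1) by (simp only: smooth_on_def)
  then show ?thesis using assms(2) by (simp add: frechet_derivative_works)
qed

lemma smooth_on_derivative:
  assumes "smooth_on UNIV W f"
  shows "smooth_on UNIV W (\<lambda>x. frechet_derivative f (at x) v)"
  unfolding smooth_on_def
proof
  fix k
  have "Ck_on UNIV (Suc k) W f" using assms by (simp only: smooth_on_def)
  then show "Ck_on UNIV k W (\<lambda>x. frechet_derivative f (at x) v)" by simp
qed

lemma smooth_on_continuous_on: "smooth_on UNIV W f \<Longrightarrow> continuous_on W f"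
  using Ck_on.simps(1) smooth_on_def by blast

section \<open>Local Lipschitz bounds and symmetry of second derivatives\<close>

text \<open>\<open>smooth_on\<close> yields continuity of derivatives in fixed directions. The
  finitely many directions of the basis suffice to control an operator norm.\<close>

lemma linear_norm_le_sum_Basis:
  fixes f :: "'a::euclidean_space \<Rightarrow> 'b::real_normed_vector"
  assumes "linear f"
  shows "norm (f x) \<le> (\<Sum>b\<in>Basis. norm (f b)) * norm x"
proof -
  have "f x = (\<Sum>b\<in>Basis. (x \<bullet> b) *\<^sub>R f b)"
    using assms by (subst euclidean_representation[symmetric, of x]) (simp add: linear_sum linear_cmul del: euclidean_representation)
  also have "norm \<dots> \<le> (\<Sum>b\<in>Basis. norm x * norm (f b))"
    by (intro sum_norm_le) (auto intro!: mult_right_mono Basis_le_norm)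
  finally show ?thesis by (simp add: sum_distrib_left mult.commute)
qed

text \<open>The continuous function \<open>S\<close> dominates the operator norm of the derivative
  and is at most \<open>S x + 1\<close> near \<open>x\<close>; the mean value inequality on a ball
  concludes.\<close>

lemma smooth_on_locally_lipschitz:
  assumes f: "smooth_on UNIV W f" and W: "open W" "x \<in> W"
  obtains r L where "0 < r" "ball x r \<subseteq> W" "L-lipschitz_on (ball x r) f"
proof -
  let ?f' = "\<lambda>y. frechet_derivative f (at y)"
  define S where "S y = (\<Sum>b\<in>Basis. norm (?f' y b))" for y
  have "continuous_on W S"
    unfolding S_def
    by (intro continuous_on_sum continuous_on_norm smooth_on_continuous_on smooth_on_derivative f)
  then have "isCont S x" using W by (simp add: continuous_on_eq_continuous_at)
  then have "\<forall>\<^sub>F y in at x. S y < S x + 1"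
    unfolding isCont_def by (rule order_tendstoD) simp
  then obtain d where d: "0 < d" "\<And>y. dist y x < d \<Longrightarrow> S y \<le> S x + 1"
    unfolding eventually_at by (metis UNIV_I less_eq_real_def less_add_one)
  obtain e where e: "0 < e" "ball x e \<subseteq> W" using W open_contains_ball by blast
  have S0: "0 \<le> S y" for y unfolding S_def by (simp add: sum_nonneg)
  show ?thesis
  proof (rule that[of "min d e" "S x + 1"])
    show "(S x + 1)-lipschitz_on (ball x (min d e)) f"
    proof (rule lipschitz_onI)
      fix y y' assume y: "y \<in> ball x (min d e)" "y' \<in> ball x (min d e)"
      have "norm (f y - f y') \<le> (S x + 1) * norm (y - y')"
      proof (rule differentiable_bound[of "ball x (min d e)" f ?f'])
        fix u assume u: "u \<in> ball x (min d e)"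
        have der: "(f has_derivative ?f' u) (at u)"
          using f by (rule smooth_on_has_derivative) (use u e in auto)
        then show "(f has_derivative ?f' u) (at u within ball x (min d e))"
          by (rule has_derivative_at_withinI)
        show "onorm (?f' u) \<le> S x + 1"
        proof (rule onorm_le)
          fix h
          have "norm (?f' u h) \<le> S u * norm h"
            unfolding S_def using has_derivative_linear[OF der] by (rule linear_norm_le_sum_Basis)
          also have "\<dots> \<le> (S x + 1) * norm h"
            using d(2)[of u] u by (intro mult_right_mono) (auto simp: dist_commute)
          finally show "norm (?f' u h) \<le> (S x + 1) * norm h" .
        qed
      qed (use y in auto)
      then show "dist (f y) (f y') \<le> (S x + 1) * dist y y'" by (simp add: dist_norm)
    qed (use S0[of x] in simp)
  qed (use d e in auto)
qed

text \<open>\<open>D s\<close> is symmetric in \<open>v\<close> and \<open>w\<close>, so this limit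
  formula makes the second derivative symmetric. The direction \<open>v\<close> is handled by the
  mean value inequality, the direction \<open>w\<close> by differentiability at \<open>p\<close> of
  \<open>K\<close>, the derivative of \<open>f\<close> along \<open>v\<close>.\<close>

lemma smooth_on_second_difference:
  fixes f :: "'a::euclidean_space \<Rightarrow> 'b::euclidean_space" and v w :: 'a
  assumes f: "smooth_on UNIV W f" and W: "open W" "p \<in> W"
  defines "D \<equiv> \<lambda>s. f (p + s *\<^sub>R v + s *\<^sub>R w) - f (p + s *\<^sub>R v) - f (p + s *\<^sub>R w) + f p"
  shows "((\<lambda>s. (1 / s\<^sup>2) *\<^sub>R D s) \<longlongrightarrow>
    frechet_derivative (\<lambda>x. frechet_derivative f (at x) v) (at p) w) (at_right 0)"
proof (rule tendstoI)
  fix e :: real assume "0 < e"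
  define K where "K = (\<lambda>x. frechet_derivative f (at x) v)"
  define K' where "K' = frechet_derivative K (at p)"
  have K: "(K has_derivative K') (at p)"
    unfolding K_def K'_def by (rule smooth_on_has_derivative[OF smooth_on_derivative[OF f] W(2)])
  then have K'lin: "linear K'" by (rule has_derivative_linear)
  define B where "B = norm v + norm w + 1"
  have B: "0 < B" by (simp add: B_def add_nonneg_pos)
  \<comment> \<open>Two remainders of size at most \<open>e' * (s * B)\<close> over a path of length
    \<open>s\<close> give \<open>2 * e' * B * s^2\<close>; division by \<open>s^2\<close> leaves
    \<open>e / 2\<close>.\<close>
  define e' where "e' = e / (4 * B)"
  have e': "0 < e'" using \<open>0 < e\<close> B by (simp add: e'_def)
  obtain d where d: "0 < d" "\<And>x. norm (x - p) < d \<Longrightarrow> norm (K x - K p - K' (x - p)) \<le> e' * norm (x - p)"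
    using K e' unfolding has_derivative_at_alt by blast
  obtain r where r: "0 < r" "ball p r \<subseteq> W" using W open_contains_ball by blast
  have bound: "norm ((1 / s\<^sup>2) *\<^sub>R D s - K' w) < e" if s: "0 < s" "s < min d r / B" for s
  proof -
    have sB: "s * B < d" "s * B < r" using s B by (auto simp: field_simps)
    \<comment> \<open>The subtracted linear term turns the derivative in \<open>\<tau>\<close> into
      a difference of two first-order remainders of \<open>K\<close> at \<open>p\<close>.\<close>
    define \<phi> where "\<phi> \<tau> = f (p + \<tau> *\<^sub>R v + s *\<^sub>R w) - f (p + \<tau> *\<^sub>R v) - \<tau> *\<^sub>R (s *\<^sub>R K' w)" for \<tau>
    have small: "norm (\<tau> *\<^sub>R v + \<sigma> *\<^sub>R w) \<le> s * (norm v + norm w)"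
      if "0 \<le> \<tau>" "\<tau> \<le> s" "0 \<le> \<sigma>" "\<sigma> \<le> s" for \<tau> \<sigma>
    proof -
      have "norm (\<tau> *\<^sub>R v + \<sigma> *\<^sub>R w) \<le> \<tau> * norm v + \<sigma> * norm w"
        using norm_triangle_ineq[of "\<tau> *\<^sub>R v" "\<sigma> *\<^sub>R w"] that by simp
      also have "\<dots> \<le> s * norm v + s * norm w" using that by (intro add_mono mult_right_mono) auto
      finally show ?thesis by (simp add: distrib_left)
    qed
    have sB': "s * (norm v + norm w) < s * B" using s by (simp add: B_def)
    have near: "norm (\<tau> *\<^sub>R v + \<sigma> *\<^sub>R w) < d" "p + \<tau> *\<^sub>R v + \<sigma> *\<^sub>R w \<in> W"
      "norm (K (p + \<tau> *\<^sub>R v + \<sigma> *\<^sub>R w) - K p - K' (\<tau> *\<^sub>R v + \<sigma> *\<^sub>R w)) \<le> e' * (s * B)"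
      if "0 \<le> \<tau>" "\<tau> \<le> s" "0 \<le> \<sigma>" "\<sigma> \<le> s" for \<tau> \<sigma>
    proof -
      show 1: "norm (\<tau> *\<^sub>R v + \<sigma> *\<^sub>R w) < d" using small[OF that] sB sB' by linarith
      have "norm (\<tau> *\<^sub>R v + \<sigma> *\<^sub>R w) < r" using small[OF that] sB sB' by linarith
      then have "p + (\<tau> *\<^sub>R v + \<sigma> *\<^sub>R w) \<in> ball p r" by (simp only: mem_ball dist_norm norm_minus_commute[of p] add_diff_cancel_left')
      then show "p + \<tau> *\<^sub>R v + \<sigma> *\<^sub>R w \<in> W" using r by (auto simp: add.assoc)
      have "norm (K (p + (\<tau> *\<^sub>R v + \<sigma> *\<^sub>R w)) - K p - K' (\<tau> *\<^sub>R v + \<sigma> *\<^sub>R w)) \<le> e' * norm (\<tau> *\<^sub>R v + \<sigma> *\<^sub>R w)"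
        using d(2)[of "p + (\<tau> *\<^sub>R v + \<sigma> *\<^sub>R w)"] 1 by simp
      also have "\<dots> \<le> e' * (s * B)" using small[OF that] sB' e' by (intro mult_left_mono) auto
      finally show "norm (K (p + \<tau> *\<^sub>R v + \<sigma> *\<^sub>R w) - K p - K' (\<tau> *\<^sub>R v + \<sigma> *\<^sub>R w)) \<le> e' * (s * B)"
        by (simp add: add.assoc)
    qed
    have "norm (\<phi> s - \<phi> 0) \<le> (2 * e' * (s * B)) * norm (s - 0)"
    proof (rule differentiable_bound[of "{0..s}" \<phi>
          "\<lambda>\<tau> h. h *\<^sub>R (K (p + \<tau> *\<^sub>R v + s *\<^sub>R w) - K (p + \<tau> *\<^sub>R v) - s *\<^sub>R K' w)"])
      fix \<tau> assume "\<tau> \<in> {0..s}"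
      then have \<tau>: "0 \<le> \<tau>" "\<tau> \<le> s" by auto
      have line: "((\<lambda>\<tau>. f (p + \<tau> *\<^sub>R v + \<sigma> *\<^sub>R w)) has_derivative (\<lambda>h. h *\<^sub>R K (p + \<tau> *\<^sub>R v + \<sigma> *\<^sub>R w))) (at \<tau>)"
        if "0 \<le> \<sigma>" "\<sigma> \<le> s" for \<sigma>
      proof -
        have W': "p + \<tau> *\<^sub>R v + \<sigma> *\<^sub>R w \<in> W" using near(2)[OF \<tau> that] .
        have "((\<lambda>\<tau>. p + \<tau> *\<^sub>R v + \<sigma> *\<^sub>R w) has_derivative (\<lambda>h. h *\<^sub>R v)) (at \<tau>)"
          by (auto intro!: derivative_eq_intros)
        from has_derivative_compose[OF this smooth_on_has_derivative[OF f W']]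
        have "((\<lambda>\<tau>. f (p + \<tau> *\<^sub>R v + \<sigma> *\<^sub>R w)) has_derivative
          (\<lambda>h. frechet_derivative f (at (p + \<tau> *\<^sub>R v + \<sigma> *\<^sub>R w)) (h *\<^sub>R v))) (at \<tau>)" .
        then show ?thesis
          unfolding K_def linear_cmul[OF has_derivative_linear[OF smooth_on_has_derivative[OF f W']]] .
      qed
      have "(\<phi> has_derivative (\<lambda>h. h *\<^sub>R (K (p + \<tau> *\<^sub>R v + s *\<^sub>R w) - K (p + \<tau> *\<^sub>R v) - s *\<^sub>R K' w))) (at \<tau>)"
        unfolding \<phi>_def
        using line[of 0] line[of s] s
        by (auto intro!: derivative_eq_intros simp: algebra_simps)
      then show "(\<phi> has_derivative (\<lambda>h. h *\<^sub>R (K (p + \<tau> *\<^sub>R v + s *\<^sub>R w) - K (p + \<tau> *\<^sub>R v) - s *\<^sub>R K' w))) (at \<tau> within {0..s})"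
        by (rule has_derivative_at_withinI)
      have "norm (K (p + \<tau> *\<^sub>R v + s *\<^sub>R w) - K (p + \<tau> *\<^sub>R v) - s *\<^sub>R K' w) \<le> 2 * e' * (s * B)"
      proof -
        have "K (p + \<tau> *\<^sub>R v + s *\<^sub>R w) - K (p + \<tau> *\<^sub>R v) - s *\<^sub>R K' w =
          (K (p + \<tau> *\<^sub>R v + s *\<^sub>R w) - K p - K' (\<tau> *\<^sub>R v + s *\<^sub>R w)) - (K (p + \<tau> *\<^sub>R v + 0 *\<^sub>R w) - K p - K' (\<tau> *\<^sub>R v + 0 *\<^sub>R w))"
          by (simp add: linear_add[OF K'lin] linear_cmul[OF K'lin])
        also have "norm \<dots> \<le> e' * (s * B) + e' * (s * B)"
          using near(3)[OF \<tau>, of s] near(3)[OF \<tau>, of 0] s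
          by (intro order_trans[OF norm_triangle_ineq4 add_mono]) auto
        finally show ?thesis by (simp add: mult_ac)
      qed
      then show "onorm (\<lambda>h. h *\<^sub>R (K (p + \<tau> *\<^sub>R v + s *\<^sub>R w) - K (p + \<tau> *\<^sub>R v) - s *\<^sub>R K' w)) \<le> 2 * e' * (s * B)"
        by (intro onorm_le) (simp add: mult.commute[of "\<bar>_\<bar>"] mult_right_mono)
    qed (use s in auto)
    also have "\<phi> s - \<phi> 0 = D s - (s\<^sup>2) *\<^sub>R K' w"
      by (simp add: \<phi>_def D_def power2_eq_square)
    finally have "norm (D s - (s\<^sup>2) *\<^sub>R K' w) \<le> 2 * e' * B * s\<^sup>2"
      using s by (simp add: power2_eq_square mult_ac)
    then have "norm ((1 / s\<^sup>2) *\<^sub>R (D s - (s\<^sup>2) *\<^sub>R K' w)) \<le> 2 * e' * B"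
      using s by (simp add: pos_divide_le_eq)
    moreover have "(1 / s\<^sup>2) *\<^sub>R (D s - (s\<^sup>2) *\<^sub>R K' w) = (1 / s\<^sup>2) *\<^sub>R D s - K' w"
      using s by (simp add: scaleR_diff_right)
    moreover have "2 * e' * B < e" using B \<open>0 < e\<close> by (simp add: e'_def field_simps)
    ultimately show ?thesis by simp
  qed
  have "0 < min d r / B" using d r B by simp
  then show "\<forall>\<^sub>F s in at_right 0. dist ((1 / s\<^sup>2) *\<^sub>R D s)
      (frechet_derivative (\<lambda>x. frechet_derivative f (at x) v) (at p) w) < e"
    unfolding eventually_at_right_field K_def[symmetric] K'_def[symmetric] dist_norm
    using bound by blast
qed

lemma smooth_on_symmetric_second_derivative:
  assumes "smooth_on UNIV W f" "open W" "p \<in> W"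
  shows "frechet_derivative (\<lambda>x. frechet_derivative f (at x) v) (at p) w =
    frechet_derivative (\<lambda>x. frechet_derivative f (at x) w) (at p) v"
proof (rule tendsto_unique[OF trivial_limit_at_right_real smooth_on_second_difference[OF assms]])
  show "((\<lambda>s. (1 / s\<^sup>2) *\<^sub>R (f (p + s *\<^sub>R v + s *\<^sub>R w) - f (p + s *\<^sub>R v) - f (p + s *\<^sub>R w) + f p)) \<longlongrightarrow>
    frechet_derivative (\<lambda>x. frechet_derivative f (at x) w) (at p) v) (at_right 0)"
    using smooth_on_second_difference[OF assms, of w v] by (simp add: algebra_simps)
qed

section \<open>Lie groups in the chart at the unit\<close>

text \<open>With \<open>E = UNIV\<close> derivatives within \<open>E\<close> are ordinary ones and
  chart images are open; the model space \<open>{0}\<close> is left to a direct argument.\<close>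

locale full_lie_group = lie_group E A mul unit ginv
  for E :: "'e::euclidean_space set"
    and A :: "('g::{t2_space, second_countable_topology}, 'e) chart set"
    and mul :: "'g \<Rightarrow> 'g \<Rightarrow> 'g" and unit :: 'g and ginv :: "'g \<Rightarrow> 'g" +
  assumes E_UNIV: "E = UNIV"
begin

lemma chart_at_chart: "chart_at A p \<in> A" "p \<in> fst (chart_at A p)"
proof -
  have "\<exists>c. c \<in> A \<and> p \<in> fst c" using charts_cover by blast
  then have "chart_at A p \<in> A \<and> p \<in> fst (chart_at A p)" unfolding chart_at_def by (rule someI_ex)
  then show "chart_at A p \<in> A" "p \<in> fst (chart_at A p)" by auto
qed

lemma
  assumes c: "c \<in> A"
  shows chart_cont: "continuous_on (fst c) (snd c)"
    and chart_inv_cont: "continuous_on (snd c ` fst c) (chart_inv c)"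
    and chart_inv_chart: "p \<in> fst c \<Longrightarrow> chart_inv c (snd c p) = p"
    and chart_chart_inv: "x \<in> snd c ` fst c \<Longrightarrow> snd c (chart_inv c x) = x"
    and chart_inv_in: "x \<in> snd c ` fst c \<Longrightarrow> chart_inv c x \<in> fst c"
    and open_chart: "open (fst c)"
    and open_chart_image: "open (snd c ` fst c)"
proof -
  note h = chart_homeomorphism[OF c]
  show "continuous_on (fst c) (snd c)" "continuous_on (snd c ` fst c) (chart_inv c)"
    using h by (auto simp: homeomorphism_def)
  show "p \<in> fst c \<Longrightarrow> chart_inv c (snd c p) = p" using h by (auto simp: homeomorphism_def)
  show "x \<in> snd c ` fst c \<Longrightarrow> snd c (chart_inv c x) = x" by (rule f_inv_into_f)
  show "x \<in> snd c ` fst c \<Longrightarrow> chart_inv c x \<in> fst c" by (rule inv_into_into)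
  show "open (fst c)" using c by (rule chart_domain_open)
  show "open (snd c ` fst c)" using chart_image_open[OF c] by (simp add: E_UNIV)
qed

lemma mul_cont: "continuous_on UNIV (\<lambda>p. mul (fst p) (snd p))"
  using mul_smooth by (simp add: smooth_map_def case_prod_beta)

lemma ginv_cont: "continuous_on UNIV ginv"
  using ginv_smooth by (simp add: smooth_map_def)

lemma continuous_mul [continuous_intros]:
  assumes "continuous_on S f" "continuous_on S h"
  shows "continuous_on S (\<lambda>s. mul (f s) (h s))"
  using continuous_on_compose2[OF mul_cont continuous_on_Pair[OF assms]] by simp

lemma continuous_ginv [continuous_intros]:
  assumes "continuous_on S f"
  shows "continuous_on S (\<lambda>s. ginv (f s))"
  using continuous_on_compose2[OF ginv_cont assms] by simp

section \<open>Multiplication and translations in coordinates\<close>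

text \<open>Left factor, right factor and product may be read in three different charts, since
  translations leave any single chart domain. The inverse of the product chart appears as in
  \<open>smooth_map\<close>, so that smoothness can be quoted literally.\<close>

definition chart_mul :: "('g, 'e) chart \<Rightarrow> ('g, 'e) chart \<Rightarrow> ('g, 'e) chart \<Rightarrow> 'e \<times> 'e \<Rightarrow> 'e" where
  "chart_mul c d e = snd e \<circ> (\<lambda>(x, y). mul x y) \<circ> chart_inv (fst c \<times> fst d, map_prod (snd c) (snd d))"

definition chart_mul_dom :: "('g, 'e) chart \<Rightarrow> ('g, 'e) chart \<Rightarrow> ('g, 'e) chart \<Rightarrow> ('e \<times> 'e) set" where
  "chart_mul_dom c d e = {(a, b). a \<in> snd c ` fst c \<and> b \<in> snd d ` fst d \<and> mul (chart_inv c a) (chart_inv d b) \<in> fst e}"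

lemma
  assumes c: "c \<in> A" and d: "d \<in> A" and e: "e \<in> A"
  shows chart_mul_smooth: "smooth_on UNIV (chart_mul_dom c d e) (chart_mul c d e)"
    and open_chart_mul_dom: "open (chart_mul_dom c d e)"
    and chart_mul_eq: "(a, b) \<in> chart_mul_dom c d e \<Longrightarrow>
      chart_mul c d e (a, b) = snd e (mul (chart_inv c a) (chart_inv d b))"
proof -
  let ?p = "(fst c \<times> fst d, map_prod (snd c) (snd d))"
  have img: "map_prod (snd c) (snd d) ` (fst c \<times> fst d) = snd c ` fst c \<times> snd d ` fst d"
    by (auto simp: image_iff)
  have inj: "inj_on (map_prod (snd c) (snd d)) (fst c \<times> fst d)"
    using map_prod_inj_on[OF inj_on_inverseI[of "fst c" "chart_inv c" "snd c"] inj_on_inverseI[of "fst d" "chart_inv d" "snd d"]]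
      chart_inv_chart[OF c] chart_inv_chart[OF d] by blast
  have inv: "chart_inv ?p (a, b) = (chart_inv c a, chart_inv d b)"
    if "a \<in> snd c ` fst c" "b \<in> snd d ` fst d" for a b
    using chart_chart_inv[OF c that(1)] chart_chart_inv[OF d that(2)] chart_inv_in[OF c that(1)] chart_inv_in[OF d that(2)]
    by (auto intro!: inv_into_f_eq[OF inj])
  have dom: "snd ?p ` (fst ?p \<inter> (\<lambda>(x, y). mul x y) -` fst e) = chart_mul_dom c d e"
  proof (rule set_eqI)
    fix q :: "'e \<times> 'e"
    obtain a b where q: "q = (a, b)" by fastforce
    have "q \<in> snd ?p ` (fst ?p \<inter> (\<lambda>(x, y). mul x y) -` fst e) \<longleftrightarrow>
      (\<exists>x y. x \<in> fst c \<and> y \<in> fst d \<and> a = snd c x \<and> b = snd d y \<and> mul x y \<in> fst e)"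
      unfolding q by (simp add: image_iff Bex_def) blast
    also have "\<dots> \<longleftrightarrow> q \<in> chart_mul_dom c d e"
    proof
      assume "\<exists>x y. x \<in> fst c \<and> y \<in> fst d \<and> a = snd c x \<and> b = snd d y \<and> mul x y \<in> fst e"
      then show "q \<in> chart_mul_dom c d e"
        using chart_inv_chart[OF c] chart_inv_chart[OF d] by (auto simp: q chart_mul_dom_def)
    next
      assume "q \<in> chart_mul_dom c d e"
      then have "a \<in> snd c ` fst c" "b \<in> snd d ` fst d" "mul (chart_inv c a) (chart_inv d b) \<in> fst e"
        by (auto simp: q chart_mul_dom_def)
      then show "\<exists>x y. x \<in> fst c \<and> y \<in> fst d \<and> a = snd c x \<and> b = snd d y \<and> mul x y \<in> fst e"
        using chart_inv_in[OF c] chart_inv_in[OF d] chart_chart_inv[OF c] chart_chart_inv[OF d] by metis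
    qed
    finally show "q \<in> snd ?p ` (fst ?p \<inter> (\<lambda>(x, y). mul x y) -` fst e) \<longleftrightarrow> q \<in> chart_mul_dom c d e" .
  qed
  have "?p \<in> prod_atlas A A" unfolding prod_atlas_def using c d by blast
  then have "smooth_on UNIV (snd ?p ` (fst ?p \<inter> (\<lambda>(x, y). mul x y) -` fst e)) (chart_mul c d e)"
    using mul_smooth e unfolding smooth_map_def E_UNIV chart_mul_def by (metis UNIV_Times_UNIV)
  then show "smooth_on UNIV (chart_mul_dom c d e) (chart_mul c d e)" unfolding dom .
  show "chart_mul c d e (a, b) = snd e (mul (chart_inv c a) (chart_inv d b))"
    if "(a, b) \<in> chart_mul_dom c d e"
    using that inv by (simp add: chart_mul_def chart_mul_dom_def)
  have "continuous_on (snd c ` fst c \<times> snd d ` fst d) (\<lambda>q. mul (chart_inv c (fst q)) (chart_inv d (snd q)))"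
    by (intro continuous_intros continuous_on_compose2[OF chart_inv_cont[OF c]] continuous_on_compose2[OF chart_inv_cont[OF d]]) auto
  then have "open ((\<lambda>q. mul (chart_inv c (fst q)) (chart_inv d (snd q))) -` fst e \<inter> (snd c ` fst c \<times> snd d ` fst d))"
    using open_chart[OF e] open_chart_image[OF c] open_chart_image[OF d]
    by (subst (asm) continuous_on_open_vimage) (auto intro: open_Times)
  also have "(\<lambda>q. mul (chart_inv c (fst q)) (chart_inv d (snd q))) -` fst e \<inter> (snd c ` fst c \<times> snd d ` fst d) = chart_mul_dom c d e"
    by (auto simp: chart_mul_dom_def)
  finally show "open (chart_mul_dom c d e)" .
qed

text \<open>A relation for arbitrary charts, whereas \<open>differential\<close> is tied to the
  charts selected at \<open>p\<close> and \<open>F p\<close>. It bundles existence and value of the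
  derivative with the domain conditions of the chain rule; by uniqueness, identities between maps
  become identities between derivatives.\<close>

definition chart_deriv :: "('g, 'e) chart \<Rightarrow> ('g, 'e) chart \<Rightarrow> ('g \<Rightarrow> 'g) \<Rightarrow> 'g \<Rightarrow> ('e \<Rightarrow> 'e) \<Rightarrow> bool" where
  "chart_deriv c d F p D \<longleftrightarrow> p \<in> fst c \<and> F p \<in> fst d \<and>
     ((snd d \<circ> F \<circ> chart_inv c) has_derivative D) (at (snd c p))"

lemma chart_deriv_unique: "chart_deriv c d F p D \<Longrightarrow> chart_deriv c d F p D' \<Longrightarrow> D = D'"
  unfolding chart_deriv_def by (blast intro: has_derivative_unique)

lemma chart_deriv_id:
  assumes "c \<in> A" "p \<in> fst c"
  shows "chart_deriv c c (\<lambda>x. x) p (\<lambda>v. v)"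
proof -
  have "((\<lambda>x. x) has_derivative (\<lambda>v. v)) (at (snd c p))" by simp
  then have "((snd c \<circ> (\<lambda>x. x) \<circ> chart_inv c) has_derivative (\<lambda>v. v)) (at (snd c p))"
    by (rule has_derivative_transform_within_open[OF _ open_chart_image[OF assms(1)]])
       (use assms chart_chart_inv in auto)
  then show ?thesis using assms by (simp add: chart_deriv_def)
qed

lemma chart_deriv_compose:
  assumes F: "chart_deriv c d F p D" and G: "chart_deriv d e G (F p) D'"
    and c: "c \<in> A" and d: "d \<in> A" and cont: "continuous_on UNIV F"
  shows "chart_deriv c e (\<lambda>x. G (F x)) p (\<lambda>v. D' (D v))"
proof -
  have p: "p \<in> fst c" "F p \<in> fst d" "G (F p) \<in> fst e" using F G by (auto simp: chart_deriv_def)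
  have 1: "((snd d \<circ> F \<circ> chart_inv c) has_derivative D) (at (snd c p))"
    and 2: "((snd e \<circ> G \<circ> chart_inv d) has_derivative D') (at (snd d (F p)))"
    using F G by (auto simp: chart_deriv_def)
  have "((\<lambda>x. (snd e \<circ> G \<circ> chart_inv d) ((snd d \<circ> F \<circ> chart_inv c) x)) has_derivative (\<lambda>v. D' (D v))) (at (snd c p))"
    by (rule has_derivative_compose[OF 1]) (use 2 p chart_inv_chart[OF c] in \<open>simp del: o_apply add: o_apply[of _ "chart_inv c"] o_apply[of "snd d" F]\<close>)
  moreover have "continuous_on (snd c ` fst c) (\<lambda>x. F (chart_inv c x))"
    by (rule continuous_on_compose2[OF cont chart_inv_cont[OF c]]) simp
  then have "open ((\<lambda>x. F (chart_inv c x)) -` fst d \<inter> snd c ` fst c)"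
    using open_chart[OF d] open_chart_image[OF c] by (subst (asm) continuous_on_open_vimage) auto
  moreover have "snd c p \<in> (\<lambda>x. F (chart_inv c x)) -` fst d \<inter> snd c ` fst c"
    using p chart_inv_chart[OF c] by simp
  ultimately have "((snd e \<circ> (\<lambda>x. G (F x)) \<circ> chart_inv c) has_derivative (\<lambda>v. D' (D v))) (at (snd c p))"
    by (rule has_derivative_transform_within_open) (use chart_inv_chart[OF d] in auto)
  then show ?thesis using p by (simp add: chart_deriv_def)
qed

lemma left_translation_chart_deriv:
  assumes "c \<in> A" "d \<in> A" "e \<in> A" "g \<in> fst c" "y \<in> fst d" "mul g y \<in> fst e"
  shows "chart_deriv d e (mul g) y (\<lambda>v. frechet_derivative (chart_mul c d e) (at (snd c g, snd d y)) (0, v))"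
proof -
  have in_dom: "(snd c g, snd d y) \<in> chart_mul_dom c d e"
    using assms chart_inv_chart by (auto simp: chart_mul_dom_def)
  have "((\<lambda>b. (snd c g, b)) has_derivative (\<lambda>v. (0, v))) (at (snd d y))"
    by (auto intro!: derivative_eq_intros)
  from has_derivative_compose[OF this smooth_on_has_derivative[OF chart_mul_smooth[OF assms(1-3)] in_dom]]
  have 1: "((\<lambda>b. chart_mul c d e (snd c g, b)) has_derivative
    (\<lambda>v. frechet_derivative (chart_mul c d e) (at (snd c g, snd d y)) (0, v))) (at (snd d y))" .
  have "open (Pair (snd c g) -` chart_mul_dom c d e)"
    by (intro open_vimage open_chart_mul_dom assms continuous_intros)
  from has_derivative_transform_within_open[OF 1 this]
  have "((snd e \<circ> mul g \<circ> chart_inv d) has_derivative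
    (\<lambda>v. frechet_derivative (chart_mul c d e) (at (snd c g, snd d y)) (0, v))) (at (snd d y))"
    using in_dom chart_mul_eq[OF assms(1-3)] chart_inv_chart[OF assms(1,4)] by simp
  then show ?thesis using assms by (simp add: chart_deriv_def)
qed

lemma right_translation_chart_deriv:
  assumes "c \<in> A" "d \<in> A" "e \<in> A" "y \<in> fst c" "g \<in> fst d" "mul y g \<in> fst e"
  shows "chart_deriv c e (\<lambda>x. mul x g) y (\<lambda>v. frechet_derivative (chart_mul c d e) (at (snd c y, snd d g)) (v, 0))"
proof -
  have in_dom: "(snd c y, snd d g) \<in> chart_mul_dom c d e"
    using assms chart_inv_chart by (auto simp: chart_mul_dom_def)
  have "((\<lambda>b. (b, snd d g)) has_derivative (\<lambda>v. (v, 0))) (at (snd c y))"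
    by (auto intro!: derivative_eq_intros)
  from has_derivative_compose[OF this smooth_on_has_derivative[OF chart_mul_smooth[OF assms(1-3)] in_dom]]
  have 1: "((\<lambda>b. chart_mul c d e (b, snd d g)) has_derivative
    (\<lambda>v. frechet_derivative (chart_mul c d e) (at (snd c y, snd d g)) (v, 0))) (at (snd c y))" .
  have "open ((\<lambda>b. (b, snd d g)) -` chart_mul_dom c d e)"
    by (intro open_vimage open_chart_mul_dom assms continuous_intros)
  from has_derivative_transform_within_open[OF 1 this]
  have "((snd e \<circ> (\<lambda>x. mul x g) \<circ> chart_inv c) has_derivative
    (\<lambda>v. frechet_derivative (chart_mul c d e) (at (snd c y, snd d g)) (v, 0))) (at (snd c y))"
    using in_dom chart_mul_eq[OF assms(1-3)] chart_inv_chart[OF assms(2,5)] by simp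
  then show ?thesis using assms by (simp add: chart_deriv_def)
qed

text \<open>The left factor is frozen in a local Lipschitz bound for \<open>chart_mul\<close>. As
  \<open>d\<close> and \<open>e\<close> are arbitrary, \<open>g = unit\<close> covers changes of
  charts.\<close>

lemma left_translation_locally_lipschitz:
  assumes d: "d \<in> A" and e: "e \<in> A" and y: "y \<in> fst d" "mul g y \<in> fst e"
  obtains r L where "0 < r" "ball (snd d y) r \<subseteq> snd d ` fst d"
    "\<And>x. x \<in> ball (snd d y) r \<Longrightarrow> mul g (chart_inv d x) \<in> fst e"
    "L-lipschitz_on (ball (snd d y) r) (\<lambda>x. snd e (mul g (chart_inv d x)))"
proof -
  define c where "c = chart_at A g"
  have c: "c \<in> A" "g \<in> fst c" unfolding c_def by (rule chart_at_chart)+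
  have in_dom: "(snd c g, snd d y) \<in> chart_mul_dom c d e"
    using c d e y chart_inv_chart by (auto simp: chart_mul_dom_def)
  obtain r L where r: "0 < r" "ball (snd c g, snd d y) r \<subseteq> chart_mul_dom c d e"
    "L-lipschitz_on (ball (snd c g, snd d y) r) (chart_mul c d e)"
    using smooth_on_locally_lipschitz[OF chart_mul_smooth[OF c(1) d e] open_chart_mul_dom[OF c(1) d e] in_dom] .
  have pair: "(snd c g, x) \<in> ball (snd c g, snd d y) r" if "x \<in> ball (snd d y) r" for x
    using that by (simp add: dist_Pair_Pair)
  have dom: "(snd c g, x) \<in> chart_mul_dom c d e" if "x \<in> ball (snd d y) r" for x
    using pair[OF that] r by auto
  show ?thesis
  proof (rule that[OF r(1), of L])
    show "ball (snd d y) r \<subseteq> snd d ` fst d" using dom by (auto simp: chart_mul_dom_def)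
    show "\<And>x. x \<in> ball (snd d y) r \<Longrightarrow> mul g (chart_inv d x) \<in> fst e"
      using dom chart_inv_chart[OF c] by (auto simp: chart_mul_dom_def)
    show "L-lipschitz_on (ball (snd d y) r) (\<lambda>x. snd e (mul g (chart_inv d x)))"
    proof (rule lipschitz_onI)
      fix x x' assume x: "x \<in> ball (snd d y) r" "x' \<in> ball (snd d y) r"
      have "dist (chart_mul c d e (snd c g, x)) (chart_mul c d e (snd c g, x')) \<le> L * dist (snd c g, x) (snd c g, x')"
        by (rule lipschitz_onD[OF r(3) pair pair]) (use x in auto)
      then show "dist (snd e (mul g (chart_inv d x))) (snd e (mul g (chart_inv d x'))) \<le> L * dist x x'"
        using chart_mul_eq[OF c(1) d e dom] x chart_inv_chart[OF c] by (simp add: dist_Pair_Pair)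
    qed (use r(3) in \<open>rule lipschitz_on_nonneg\<close>)
  qed
qed

section \<open>Differentials of left translations and the adjoint representation\<close>

abbreviation "c0 \<equiv> chart_at A unit"
abbreviation "U \<equiv> fst c0"
abbreviation "\<phi> \<equiv> snd c0"
abbreviation "\<psi> \<equiv> chart_inv c0"
abbreviation "z \<equiv> \<phi> unit"

lemma c0: "c0 \<in> A" "unit \<in> U"
  by (rule chart_at_chart)+

lemma z_in: "z \<in> \<phi> ` U" using c0 by simp

lemma dL_chart_deriv: "chart_deriv c0 (chart_at A g) (mul g) unit (dL g)"
proof -
  obtain D where "chart_deriv c0 (chart_at A g) (mul g) unit D"
    using left_translation_chart_deriv[OF chart_at_chart(1)[of g] c0(1) chart_at_chart(1)[of g] chart_at_chart(2)[of g] c0(2)]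
      chart_at_chart(2)[of g] by auto
  then have D: "mul g unit \<in> fst (chart_at A g)"
    "((snd (chart_at A g) \<circ> mul g \<circ> \<psi>) has_derivative D) (at z)"
    by (auto simp: chart_deriv_def)
  have "dL g = frechet_derivative (snd (chart_at A g) \<circ> mul g \<circ> \<psi>) (at z)"
    unfolding dL_def differential_def by (simp add: E_UNIV)
  then have "dL g = D" using frechet_derivative_at[OF D(2)] by simp
  then show ?thesis using D c0 by (simp add: chart_deriv_def)
qed

text \<open>Conjugation is left translation by \<open>g\<close>, read in the chart at
  \<open>g\<close>, followed by right translation by \<open>ginv g\<close>, which leads back to
  \<open>unit\<close> and \<open>c0\<close>.\<close>

lemma Ad_chart_deriv: "chart_deriv c0 c0 (\<lambda>x. mul (mul g x) (ginv g)) unit (Ad g)"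
proof -
  let ?c = "chart_at A g" and ?i = "chart_at A (ginv g)"
  obtain D where D: "chart_deriv c0 ?c (mul g) unit D" using dL_chart_deriv by blast
  have "mul (mul g unit) (ginv g) = unit" by simp
  then obtain D' where D': "chart_deriv ?c c0 (\<lambda>x. mul x (ginv g)) (mul g unit) D'"
    using right_translation_chart_deriv[OF chart_at_chart(1)[of g] chart_at_chart(1)[of "ginv g"] c0(1),
        of "mul g unit" "ginv g"]
      chart_at_chart(2)[of g] chart_at_chart(2)[of "ginv g"] c0(2) by auto
  have "chart_deriv c0 c0 (\<lambda>x. mul (mul g x) (ginv g)) unit (\<lambda>v. D' (D v))"
    by (rule chart_deriv_compose[OF D D' c0(1) chart_at_chart(1)]) (intro continuous_intros)
  then have D'': "((\<phi> \<circ> (\<lambda>x. mul (mul g x) (ginv g)) \<circ> \<psi>) has_derivative (\<lambda>v. D' (D v))) (at z)"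
    by (simp add: chart_deriv_def)
  have "Ad g = frechet_derivative (\<phi> \<circ> (\<lambda>x. mul (mul g x) (ginv g)) \<circ> \<psi>) (at z)"
    unfolding Ad_def differential_def by (simp add: E_UNIV)
  then have "Ad g = (\<lambda>v. D' (D v))" using frechet_derivative_at[OF D''] by simp
  then show ?thesis using D'' c0 by (simp add: chart_deriv_def)
qed

lemma conj_cont: "continuous_on UNIV (\<lambda>x. mul (mul g x) (ginv g))"
  by (intro continuous_intros)

lemma linear_Ad: "linear (Ad g)"
  using Ad_chart_deriv has_derivative_linear by (auto simp: chart_deriv_def)

lemma Ad_mul: "Ad (mul g h) v = Ad g (Ad h v)"
proof -
  have "chart_deriv c0 c0 (\<lambda>x. mul (mul g (mul (mul h x) (ginv h))) (ginv g)) unit (\<lambda>v. Ad g (Ad h v))"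
    by (rule chart_deriv_compose[OF Ad_chart_deriv _ c0(1) c0(1) conj_cont]) (use Ad_chart_deriv in simp)
  moreover have "(\<lambda>x. mul (mul g (mul (mul h x) (ginv h))) (ginv g)) = (\<lambda>x. mul (mul (mul g h) x) (ginv (mul g h)))"
    by (simp add: assoc inverse_distrib_swap)
  ultimately show ?thesis using chart_deriv_unique[OF Ad_chart_deriv[of "mul g h"]] by metis
qed

lemma Ad_unit: "Ad unit v = v"
proof -
  have "(\<lambda>x. mul (mul unit x) (ginv unit)) = (\<lambda>x. x)" by simp
  then show ?thesis using chart_deriv_unique[OF Ad_chart_deriv[of unit]] chart_deriv_id[OF c0] by metis
qed

lemma linear_dL: "linear (dL g)"
  using dL_chart_deriv has_derivative_linear by (auto simp: chart_deriv_def)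

text \<open>The derivative of left translation by \<open>ginv g\<close> is a left inverse.
  Injectivity lets \<open>control\<close> recover the translated vector.\<close>

lemma inj_dL: "inj (dL g)"
proof -
  let ?c = "chart_at A g"
  obtain D where D: "chart_deriv ?c c0 (mul (ginv g)) (mul g unit) D"
    using left_translation_chart_deriv[OF chart_at_chart(1)[of "ginv g"] chart_at_chart(1)[of g] c0(1)
        chart_at_chart(2)[of "ginv g"], of "mul g unit"] chart_at_chart(2)[of g] c0(2) by auto
  have "chart_deriv c0 c0 (\<lambda>x. mul (ginv g) (mul g x)) unit (\<lambda>v. D (dL g v))"
    by (rule chart_deriv_compose[OF dL_chart_deriv D c0(1) chart_at_chart(1)]) (intro continuous_intros)
  moreover have "(\<lambda>x. mul (ginv g) (mul g x)) = (\<lambda>x. x)" by (simp add: assoc[symmetric])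
  ultimately have "(\<lambda>v. D (dL g v)) = (\<lambda>v. v)"
    using chart_deriv_unique[OF _ chart_deriv_id[OF c0]] by metis
  then show ?thesis by (metis injI)
qed

section \<open>Left- and right-invariant frames and regularity of \<open>Ad\<close> near the
  unit\<close>

text \<open>For \<open>x\<close> in the chart image, \<open>lframe x v\<close> and its right-handed
  analogue \<open>rframe x v\<close> are the values at \<open>x\<close> of the left- and
  right-invariant fields equal to \<open>v\<close> at \<open>unit\<close>. Being partial derivatives
  of one smooth map, they depend smoothly on \<open>x\<close>.\<close>

definition lframe :: "'e \<Rightarrow> 'e \<Rightarrow> 'e" where
  "lframe x v = frechet_derivative (chart_mul c0 c0 c0) (at (x, z)) (0, v)"

definition rframe :: "'e \<Rightarrow> 'e \<Rightarrow> 'e" where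
  "rframe x v = frechet_derivative (chart_mul c0 c0 c0) (at (z, x)) (v, 0)"

lemma lframe_chart_deriv: "x \<in> \<phi> ` U \<Longrightarrow> chart_deriv c0 c0 (mul (\<psi> x)) unit (lframe x)"
  using left_translation_chart_deriv[OF c0(1) c0(1) c0(1) _ c0(2), of "\<psi> x"]
    chart_inv_in[OF c0(1)] chart_chart_inv[OF c0(1)] by (simp add: lframe_def[abs_def])

lemma rframe_chart_deriv: "x \<in> \<phi> ` U \<Longrightarrow> chart_deriv c0 c0 (\<lambda>y. mul y (\<psi> x)) unit (rframe x)"
  using right_translation_chart_deriv[OF c0(1) c0(1) c0(1) c0(2), of "\<psi> x"]
    chart_inv_in[OF c0(1)] chart_chart_inv[OF c0(1)] by (simp add: rframe_def[abs_def])

lemma linear_lframe: "x \<in> \<phi> ` U \<Longrightarrow> linear (lframe x)"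
  using lframe_chart_deriv has_derivative_linear by (auto simp: chart_deriv_def)

lemma linear_rframe: "x \<in> \<phi> ` U \<Longrightarrow> linear (rframe x)"
  using rframe_chart_deriv has_derivative_linear by (auto simp: chart_deriv_def)

text \<open>Conjugation by \<open>\<psi> x\<close> followed by right translation by
  \<open>\<psi> x\<close> is left translation by \<open>\<psi> x\<close>. Wherever
  \<open>rframe x\<close> is invertible this writes \<open>Ad (\<psi> x)\<close> as its inverse
  applied to \<open>lframe x\<close>, so regularity of \<open>Ad\<close> follows from that of the
  frames.\<close>

lemma rframe_Ad:
  assumes x: "x \<in> \<phi> ` U"
  shows "rframe x (Ad (\<psi> x) v) = lframe x v"
proof -
  have 1: "chart_deriv c0 c0 (\<lambda>y. mul y (\<psi> x)) (mul (mul (\<psi> x) unit) (ginv (\<psi> x))) (rframe x)"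
    using rframe_chart_deriv[OF x] by simp
  have "chart_deriv c0 c0 (\<lambda>y. mul (mul (mul (\<psi> x) y) (ginv (\<psi> x))) (\<psi> x)) unit (\<lambda>v. rframe x (Ad (\<psi> x) v))"
    by (rule chart_deriv_compose[OF Ad_chart_deriv 1 c0(1) c0(1) conj_cont])
  moreover have "(\<lambda>y. mul (mul (mul (\<psi> x) y) (ginv (\<psi> x))) (\<psi> x)) = mul (\<psi> x)"
    by (simp add: assoc fun_eq_iff)
  ultimately show ?thesis using chart_deriv_unique[OF lframe_chart_deriv[OF x]] by metis
qed

lemma lframe_unit: "lframe z v = v"
proof -
  have "mul (\<psi> z) = (\<lambda>x. x)" using chart_inv_chart[OF c0] by (simp add: fun_eq_iff)
  then have "chart_deriv c0 c0 (\<lambda>x. x) unit (lframe z)" using lframe_chart_deriv[OF z_in] by simp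
  then show ?thesis using chart_deriv_unique[OF _ chart_deriv_id[OF c0]] by metis
qed

lemma rframe_unit: "rframe z v = v"
proof -
  have "chart_deriv c0 c0 (\<lambda>x. x) unit (rframe z)"
    using rframe_chart_deriv[OF z_in] chart_inv_chart[OF c0] by simp
  then show ?thesis using chart_deriv_unique[OF _ chart_deriv_id[OF c0]] by metis
qed

lemma dom_z:
  assumes "x \<in> \<phi> ` U"
  shows "(x, z) \<in> chart_mul_dom c0 c0 c0" "(z, x) \<in> chart_mul_dom c0 c0 c0"
  using assms c0 chart_inv_chart[OF c0] chart_inv_in[OF c0(1)] by (auto simp: chart_mul_dom_def)

lemma lframe_has_derivative:
  assumes "x \<in> \<phi> ` U"
  shows "((\<lambda>x. lframe x v) has_derivative (\<lambda>h. frechet_derivative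
    (\<lambda>q. frechet_derivative (chart_mul c0 c0 c0) (at q) (0, v)) (at (x, z)) (h, 0))) (at x)"
proof -
  have "((\<lambda>x. (x, z)) has_derivative (\<lambda>h. (h, 0))) (at x)" by (auto intro!: derivative_eq_intros)
  from has_derivative_compose[OF this smooth_on_has_derivative[OF smooth_on_derivative[OF chart_mul_smooth] dom_z(1)]] assms c0
  show ?thesis by (simp add: lframe_def)
qed

lemma rframe_has_derivative:
  assumes "x \<in> \<phi> ` U"
  shows "((\<lambda>x. rframe x v) has_derivative (\<lambda>h. frechet_derivative
    (\<lambda>q. frechet_derivative (chart_mul c0 c0 c0) (at q) (v, 0)) (at (z, x)) (0, h))) (at x)"
proof -
  have "((\<lambda>x. (z, x)) has_derivative (\<lambda>h. (0, h))) (at x)" by (auto intro!: derivative_eq_intros)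
  from has_derivative_compose[OF this smooth_on_has_derivative[OF smooth_on_derivative[OF chart_mul_smooth] dom_z(2)]] assms c0
  show ?thesis by (simp add: rframe_def)
qed

text \<open>The vanishing derivative is \<open>[v, v] = 0\<close>, which in coordinates is the symmetry of the
  second derivative of the multiplication.\<close>

lemma frames_diff_has_derivative:
  obtains R where "((\<lambda>x. lframe x v - rframe x v) has_derivative R) (at z)" "R v = 0"
proof (rule that[OF has_derivative_diff[OF lframe_has_derivative[OF z_in] rframe_has_derivative[OF z_in]]])
  show "frechet_derivative (\<lambda>q. frechet_derivative (chart_mul c0 c0 c0) (at q) (0, v)) (at (z, z)) (v, 0) -
    frechet_derivative (\<lambda>q. frechet_derivative (chart_mul c0 c0 c0) (at q) (v, 0)) (at (z, z)) (0, v) = 0"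
    using smooth_on_symmetric_second_derivative[OF chart_mul_smooth[OF c0(1) c0(1) c0(1)]
        open_chart_mul_dom[OF c0(1) c0(1) c0(1)] dom_z(1)[OF z_in], of "(0, v)" "(v, 0)"] by simp
qed

text \<open>Every fixed direction has its own radius and Lipschitz constant. The smallest radius and
  the sum of the constants over the finite basis of the product space serve all basis directions,
  and linearity extends the bound.\<close>

lemma frames_lipschitz_near_unit:
  obtains r L where "0 < r" "ball z r \<subseteq> \<phi> ` U" "0 \<le> L"
    "\<And>x y v. x \<in> ball z r \<Longrightarrow> y \<in> ball z r \<Longrightarrow> norm (lframe x v - lframe y v) \<le> L * norm (x - y) * norm v"
    "\<And>x y v. x \<in> ball z r \<Longrightarrow> y \<in> ball z r \<Longrightarrow> norm (rframe x v - rframe y v) \<le> L * norm (x - y) * norm v"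
proof -
  let ?D = "chart_mul_dom c0 c0 c0" and ?m = "chart_mul c0 c0 c0"
  have "\<exists>r>0. \<exists>L. ball (z, z) r \<subseteq> ?D \<and> L-lipschitz_on (ball (z, z) r) (\<lambda>q. frechet_derivative ?m (at q) w)" for w
    using smooth_on_locally_lipschitz[OF smooth_on_derivative[OF chart_mul_smooth] open_chart_mul_dom dom_z(1)[OF z_in]] c0
    by metis
  then obtain r L where rL: "\<And>w. r w > 0 \<and> ball (z, z) (r w) \<subseteq> ?D \<and>
    (L w)-lipschitz_on (ball (z, z) (r w)) (\<lambda>q. frechet_derivative ?m (at q) w)" by metis
  have L0: "0 \<le> L w" for w using rL[of w] lipschitz_on_nonneg by blast
  define B where "B = (Basis :: ('e \<times> 'e) set)"
  have fB: "finite B" "B \<noteq> {}" by (auto simp: B_def)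
  define r0 where "r0 = Min (r ` B)"
  have r0: "0 < r0" "\<And>w. w \<in> B \<Longrightarrow> r0 \<le> r w" using fB rL by (auto simp: r0_def)
  define L' where "L' = (\<Sum>w\<in>B. L w)"
  have L': "0 \<le> L'" unfolding L'_def by (rule sum_nonneg) (rule L0)
  have sub: "ball (z, z) r0 \<subseteq> ?D"
  proof -
    obtain w where "w \<in> B" using fB by blast
    have "ball (z, z) r0 \<subseteq> ball (z, z) (r w)" by (rule subset_ball[OF r0(2)[OF \<open>w \<in> B\<close>]])
    then show ?thesis using rL[of w] by blast
  qed
  have est: "norm (frechet_derivative ?m (at q) w - frechet_derivative ?m (at q') w) \<le> L' * norm (q - q') * norm w"
    if q: "q \<in> ball (z, z) r0" "q' \<in> ball (z, z) r0" for q q' w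
  proof -
    have lin: "linear (frechet_derivative ?m (at q))" if "q \<in> ball (z, z) r0" for q
      using has_derivative_linear[OF smooth_on_has_derivative[OF chart_mul_smooth]] c0 sub that by blast
    have "linear (\<lambda>w. frechet_derivative ?m (at q) w - frechet_derivative ?m (at q') w)"
      using lin[OF q(1)] lin[OF q(2)] by (rule linear_compose_sub)
    from linear_norm_le_sum_Basis[OF this]
    have "norm (frechet_derivative ?m (at q) w - frechet_derivative ?m (at q') w)
      \<le> (\<Sum>b\<in>B. norm (frechet_derivative ?m (at q) b - frechet_derivative ?m (at q') b)) * norm w"
      by (simp add: B_def)
    also have "\<dots> \<le> (\<Sum>b\<in>B. L b * norm (q - q')) * norm w"
    proof (intro mult_right_mono sum_mono)
      fix b assume "b \<in> B"
      then have "q \<in> ball (z, z) (r b)" "q' \<in> ball (z, z) (r b)" using q r0(2) by fastforce+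
      then show "norm (frechet_derivative ?m (at q) b - frechet_derivative ?m (at q') b) \<le> L b * norm (q - q')"
        using rL[of b] lipschitz_onD by (fastforce simp: dist_norm)
    qed simp
    finally show ?thesis by (simp add: L'_def sum_distrib_right)
  qed
  obtain r1 where r1: "0 < r1" "ball z r1 \<subseteq> \<phi> ` U"
    using open_chart_image[OF c0(1)] z_in open_contains_ball by blast
  show ?thesis
  proof (rule that[of "min r0 r1" L'])
    fix x y v assume "x \<in> ball z (min r0 r1)" "y \<in> ball z (min r0 r1)"
    then have q: "(x, z) \<in> ball (z, z) r0" "(y, z) \<in> ball (z, z) r0" "(z, x) \<in> ball (z, z) r0" "(z, y) \<in> ball (z, z) r0"
      by (auto simp: dist_Pair_Pair)
    show "norm (lframe x v - lframe y v) \<le> L' * norm (x - y) * norm v"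
      using est[OF q(1,2), of "(0, v)"] by (simp add: lframe_def norm_Pair)
    show "norm (rframe x v - rframe y v) \<le> L' * norm (x - y) * norm v"
      using est[OF q(3,4), of "(v, 0)"] by (simp add: rframe_def norm_Pair)
  qed (use r0 r1 L' in auto)
qed

text \<open>The right frame is the identity at \<open>z\<close>, hence bounded below by
  \<open>1 / 2\<close> nearby. Applied to a difference of values of \<open>Ad\<close>, it produces
  differences of frames, which are Lipschitz.\<close>

lemma Ad_near_unit:
  obtains r L where "0 < r" "ball z r \<subseteq> \<phi> ` U" "0 \<le> L"
    "\<And>x y v. x \<in> ball z r \<Longrightarrow> y \<in> ball z r \<Longrightarrow> norm (Ad (\<psi> x) v - Ad (\<psi> y) v) \<le> L * norm (x - y) * norm v"
    "\<And>x y v. x \<in> ball z r \<Longrightarrow> y \<in> ball z r \<Longrightarrow> norm (lframe x v - lframe y v) \<le> L * norm (x - y) * norm v"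
    "\<And>x v. x \<in> ball z r \<Longrightarrow> norm v \<le> 2 * norm (rframe x v)"
proof -
  obtain r L where r: "0 < r" "ball z r \<subseteq> \<phi> ` U" "0 \<le> L"
    and PL: "\<And>x y v. x \<in> ball z r \<Longrightarrow> y \<in> ball z r \<Longrightarrow> norm (lframe x v - lframe y v) \<le> L * norm (x - y) * norm v"
    and QL: "\<And>x y v. x \<in> ball z r \<Longrightarrow> y \<in> ball z r \<Longrightarrow> norm (rframe x v - rframe y v) \<le> L * norm (x - y) * norm v"
    using frames_lipschitz_near_unit by metis
  \<comment> \<open>On this radius both frames differ from the identity by at most
    \<open>1 / 2\<close> in norm, which yields the factors 2 in \<open>Q2\<close> and
    \<open>P2\<close>.\<close>
  define r' where "r' = min r (1 / (2 * (L + 1)))"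
  have r': "0 < r'" "r' \<le> r" "L * r' \<le> 1 / 2"
  proof -
    show "0 < r'" "r' \<le> r" using r by (auto simp: r'_def)
    have "L * r' \<le> L * (1 / (2 * (L + 1)))" using r(3) by (intro mult_left_mono) (auto simp: r'_def)
    also have "\<dots> \<le> 1 / 2" using r(3) by (simp add: field_simps)
    finally show "L * r' \<le> 1 / 2" .
  qed
  have sub: "x \<in> ball z r" "x \<in> \<phi> ` U" if "x \<in> ball z r'" for x using that r r' by auto
  have near: "L * norm (x - z) * norm v \<le> (1 / 2) * norm v" if "x \<in> ball z r'" for x and v :: 'e
  proof (rule mult_right_mono)
    have "L * norm (x - z) \<le> L * r'"
      using that r(3) by (intro mult_left_mono) (auto simp: dist_norm norm_minus_commute)
    then show "L * norm (x - z) \<le> 1 / 2" using r'(3) by simp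
  qed simp
  have zr: "z \<in> ball z r" using r by simp
  have Q2: "norm v \<le> 2 * norm (rframe x v)" if "x \<in> ball z r'" for x v
    using QL[OF sub(1)[OF that] zr, of v] near[OF that, of v] rframe_unit[of v] norm_triangle_sub[of v "rframe x v"]
    by (simp add: norm_minus_commute)
  have P2: "norm (lframe x v) \<le> 2 * norm v" if "x \<in> ball z r'" for x v
  proof -
    have "norm (lframe x v - v) \<le> (1 / 2) * norm v"
      using PL[OF sub(1)[OF that] zr, of v] near[OF that, of v] unfolding lframe_unit by (rule order_trans)
    then show ?thesis using norm_triangle_sub[of "lframe x v" v] norm_ge_zero[of v] by linarith
  qed
  have Ad2: "norm (Ad (\<psi> x) v) \<le> 4 * norm v" if "x \<in> ball z r'" for x v
    using Q2[OF that, of "Ad (\<psi> x) v"] P2[OF that, of v] rframe_Ad[OF sub(2)[OF that], of v] by simp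
  \<comment> \<open>Here \<open>10 = 2 * (1 + 4)\<close>: the factor 2 inverts the right frame, 1
    and 4 bound the vectors \<open>v\<close> and \<open>Ad (\<psi> y) v\<close> on which the frame
    differences act.\<close>
  have AdL: "norm (Ad (\<psi> x) v - Ad (\<psi> y) v) \<le> 10 * L * norm (x - y) * norm v"
    if x: "x \<in> ball z r'" and y: "y \<in> ball z r'" for x y v
  proof -
    have "rframe x (Ad (\<psi> x) v - Ad (\<psi> y) v) = (lframe x v - lframe y v) - (rframe x (Ad (\<psi> y) v) - rframe y (Ad (\<psi> y) v))"
      by (simp add: linear_diff[OF linear_rframe[OF sub(2)[OF x]]] rframe_Ad[OF sub(2)[OF x]] rframe_Ad[OF sub(2)[OF y]])
    then have "norm (rframe x (Ad (\<psi> x) v - Ad (\<psi> y) v)) \<le> norm (lframe x v - lframe y v) + norm (rframe x (Ad (\<psi> y) v) - rframe y (Ad (\<psi> y) v))"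
      using norm_triangle_ineq4 by metis
    also have "\<dots> \<le> L * norm (x - y) * norm v + L * norm (x - y) * norm (Ad (\<psi> y) v)"
      using PL QL sub(1) x y by (intro add_mono) auto
    also have "\<dots> \<le> L * norm (x - y) * norm v + L * norm (x - y) * (4 * norm v)"
      using Ad2[OF y, of v] r(3) by (intro add_left_mono mult_left_mono) auto
    finally have "norm (rframe x (Ad (\<psi> x) v - Ad (\<psi> y) v)) \<le> 5 * (L * norm (x - y) * norm v)"
      by (simp add: mult_ac)
    then show ?thesis using Q2[OF x, of "Ad (\<psi> x) v - Ad (\<psi> y) v"] by simp
  qed
  show ?thesis
  proof (rule that[of r' "10 * L"])
    show "norm (lframe x v - lframe y v) \<le> 10 * L * norm (x - y) * norm v"
      if "x \<in> ball z r'" "y \<in> ball z r'" for x y v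
    proof -
      have "norm (lframe x v - lframe y v) \<le> L * norm (x - y) * norm v" using PL sub(1) that by blast
      also have "\<dots> \<le> 10 * L * norm (x - y) * norm v" using r(3) by (intro mult_right_mono) auto
      finally show ?thesis .
    qed
    show "ball z r' \<subseteq> \<phi> ` U" using sub(2) by blast
  qed (use r r' AdL Q2 in simp_all)
qed

text \<open>Classically the derivative is \<open>ad u u\<close>. The gap \<open>\<rho>\<close>
  between the two frames on \<open>u\<close> has derivative zero along \<open>y\<close>, because the
  derivative of the gap at \<open>z\<close> kills the velocity \<open>u\<close>. Since
  \<open>rframe\<close> maps \<open>Ad (\<psi> (y s)) u - u\<close> to \<open>\<rho> s\<close> and
  is bounded below, the vanishing carries over to \<open>Ad\<close>.\<close>

lemma Ad_along_curve:
  assumes y: "(y has_vector_derivative u) (at t)" and yt: "y t = z"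
  shows "((\<lambda>s. Ad (\<psi> (y s)) u) has_vector_derivative 0) (at t)"
proof -
  obtain r L where r: "0 < r" "ball z r \<subseteq> \<phi> ` U"
    and Q2: "\<And>x v. x \<in> ball z r \<Longrightarrow> norm v \<le> 2 * norm (rframe x v)"
    using Ad_near_unit by metis
  obtain R where R: "((\<lambda>x. lframe x u - rframe x u) has_derivative R) (at z)" "R u = 0"
    using frames_diff_has_derivative by metis
  define \<rho> where "\<rho> s = lframe (y s) u - rframe (y s) u" for s
  have \<rho>t: "\<rho> t = 0" by (simp add: \<rho>_def yt lframe_unit rframe_unit)
  have "(\<rho> has_derivative (\<lambda>h. R (h *\<^sub>R u))) (at t)"
    unfolding \<rho>_def
    using has_derivative_compose[OF y[unfolded has_vector_derivative_def], of "\<lambda>x. lframe x u - rframe x u" R] R(1) yt by simp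
  then have \<rho>: "(\<rho> has_derivative (\<lambda>h. 0)) (at t)"
    using R(2) linear_cmul[OF has_derivative_linear[OF R(1)]] by simp
  have "isCont y t" using y has_vector_derivative_continuous by blast
  then have "\<forall>\<^sub>F s in at t. y s \<in> ball z r"
    unfolding isCont_def using topological_tendstoD[of y "y t" "at t" "ball z r"] r yt by simp
  then have ev: "\<forall>\<^sub>F s in at t. norm (Ad (\<psi> (y s)) u - u) \<le> 2 * norm (\<rho> s)"
  proof (rule eventually_mono)
    fix s assume s: "y s \<in> ball z r"
    then have "y s \<in> \<phi> ` U" using r by auto
    then have "rframe (y s) (Ad (\<psi> (y s)) u - u) = \<rho> s"
      by (simp add: \<rho>_def linear_diff[OF linear_rframe] rframe_Ad)
    then show "norm (Ad (\<psi> (y s)) u - u) \<le> 2 * norm (\<rho> s)" using Q2[OF s, of "Ad (\<psi> (y s)) u - u"] by simp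
  qed
  have lim\<rho>: "((\<lambda>s. 2 * (norm (\<rho> s) / norm (s - t))) \<longlongrightarrow> 0) (at t)"
  proof -
    have "((\<lambda>s. norm (\<rho> s - \<rho> t - 0) / norm (s - t)) \<longlongrightarrow> 0) (at t)"
      using \<rho> unfolding has_derivative_iff_norm by blast
    from tendsto_mult_right_zero[OF this, of 2] show ?thesis by (simp only: \<rho>t diff_0_right)
  qed
  have Adt: "Ad (\<psi> (y t)) u = u" using yt chart_inv_chart[OF c0] Ad_unit by simp
  have "((\<lambda>s. norm (Ad (\<psi> (y s)) u - Ad (\<psi> (y t)) u - 0) / norm (s - t)) \<longlongrightarrow> 0) (at t)"
  proof (rule Lim_null_comparison[OF _ lim\<rho>])
    show "\<forall>\<^sub>F s in at t. norm (norm (Ad (\<psi> (y s)) u - Ad (\<psi> (y t)) u - 0) / norm (s - t)) \<le> 2 * (norm (\<rho> s) / norm (s - t))"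
      by (rule eventually_mono[OF ev]) (simp add: Adt divide_right_mono)
  qed
  then show ?thesis by (simp add: has_vector_derivative_def has_derivative_iff_norm)
qed

section \<open>Curves in Lie groups\<close>


text \<open>The velocity of \<open>\<gamma>\<close> at \<open>t\<close> translated back to \<open>unit\<close>, that is, the control; unlike
  \<^const>\<open>velocity\<close> it involves no chart that varies with the point.\<close>

definition lderiv :: "(real \<Rightarrow> 'g) \<Rightarrow> real \<Rightarrow> 'e \<Rightarrow> bool" where
  "lderiv \<gamma> t u \<longleftrightarrow> ((\<lambda>s. \<phi> (mul (ginv (\<gamma> t)) (\<gamma> s))) has_vector_derivative u) (at t)"

section \<open>Curves that are locally Lipschitz in charts\<close>

text \<open>Intersecting with \<open>I\<close> makes neighbourhoods one-sided at the ends of a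
  closed interval. Changing the chart around \<open>\<gamma> t\<close> affects the constants but not
  the property.\<close>

definition chart_lipschitz_at :: "('g, 'e) chart \<Rightarrow> real set \<Rightarrow> (real \<Rightarrow> 'g) \<Rightarrow> real \<Rightarrow> bool" where
  "chart_lipschitz_at c I \<gamma> t \<longleftrightarrow> (\<exists>\<delta>>0. \<exists>L. \<gamma> ` (I \<inter> ball t \<delta>) \<subseteq> fst c \<and>
     L-lipschitz_on (I \<inter> ball t \<delta>) (\<lambda>s. snd c (\<gamma> s)))"

lemma chart_lipschitz_at_translate:
  assumes c: "c \<in> A" and d: "d \<in> A" and lip: "chart_lipschitz_at c I \<gamma> t" and t: "t \<in> I"
    and gd: "mul g (\<gamma> t) \<in> fst d"
  shows "chart_lipschitz_at d I (\<lambda>s. mul g (\<gamma> s)) t"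
proof -
  obtain \<delta> L where \<delta>: "0 < \<delta>" "\<gamma> ` (I \<inter> ball t \<delta>) \<subseteq> fst c"
    "L-lipschitz_on (I \<inter> ball t \<delta>) (\<lambda>s. snd c (\<gamma> s))"
    using lip by (auto simp: chart_lipschitz_at_def)
  have L: "0 \<le> L" using \<delta>(3) by (rule lipschitz_on_nonneg)
  have tc: "\<gamma> t \<in> fst c" using \<delta> t by auto
  obtain r M where r: "0 < r" "ball (snd c (\<gamma> t)) r \<subseteq> snd c ` fst c"
    "\<And>x. x \<in> ball (snd c (\<gamma> t)) r \<Longrightarrow> mul g (chart_inv c x) \<in> fst d"
    "M-lipschitz_on (ball (snd c (\<gamma> t)) r) (\<lambda>x. snd d (mul g (chart_inv c x)))"
    using left_translation_locally_lipschitz[OF c d tc gd] by metis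
  define \<delta>' where "\<delta>' = min \<delta> (r / (L + 1))"
  have \<delta>': "0 < \<delta>'" using \<delta> r L by (simp add: \<delta>'_def)
  have s: "\<gamma> s \<in> fst c" "snd c (\<gamma> s) \<in> ball (snd c (\<gamma> t)) r" if "s \<in> I \<inter> ball t \<delta>'" for s
  proof -
    have s\<delta>: "s \<in> I \<inter> ball t \<delta>" "t \<in> I \<inter> ball t \<delta>" using that \<delta> t by (auto simp: \<delta>'_def)
    then show "\<gamma> s \<in> fst c" using \<delta> by auto
    have "dist (snd c (\<gamma> t)) (snd c (\<gamma> s)) \<le> L * dist t s" by (rule lipschitz_onD[OF \<delta>(3)]) (use s\<delta> in auto)
    also have "\<dots> \<le> L * (r / (L + 1))" using that L by (intro mult_left_mono) (auto simp: \<delta>'_def)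
    also have "\<dots> < r" using L r by (simp add: field_simps)
    finally show "snd c (\<gamma> s) \<in> ball (snd c (\<gamma> t)) r" by simp
  qed
  have "(M * L)-lipschitz_on (I \<inter> ball t \<delta>') (\<lambda>s. snd d (mul g (\<gamma> s)))"
  proof (rule lipschitz_onI)
    fix s s' assume ss: "s \<in> I \<inter> ball t \<delta>'" "s' \<in> I \<inter> ball t \<delta>'"
    have "dist (snd d (mul g (chart_inv c (snd c (\<gamma> s))))) (snd d (mul g (chart_inv c (snd c (\<gamma> s'))))) \<le> M * dist (snd c (\<gamma> s)) (snd c (\<gamma> s'))"
      by (rule lipschitz_onD[OF r(4)]) (use s ss in auto)
    also have "\<dots> \<le> M * (L * dist s s')"
      using lipschitz_on_nonneg[OF r(4)] lipschitz_onD[OF \<delta>(3), of s s'] ss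
      by (intro mult_left_mono) (auto simp: \<delta>'_def)
    finally show "dist (snd d (mul g (\<gamma> s))) (snd d (mul g (\<gamma> s'))) \<le> M * L * dist s s'"
      using s(1) ss chart_inv_chart[OF c] by (simp add: mult.assoc)
  qed (use L lipschitz_on_nonneg[OF r(4)] in simp)
  moreover have "mul g (\<gamma> s) \<in> fst d" if "s \<in> I \<inter> ball t \<delta>'" for s
    using r(3)[OF s(2)[OF that]] chart_inv_chart[OF c s(1)[OF that]] by simp
  ultimately show ?thesis
    unfolding chart_lipschitz_at_def using \<delta>' by (intro exI[of _ \<delta>'] exI[of _ "M * L"] conjI) auto
qed

text \<open>Translation by \<open>unit\<close> is the identity map read in two charts.\<close>

lemma chart_lipschitz_at_change:
  assumes "c \<in> A" "d \<in> A" "chart_lipschitz_at c I \<gamma> t" "t \<in> I" "\<gamma> t \<in> fst d"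
  shows "chart_lipschitz_at d I \<gamma> t"
  using chart_lipschitz_at_translate[OF assms(1-4), of unit] assms(5) by simp

lemma chart_lipschitz_at_cong:
  assumes "chart_lipschitz_at c I \<gamma> t" "0 < \<delta>" "\<And>s. s \<in> J \<inter> ball t \<delta> \<Longrightarrow> s \<in> I \<and> \<gamma>' s = \<gamma> s"
  shows "chart_lipschitz_at c J \<gamma>' t"
proof -
  obtain \<epsilon> L where \<epsilon>: "0 < \<epsilon>" "\<gamma> ` (I \<inter> ball t \<epsilon>) \<subseteq> fst c"
    "L-lipschitz_on (I \<inter> ball t \<epsilon>) (\<lambda>s. snd c (\<gamma> s))"
    using assms(1) by (auto simp: chart_lipschitz_at_def)
  have sub: "s \<in> I \<inter> ball t \<epsilon>" "\<gamma>' s = \<gamma> s" if "s \<in> J \<inter> ball t (min \<delta> \<epsilon>)" for s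
    using assms(3)[of s] that by auto
  have "L-lipschitz_on (J \<inter> ball t (min \<delta> \<epsilon>)) (\<lambda>s. snd c (\<gamma>' s))"
    using lipschitz_onD[OF \<epsilon>(3)] lipschitz_on_nonneg[OF \<epsilon>(3)] sub by (intro lipschitz_onI) simp_all
  moreover have "\<gamma>' ` (J \<inter> ball t (min \<delta> \<epsilon>)) \<subseteq> fst c"
  proof (rule image_subsetI)
    fix s assume s: "s \<in> J \<inter> ball t (min \<delta> \<epsilon>)"
    have "\<gamma> s \<in> fst c" using \<epsilon>(2) sub(1)[OF s] by blast
    then show "\<gamma>' s \<in> fst c" by (simp only: sub(2)[OF s])
  qed
  ultimately show ?thesis
    unfolding chart_lipschitz_at_def using assms(2) \<epsilon>(1) by (intro exI[of _ "min \<delta> \<epsilon>"]) auto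
qed

text \<open>Points on opposite sides of \<open>t\<close> are compared through \<open>t\<close>;
  distances on the line add up, so the larger of the two constants still serves.\<close>

lemma chart_lipschitz_at_join:
  assumes c1: "chart_lipschitz_at c {a..t} \<gamma> t" and c2: "chart_lipschitz_at c {t..b} \<gamma> t" and ab: "a \<le> t" "t \<le> b"
  shows "chart_lipschitz_at c {a..b} \<gamma> t"
proof -
  obtain \<delta>1 L1 where \<delta>1: "0 < \<delta>1" "\<gamma> ` ({a..t} \<inter> ball t \<delta>1) \<subseteq> fst c"
    "L1-lipschitz_on ({a..t} \<inter> ball t \<delta>1) (\<lambda>s. snd c (\<gamma> s))"
    using c1 by (auto simp: chart_lipschitz_at_def)
  obtain \<delta>2 L2 where \<delta>2: "0 < \<delta>2" "\<gamma> ` ({t..b} \<inter> ball t \<delta>2) \<subseteq> fst c"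
    "L2-lipschitz_on ({t..b} \<inter> ball t \<delta>2) (\<lambda>s. snd c (\<gamma> s))"
    using c2 by (auto simp: chart_lipschitz_at_def)
  define \<delta> L where "\<delta> = min \<delta>1 \<delta>2" and "L = max L1 L2"
  have L: "0 \<le> L" using lipschitz_on_nonneg[OF \<delta>1(3)] by (simp add: L_def)
  have l1: "dist (snd c (\<gamma> s)) (snd c (\<gamma> s')) \<le> L * dist s s'"
    if "s \<in> {a..t} \<inter> ball t \<delta>" "s' \<in> {a..t} \<inter> ball t \<delta>" for s s'
  proof -
    have "dist (snd c (\<gamma> s)) (snd c (\<gamma> s')) \<le> L1 * dist s s'"
      by (rule lipschitz_onD[OF \<delta>1(3)]) (use that in \<open>auto simp: \<delta>_def\<close>)
    also have "\<dots> \<le> L * dist s s'" by (intro mult_right_mono) (auto simp: L_def)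
    finally show ?thesis .
  qed
  have l2: "dist (snd c (\<gamma> s)) (snd c (\<gamma> s')) \<le> L * dist s s'"
    if "s \<in> {t..b} \<inter> ball t \<delta>" "s' \<in> {t..b} \<inter> ball t \<delta>" for s s'
  proof -
    have "dist (snd c (\<gamma> s)) (snd c (\<gamma> s')) \<le> L2 * dist s s'"
      by (rule lipschitz_onD[OF \<delta>2(3)]) (use that in \<open>auto simp: \<delta>_def\<close>)
    also have "\<dots> \<le> L * dist s s'" by (intro mult_right_mono) (auto simp: L_def)
    finally show ?thesis .
  qed
  have tt: "t \<in> ball t \<delta>" using \<delta>1 \<delta>2 by (simp add: \<delta>_def)
  have ord: "dist (snd c (\<gamma> s)) (snd c (\<gamma> s')) \<le> L * dist s s'"
    if s: "s \<in> {a..b} \<inter> ball t \<delta>" "s' \<in> {a..b} \<inter> ball t \<delta>" "s \<le> s'" for s s'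
  proof -
    consider "s' \<le> t" | "t \<le> s" | "s < t" "t < s'" by linarith
    then show ?thesis
    proof cases
      case 1
      then show ?thesis using s by (intro l1) auto
    next
      case 2
      then show ?thesis using s by (intro l2) auto
    next
      case 3
      have "dist (snd c (\<gamma> s)) (snd c (\<gamma> s')) \<le> dist (snd c (\<gamma> s)) (snd c (\<gamma> t)) + dist (snd c (\<gamma> t)) (snd c (\<gamma> s'))"
        by (rule dist_triangle)
      also have "\<dots> \<le> L * dist s t + L * dist t s'"
        using 3 s ab tt by (intro add_mono l1 l2) auto
      also have "\<dots> = L * dist s s'" using 3 by (simp add: dist_real_def algebra_simps)
      finally show ?thesis .
    qed
  qed
  have "L-lipschitz_on ({a..b} \<inter> ball t \<delta>) (\<lambda>s. snd c (\<gamma> s))"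
  proof (rule lipschitz_onI)
    fix s s' assume s: "s \<in> {a..b} \<inter> ball t \<delta>" "s' \<in> {a..b} \<inter> ball t \<delta>"
    show "dist (snd c (\<gamma> s)) (snd c (\<gamma> s')) \<le> L * dist s s'"
    proof (cases "s \<le> s'")
      case True
      then show ?thesis by (rule ord[OF s])
    next
      case False
      then have "dist (snd c (\<gamma> s')) (snd c (\<gamma> s)) \<le> L * dist s' s" by (intro ord[OF s(2,1)]) simp
      then show ?thesis by (simp only: dist_commute[of "snd c (\<gamma> s)"] dist_commute[of s])
    qed
  qed (rule L)
  moreover have "\<gamma> ` ({a..b} \<inter> ball t \<delta>) \<subseteq> fst c"
  proof -
    have "{a..b} \<inter> ball t \<delta> \<subseteq> ({a..t} \<inter> ball t \<delta>1) \<union> ({t..b} \<inter> ball t \<delta>2)" by (auto simp: \<delta>_def)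
    then show ?thesis using \<delta>1(2) \<delta>2(2) by blast
  qed
  moreover have "0 < \<delta>" using \<delta>1 \<delta>2 by (simp add: \<delta>_def)
  ultimately show ?thesis
    unfolding chart_lipschitz_at_def by (intro exI[of _ \<delta>] exI[of _ L] conjI)
qed

section \<open>Rules for left-translated velocities\<close>

lemma lderiv_cong:
  assumes "lderiv \<gamma> t u" "open S" "t \<in> S" "\<And>s. s \<in> S \<Longrightarrow> \<gamma>' s = \<gamma> s"
  shows "lderiv \<gamma>' t u"
proof -
  have eq: "\<phi> (mul (ginv (\<gamma> t)) (\<gamma> s)) = \<phi> (mul (ginv (\<gamma>' t)) (\<gamma>' s))" if "s \<in> S" for s
    using assms(4)[OF that] assms(4)[OF assms(3)] by simp
  show ?thesis
    using has_vector_derivative_transform_within_open[OF assms(1)[unfolded lderiv_def] assms(2,3) eq]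
    by (simp add: lderiv_def)
qed

lemma lderiv_shift:
  assumes "lderiv \<gamma> (t - a) u"
  shows "lderiv (\<lambda>s. \<gamma> (s - a)) t u"
proof -
  have "((\<lambda>s. s - a) has_derivative (\<lambda>h. h)) (at t)" by (auto intro!: derivative_eq_intros)
  from has_derivative_compose[OF this] assms show ?thesis
    unfolding lderiv_def has_vector_derivative_def by blast
qed

text \<open>Near \<open>t\<close> the curve is \<open>\<gamma> t\<close> times a curve in
  \<open>U\<close>, to which the chain rule for left translation applies. Continuity keeps the
  translated curve in \<open>U\<close>, where \<open>\<psi>\<close> inverts \<open>\<phi>\<close>;
  the derivative of its coordinates alone does not ensure this.\<close>

lemma lderiv_chart:
  assumes lder: "lderiv \<gamma> t u" and cont: "isCont \<gamma> t"
  shows "((snd (chart_at A (\<gamma> t)) \<circ> \<gamma>) has_vector_derivative dL (\<gamma> t) u) (at t)"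
proof -
  define y where "y = (\<lambda>s. \<phi> (mul (ginv (\<gamma> t)) (\<gamma> s)))"
  have y: "(y has_derivative (\<lambda>h. h *\<^sub>R u)) (at t)"
    using lder by (simp add: lderiv_def y_def has_vector_derivative_def)
  have yt: "y t = z" by (simp add: y_def)
  let ?f = "snd (chart_at A (\<gamma> t)) \<circ> mul (\<gamma> t) \<circ> \<psi>"
  have "(?f has_derivative dL (\<gamma> t)) (at (y t))"
    using dL_chart_deriv[of "\<gamma> t"] by (simp add: chart_deriv_def yt)
  from has_derivative_compose[OF y this]
  have 1: "((\<lambda>s. ?f (y s)) has_derivative (\<lambda>h. dL (\<gamma> t) (h *\<^sub>R u))) (at t)" .
  have "isCont (\<lambda>p. mul (ginv (\<gamma> t)) p) (\<gamma> t)"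
  proof -
    have "continuous_on UNIV (\<lambda>p. mul (ginv (\<gamma> t)) p)" by (intro continuous_intros)
    then show ?thesis by (simp add: continuous_on_eq_continuous_at)
  qed
  then have "isCont (\<lambda>s. mul (ginv (\<gamma> t)) (\<gamma> s)) t"
    by (rule isCont_o2[OF cont])
  then have ev: "\<forall>\<^sub>F s in at t. mul (ginv (\<gamma> t)) (\<gamma> s) \<in> U"
    unfolding isCont_def using topological_tendstoD[of _ _ "at t" U] open_chart[OF c0(1)] c0(2) by simp
  have eq: "?f (y s) = snd (chart_at A (\<gamma> t)) (\<gamma> s)" if "mul (ginv (\<gamma> t)) (\<gamma> s) \<in> U" for s
    using chart_inv_chart[OF c0(1) that] by (simp add: y_def assoc[symmetric])
  have "((snd (chart_at A (\<gamma> t)) \<circ> \<gamma>) has_derivative (\<lambda>h. dL (\<gamma> t) (h *\<^sub>R u))) (at t)"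
  proof (rule has_derivative_transform_eventually[OF 1])
    show "\<forall>\<^sub>F s in at t. ?f (y s) = (snd (chart_at A (\<gamma> t)) \<circ> \<gamma>) s"
      by (rule eventually_mono[OF ev]) (use eq in simp)
    show "?f (y t) = (snd (chart_at A (\<gamma> t)) \<circ> \<gamma>) t" using eq[of t] c0(2) by simp
  qed simp
  then show ?thesis
    unfolding has_vector_derivative_def using linear_cmul[OF linear_dL] by simp
qed

text \<open>Multiplicativity of \<open>Ad\<close> moves the computation from
  \<open>\<gamma> t\<close> to \<open>unit\<close>. This is the infinitesimal conservation law: the
  transported covector is stationary on the current control.\<close>

lemma Ad_lderiv:
  assumes lder: "lderiv \<gamma> t u" and cont: "isCont \<gamma> t"
  shows "((\<lambda>s. Ad (\<gamma> s) u) has_vector_derivative 0) (at t)"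
proof -
  define y where "y = (\<lambda>s. \<phi> (mul (ginv (\<gamma> t)) (\<gamma> s)))"
  have y: "(y has_vector_derivative u) (at t)" using lder by (simp add: lderiv_def y_def)
  have yt: "y t = z" by (simp add: y_def)
  have bl: "bounded_linear (Ad (\<gamma> t))" using linear_Ad linear_conv_bounded_linear by blast
  have "((\<lambda>s. Ad (\<gamma> t) (Ad (\<psi> (y s)) u)) has_vector_derivative Ad (\<gamma> t) 0) (at t)"
    by (rule bounded_linear.has_vector_derivative[OF bl Ad_along_curve[OF y yt]])
  then have 1: "((\<lambda>s. Ad (\<gamma> t) (Ad (\<psi> (y s)) u)) has_vector_derivative 0) (at t)"
    by (simp add: linear_0[OF linear_Ad])
  have "continuous_on UNIV (\<lambda>p. mul (ginv (\<gamma> t)) p)" by (intro continuous_intros)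
  then have "isCont (\<lambda>p. mul (ginv (\<gamma> t)) p) (\<gamma> t)" by (simp add: continuous_on_eq_continuous_at)
  then have "isCont (\<lambda>s. mul (ginv (\<gamma> t)) (\<gamma> s)) t"
    by (rule isCont_o2[OF cont])
  then have ev: "\<forall>\<^sub>F s in at t. mul (ginv (\<gamma> t)) (\<gamma> s) \<in> U"
    unfolding isCont_def using topological_tendstoD[of _ _ "at t" U] open_chart[OF c0(1)] c0(2) by simp
  have eq: "Ad (\<gamma> t) (Ad (\<psi> (y s)) u) = Ad (\<gamma> s) u" if "mul (ginv (\<gamma> t)) (\<gamma> s) \<in> U" for s
    using chart_inv_chart[OF c0(1) that] by (simp add: y_def Ad_mul[symmetric] assoc[symmetric])
  show ?thesis
    using 1 unfolding has_vector_derivative_def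
  proof (rule has_derivative_transform_eventually)
    show "\<forall>\<^sub>F s in at t. Ad (\<gamma> t) (Ad (\<psi> (y s)) u) = Ad (\<gamma> s) u"
      by (rule eventually_mono[OF ev]) (rule eq)
    show "Ad (\<gamma> t) (Ad (\<psi> (y t)) u) = Ad (\<gamma> t) u" using eq[of t] c0(2) by simp
  qed simp
qed

section \<open>Extremals, their restriction and concatenation\<close>

definition maximizers :: "'e set \<Rightarrow> ('e \<Rightarrow> real) \<Rightarrow> 'g \<Rightarrow> 'e set" where
  "maximizers K \<xi> h = {u \<in> K. \<forall>w\<in>K. \<xi> (Ad h w) \<le> \<xi> (Ad h u)}"

text \<open>The maximized Hamiltonian of Pontryagin's principle, that is, the support function of
  \<open>K\<close> at the covector \<open>\<xi> \<circ> Ad h\<close>.\<close>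

definition hamiltonian :: "'e set \<Rightarrow> ('e \<Rightarrow> real) \<Rightarrow> 'g \<Rightarrow> real" where
  "hamiltonian K \<xi> h = (SUP u\<in>K. \<xi> (Ad h u))"

text \<open>Conservation of \<open>hamiltonian\<close> is part of the notion, so it has to be proved
  on short intervals only and passes to concatenations. \<open>lderiv\<close> is two-sided, hence
  demanded at interior times.\<close>

definition extremal :: "'e set \<Rightarrow> ('e \<Rightarrow> real) \<Rightarrow> real \<Rightarrow> (real \<Rightarrow> 'g) \<Rightarrow> bool" where
  "extremal K \<xi> T \<gamma> \<longleftrightarrow> continuous_on {0..T} \<gamma> \<and>
     (\<forall>t\<in>{0..T}. \<exists>c\<in>A. chart_lipschitz_at c {0..T} \<gamma> t) \<and>
     (\<exists>Z. negligible Z \<and> (\<forall>t\<in>{0<..<T} - Z. \<exists>u\<in>maximizers K \<xi> (\<gamma> t). lderiv \<gamma> t u)) \<and>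
     (\<forall>t\<in>{0..T}. hamiltonian K \<xi> (\<gamma> t) = hamiltonian K \<xi> (\<gamma> 0))"

lemma
  assumes "extremal K \<xi> T \<gamma>"
  shows extremal_continuous: "continuous_on {0..T} \<gamma>"
    and extremal_lipschitz: "t \<in> {0..T} \<Longrightarrow> \<exists>c\<in>A. chart_lipschitz_at c {0..T} \<gamma> t"
    and extremal_lderiv:
      "\<exists>Z. negligible Z \<and> (\<forall>t\<in>{0<..<T} - Z. \<exists>u\<in>maximizers K \<xi> (\<gamma> t). lderiv \<gamma> t u)"
    and extremal_hamiltonian: "t \<in> {0..T} \<Longrightarrow> hamiltonian K \<xi> (\<gamma> t) = hamiltonian K \<xi> (\<gamma> 0)"
  using assms unfolding extremal_def by blast+

lemma extremal_restrict:
  assumes ex: "extremal K \<xi> T \<gamma>" and T': "0 < T'" "T' \<le> T"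
  shows "extremal K \<xi> T' \<gamma>"
  unfolding extremal_def
proof (intro conjI ballI)
  show "continuous_on {0..T'} \<gamma>"
    using extremal_continuous[OF ex] T' by (auto intro: continuous_on_subset)
  show "\<exists>c\<in>A. chart_lipschitz_at c {0..T'} \<gamma> t" if "t \<in> {0..T'}" for t
  proof -
    have "t \<in> {0..T}" using that T' by simp
    then obtain c where c: "c \<in> A" "chart_lipschitz_at c {0..T} \<gamma> t" using extremal_lipschitz[OF ex] by blast
    have "chart_lipschitz_at c {0..T'} \<gamma> t"
      by (rule chart_lipschitz_at_cong[OF c(2) zero_less_one]) (use T' in auto)
    then show ?thesis using c(1) by blast
  qed
  obtain Z where "negligible Z" "\<forall>t\<in>{0<..<T} - Z. \<exists>u\<in>maximizers K \<xi> (\<gamma> t). lderiv \<gamma> t u"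
    using extremal_lderiv[OF ex] by blast
  then show "\<exists>Z. negligible Z \<and> (\<forall>t\<in>{0<..<T'} - Z. \<exists>u\<in>maximizers K \<xi> (\<gamma> t). lderiv \<gamma> t u)"
    using T' by (intro exI[of _ Z]) auto
  show "hamiltonian K \<xi> (\<gamma> t) = hamiltonian K \<xi> (\<gamma> 0)" if "t \<in> {0..T'}" for t
  proof -
    have "t \<in> {0..T}" using that T' by simp
    then show ?thesis by (rule extremal_hamiltonian[OF ex])
  qed
qed

text \<open>The joining time is added to the exceptional null set, since the pieces may meet with
  different velocities.\<close>

lemma extremal_concat:
  assumes e1: "extremal K \<xi> a \<gamma>1" and e2: "extremal K \<xi> b \<gamma>2" and ab: "0 < a" "0 < b"
    and join: "\<gamma>2 0 = \<gamma>1 a"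
  shows "extremal K \<xi> (a + b) (\<lambda>t. if t \<le> a then \<gamma>1 t else \<gamma>2 (t - a))"
    (is "extremal K \<xi> _ ?\<gamma>")
  unfolding extremal_def
proof (intro conjI ballI)
  have \<gamma>2: "?\<gamma> t = \<gamma>2 (t - a)" if "a \<le> t" for t
    using that join by (cases "t = a") auto
  have c2: "continuous_on {a..a + b} (\<lambda>t. \<gamma>2 (t - a))"
  proof (rule continuous_on_compose2[of "{0..b}" \<gamma>2 "{a..a + b}" "\<lambda>t. t - a"])
    show "continuous_on {0..b} \<gamma>2" by (rule extremal_continuous[OF e2])
    show "continuous_on {a..a + b} (\<lambda>t. t - a)" by (intro continuous_on_diff continuous_on_id continuous_on_const)
    show "(\<lambda>t. t - a) ` {a..a + b} \<subseteq> {0..b}" by auto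
  qed
  have c1: "continuous_on {0..a} \<gamma>1" by (rule extremal_continuous[OF e1])
  have "continuous_on ({0..a} \<union> {a..a + b}) ?\<gamma>"
  proof (rule continuous_on_closed_Un)
    show "continuous_on {0..a} ?\<gamma>" using c1 by (rule continuous_on_eq) simp
    show "continuous_on {a..a + b} ?\<gamma>" by (rule continuous_on_eq[OF c2]) (rule \<gamma>2[symmetric], simp)
  qed auto
  moreover have "{0..a} \<union> {a..a + b} = {0..a + b}" using ab by auto
  ultimately show "continuous_on {0..a + b} ?\<gamma>" by simp
  have lip1: "\<exists>c\<in>A. chart_lipschitz_at c {0..a} ?\<gamma> t" if "t \<in> {0..a}" for t
  proof -
    obtain c where c: "c \<in> A" "chart_lipschitz_at c {0..a} \<gamma>1 t" using extremal_lipschitz[OF e1 \<open>t \<in> {0..a}\<close>] by blast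
    have "chart_lipschitz_at c {0..a} ?\<gamma> t"
      by (rule chart_lipschitz_at_cong[OF c(2) zero_less_one]) auto
    then show ?thesis using c(1) by blast
  qed
  have lip2: "\<exists>c\<in>A. chart_lipschitz_at c {a..a + b} ?\<gamma> t" if "t \<in> {a..a + b}" for t
  proof -
    have "t - a \<in> {0..b}" using that by auto
    then obtain c \<delta> L where c: "c \<in> A" "0 < \<delta>" "\<gamma>2 ` ({0..b} \<inter> ball (t - a) \<delta>) \<subseteq> fst c"
      "L-lipschitz_on ({0..b} \<inter> ball (t - a) \<delta>) (\<lambda>s. snd c (\<gamma>2 s))"
      using extremal_lipschitz[OF e2] unfolding chart_lipschitz_at_def by blast
    have sub: "s - a \<in> {0..b} \<inter> ball (t - a) \<delta>" "?\<gamma> s = \<gamma>2 (s - a)" if "s \<in> {a..a + b} \<inter> ball t \<delta>" for s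
      using that \<gamma>2[of s] by (auto simp: dist_real_def)
    have "L-lipschitz_on ({a..a + b} \<inter> ball t \<delta>) (\<lambda>s. snd c (?\<gamma> s))"
    proof (rule lipschitz_onI)
      fix s s' assume s: "s \<in> {a..a + b} \<inter> ball t \<delta>" "s' \<in> {a..a + b} \<inter> ball t \<delta>"
      have "dist (snd c (\<gamma>2 (s - a))) (snd c (\<gamma>2 (s' - a))) \<le> L * dist (s - a) (s' - a)"
        by (rule lipschitz_onD[OF c(4) sub(1)[OF s(1)] sub(1)[OF s(2)]])
      then show "dist (snd c (?\<gamma> s)) (snd c (?\<gamma> s')) \<le> L * dist s s'"
        unfolding sub(2)[OF s(1)] sub(2)[OF s(2)] by (simp add: dist_real_def)
    qed (rule lipschitz_on_nonneg[OF c(4)])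
    moreover have "?\<gamma> s \<in> fst c" if "s \<in> {a..a + b} \<inter> ball t \<delta>" for s
      using sub[OF that] c(3) by auto
    ultimately show ?thesis
      unfolding chart_lipschitz_at_def using c(1,2) by (intro bexI[of _ c] exI[of _ \<delta>]) blast+
  qed
  show "\<exists>c\<in>A. chart_lipschitz_at c {0..a + b} ?\<gamma> t" if t: "t \<in> {0..a + b}" for t
  proof -
    consider "t < a" | "t = a" | "a < t" by linarith
    then show ?thesis
    proof cases
      case 1
      then obtain c where c: "c \<in> A" "chart_lipschitz_at c {0..a} ?\<gamma> t" using lip1[of t] t by auto
      have "chart_lipschitz_at c {0..a + b} ?\<gamma> t"
        by (rule chart_lipschitz_at_cong[OF c(2), of "a - t"]) (use 1 in \<open>auto simp: dist_real_def\<close>)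
      then show ?thesis using c(1) by blast
    next
      case 3
      then obtain c where c: "c \<in> A" "chart_lipschitz_at c {a..a + b} ?\<gamma> t" using lip2[of t] t by auto
      have "chart_lipschitz_at c {0..a + b} ?\<gamma> t"
        by (rule chart_lipschitz_at_cong[OF c(2), of "t - a"]) (use 3 in \<open>auto simp: dist_real_def\<close>)
      then show ?thesis using c(1) by blast
    next
      case 2
      obtain c where c: "c \<in> A" "chart_lipschitz_at c {0..a} ?\<gamma> a" using lip1[of a] ab by auto
      obtain d where d: "d \<in> A" "chart_lipschitz_at d {a..a + b} ?\<gamma> a" using lip2[of a] ab by auto
      \<comment> \<open>The two pieces may be Lipschitz at \<open>a\<close> in different charts; the
        second is transferred to the chart \<open>c\<close> of the first.\<close>
      have "?\<gamma> a \<in> fst c" using c(2) ab unfolding chart_lipschitz_at_def by fastforce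
      then have "chart_lipschitz_at c {a..a + b} ?\<gamma> a"
        using ab by (intro chart_lipschitz_at_change[OF d(1) c(1) d(2)]) auto
      then have "chart_lipschitz_at c {0..a + b} ?\<gamma> a"
        using ab by (intro chart_lipschitz_at_join[OF c(2)]) auto
      then show ?thesis using c(1) 2 by blast
    qed
  qed
  obtain Z1 where Z1: "negligible Z1" "\<And>t. t \<in> {0<..<a} - Z1 \<Longrightarrow> \<exists>u\<in>maximizers K \<xi> (\<gamma>1 t). lderiv \<gamma>1 t u"
    using extremal_lderiv[OF e1] by blast
  obtain Z2 where Z2: "negligible Z2" "\<And>t. t \<in> {0<..<b} - Z2 \<Longrightarrow> \<exists>u\<in>maximizers K \<xi> (\<gamma>2 t). lderiv \<gamma>2 t u"
    using extremal_lderiv[OF e2] by blast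
  show "\<exists>Z. negligible Z \<and> (\<forall>t\<in>{0<..<a + b} - Z. \<exists>u\<in>maximizers K \<xi> (?\<gamma> t). lderiv ?\<gamma> t u)"
  proof (intro exI[of _ "Z1 \<union> ((+) a ` Z2 \<union> {a})"] conjI ballI)
    show "negligible (Z1 \<union> ((+) a ` Z2 \<union> {a}))"
      using Z1 Z2 by (auto intro!: negligible_Un negligible_translation)
    fix t assume t: "t \<in> {0<..<a + b} - (Z1 \<union> ((+) a ` Z2 \<union> {a}))"
    show "\<exists>u\<in>maximizers K \<xi> (?\<gamma> t). lderiv ?\<gamma> t u"
    proof (cases "t < a")
      case True
      then obtain u where u: "u \<in> maximizers K \<xi> (\<gamma>1 t)" "lderiv \<gamma>1 t u" using Z1(2)[of t] t by auto
      have "lderiv ?\<gamma> t u"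
        by (rule lderiv_cong[OF u(2), of "{..<a}"]) (use True in auto)
      then show ?thesis using u(1) True by auto
    next
      case False
      then have at: "a < t" using t by auto
      have "t - a \<notin> Z2"
      proof
        assume "t - a \<in> Z2"
        then have "a + (t - a) \<in> (+) a ` Z2" by (rule imageI)
        then show False using t by simp
      qed
      then have "t - a \<in> {0<..<b} - Z2" using at t by simp
      then obtain u where u: "u \<in> maximizers K \<xi> (\<gamma>2 (t - a))" "lderiv \<gamma>2 (t - a) u" using Z2(2) by blast
      have "lderiv ?\<gamma> t u"
        by (rule lderiv_cong[OF lderiv_shift[OF u(2)], of "{a<..}"]) (use at in auto)
      then show ?thesis using u(1) at by auto
    qed
  qed
  show "hamiltonian K \<xi> (?\<gamma> t) = hamiltonian K \<xi> (?\<gamma> 0)" if "t \<in> {0..a + b}" for t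
  proof (cases "t \<le> a")
    case True
    then have "t \<in> {0..a}" using that by simp
    then have "hamiltonian K \<xi> (\<gamma>1 t) = hamiltonian K \<xi> (\<gamma>1 0)"
      by (rule extremal_hamiltonian[OF e1])
    then show ?thesis using True ab by simp
  next
    case False
    then have "t - a \<in> {0..b}" "a \<in> {0..a}" using that ab by auto
    from extremal_hamiltonian[OF e2 this(1)] extremal_hamiltonian[OF e1 this(2)]
    show ?thesis using False join ab by simp
  qed
qed

section \<open>Existence of extremals\<close>


text \<open>Base point and vector converge simultaneously. It serves for \<open>Ad\<close> in
  coordinates and for \<open>lframe\<close>, applied to controls selected at moving points.\<close>

lemma tendsto_family_apply:
  fixes T :: "'e \<Rightarrow> 'e \<Rightarrow> 'e"
  assumes lip: "\<And>x y v. x \<in> S \<Longrightarrow> y \<in> S \<Longrightarrow> norm (T x v - T y v) \<le> L * norm (x - y) * norm v"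
    and lin: "linear (T y)" and y: "y \<in> S"
    and X: "\<forall>\<^sub>F n in sequentially. X n \<in> S" "X \<longlonglongrightarrow> y" and V: "V \<longlonglongrightarrow> v"
  shows "(\<lambda>n. T (X n) (V n)) \<longlonglongrightarrow> T y v"
proof -
  have bl: "bounded_linear (T y)" using lin by (simp add: linear_conv_bounded_linear)
  have 1: "(\<lambda>n. T y (V n)) \<longlonglongrightarrow> T y v" by (rule bounded_linear.tendsto[OF bl V])
  have "(\<lambda>n. L * norm (X n - y) * norm (V n)) \<longlonglongrightarrow> L * norm (y - y) * norm v"
    by (intro tendsto_intros X V)
  then have 2: "(\<lambda>n. L * norm (X n - y) * norm (V n)) \<longlonglongrightarrow> 0" by simp
  have "(\<lambda>n. T (X n) (V n) - T y (V n)) \<longlonglongrightarrow> 0"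
    by (rule Lim_null_comparison[OF eventually_mono[OF X(1)] 2]) (rule lip[OF _ y])
  from tendsto_add[OF this 1] show ?thesis by simp
qed

text \<open>The maximizers are the face of \<open>K\<close> exposed by the functional. Its
  compactness and convexity permit separation by a hyperplane; that it is nonempty makes the
  supremum a maximum.\<close>

lemma
  assumes K: "compact K" "convex K" "K \<noteq> {}" and \<xi>: "linear \<xi>"
  shows maximizers_nonempty: "maximizers K \<xi> h \<noteq> {}"
    and compact_maximizers: "compact (maximizers K \<xi> h)"
    and convex_maximizers: "convex (maximizers K \<xi> h)"
    and hamiltonian_upper: "w \<in> K \<Longrightarrow> \<xi> (Ad h w) \<le> hamiltonian K \<xi> h"
    and hamiltonian_maximizers: "u \<in> maximizers K \<xi> h \<Longrightarrow> hamiltonian K \<xi> h = \<xi> (Ad h u)"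
proof -
  have lin: "linear (\<lambda>u. \<xi> (Ad h u))" using linear_compose[OF linear_Ad \<xi>, of h] by (simp add: o_def)
  have cont: "continuous_on S (\<lambda>u. \<xi> (Ad h u))" for S
    using lin by (rule linear_continuous_on[OF linear_conv_bounded_linear[THEN iffD1]])
  obtain m where m: "m \<in> K" "\<And>w. w \<in> K \<Longrightarrow> \<xi> (Ad h w) \<le> \<xi> (Ad h m)"
    using continuous_attains_sup[OF K(1,3) cont] by blast
  then have eq: "maximizers K \<xi> h = K \<inter> {u. \<xi> (Ad h m) \<le> \<xi> (Ad h u)}"
    by (auto simp: maximizers_def intro: order_trans)
  show "maximizers K \<xi> h \<noteq> {}" using m by (auto simp: maximizers_def)
  have "closed {u. \<xi> (Ad h m) \<le> \<xi> (Ad h u)}"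
    by (intro closed_Collect_le continuous_on_const cont)
  then show "compact (maximizers K \<xi> h)"
    unfolding eq using K(1) by (rule compact_Int_closed[rotated])
  have "convex {u. \<xi> (Ad h m) \<le> \<xi> (Ad h u)}"
  proof (rule convexI)
    fix u v :: 'e and a b :: real
    assume uv: "u \<in> {u. \<xi> (Ad h m) \<le> \<xi> (Ad h u)}" "v \<in> {u. \<xi> (Ad h m) \<le> \<xi> (Ad h u)}" and ab: "0 \<le> a" "0 \<le> b" "a + b = 1"
    have "\<xi> (Ad h m) = a * \<xi> (Ad h m) + b * \<xi> (Ad h m)" using ab by (simp add: distrib_right[symmetric])
    also have "\<dots> \<le> a * \<xi> (Ad h u) + b * \<xi> (Ad h v)" using uv ab by (intro add_mono mult_left_mono) auto
    also have "\<dots> = \<xi> (Ad h (a *\<^sub>R u + b *\<^sub>R v))" by (simp only: linear_add[OF lin] linear_cmul[OF lin] real_scaleR_def)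
    finally show "a *\<^sub>R u + b *\<^sub>R v \<in> {u. \<xi> (Ad h m) \<le> \<xi> (Ad h u)}" by simp
  qed
  then show "convex (maximizers K \<xi> h)" unfolding eq using K(2) by (rule convex_Int[rotated])
  have bdd: "bdd_above ((\<lambda>u. \<xi> (Ad h u)) ` K)" by (rule bdd_aboveI2) (rule m(2))
  show "\<xi> (Ad h w) \<le> hamiltonian K \<xi> h" if "w \<in> K"
    unfolding hamiltonian_def by (rule cSUP_upper[OF that bdd])
  show "hamiltonian K \<xi> h = \<xi> (Ad h u)" if "u \<in> maximizers K \<xi> h"
    unfolding hamiltonian_def using that by (intro cSup_eq_maximum) (auto simp: maximizers_def)
qed

text \<open>The time \<open>\<tau>\<close> is fixed before \<open>g\<close>: the curve is sought as
  \<open>g\<close> times a curve in the chart at \<open>unit\<close>, and there \<open>g\<close>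
  influences only which elements of \<open>K\<close> are maximizers, not the speed bound
  \<open>M\<close>.\<close>

lemma local_extremal_exists:
  assumes K: "compact K" "convex K" "K \<noteq> {}" and \<xi>: "linear \<xi>"
  obtains \<tau> where "0 < \<tau>" "\<And>g. \<exists>\<gamma>. \<gamma> 0 = g \<and> extremal K \<xi> \<tau> \<gamma>"
proof -
  obtain r L where r: "0 < r" "ball z r \<subseteq> \<phi> ` U" "0 \<le> L"
    and AdL: "\<And>x y v. x \<in> ball z r \<Longrightarrow> y \<in> ball z r \<Longrightarrow> norm (Ad (\<psi> x) v - Ad (\<psi> y) v) \<le> L * norm (x - y) * norm v"
    and PL: "\<And>x y v. x \<in> ball z r \<Longrightarrow> y \<in> ball z r \<Longrightarrow> norm (lframe x v - lframe y v) \<le> L * norm (x - y) * norm v"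
    using Ad_near_unit by metis
  obtain k where k: "0 < k" "\<And>u. u \<in> K \<Longrightarrow> norm u \<le> k"
    using compact_imp_bounded[OF K(1)] bounded_pos by metis
  \<comment> \<open>The existence theorem asks for a bounded field on the whole space; retraction
    onto this ball extends the field.\<close>
  define B where "B = cball z (r / 2)"
  have B: "B \<subseteq> ball z r" "z \<in> B" "closed B" "convex B" "B \<noteq> {}" using r by (auto simp: B_def)
  \<comment> \<open>Within \<open>ball z r\<close> the frame differs from the identity by at most
    \<open>L * r\<close>, and controls have norm at most \<open>k\<close>.\<close>
  define M where "M = (L * r + 1) * k"
  have M: "0 < M" using r k by (simp add: M_def add_nonneg_pos)
  have PM: "norm (lframe x u) \<le> M" if "x \<in> ball z r" "u \<in> K" for x u
  proof -
    have "norm (lframe x u - u) \<le> L * norm (x - z) * norm u"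
      using PL[OF that(1), of z u] r lframe_unit by simp
    also have "\<dots> \<le> L * r * norm u"
      using that r by (intro mult_right_mono mult_left_mono) (auto simp: dist_norm norm_minus_commute)
    finally have "norm (lframe x u) \<le> (L * r + 1) * norm u"
      using norm_triangle_sub[of "lframe x u" u] by (simp add: distrib_right)
    also have "\<dots> \<le> M" unfolding M_def using k(2)[OF that(2)] r by (intro mult_left_mono) auto
    finally show ?thesis .
  qed
  \<comment> \<open>At speed \<open>M\<close> the curve travels at most \<open>r / 4\<close>, so it
    stays in the open ball of radius \<open>r / 2\<close>, where the retraction is the
    identity.\<close>
  define \<tau> where "\<tau> = r / (4 * M)"
  have \<tau>: "0 < \<tau>" using r M by (simp add: \<tau>_def)
  have "\<exists>\<gamma>. \<gamma> 0 = g \<and> extremal K \<xi> \<tau> \<gamma>" for g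
  proof -
    \<comment> \<open>An arbitrary selection, with no continuity claimed.\<close>
    define f where "f x = (SOME u. u \<in> maximizers K \<xi> (mul g (\<psi> x)))" for x
    have f: "f x \<in> maximizers K \<xi> (mul g (\<psi> x))" for x
      unfolding f_def by (rule someI_ex) (rule ex_in_conv[THEN iffD2, OF maximizers_nonempty[OF K \<xi>]])
    have fK: "f x \<in> K" for x using f by (auto simp: maximizers_def)
    define v where "v x = lframe (closest_point B x) (f (closest_point B x))" for x
    have cpB: "closest_point B x \<in> ball z r" for x
      using closest_point_in_set[OF B(3,5)] B(1) by blast
    have vM: "norm (v x) \<le> M" for x unfolding v_def by (rule PM[OF cpB fK])
    obtain x where x: "x 0 = z" "M-lipschitz_on {0..\<tau>} x"
      and kras: "\<forall>t\<in>{0..\<tau>}. \<forall>w b \<epsilon>. 0 < \<epsilon> \<longrightarrow> (\<forall>y\<in>ball (x t) \<epsilon>. w \<bullet> v y \<le> b) \<longrightarrow>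
        (\<exists>\<delta>>0. \<forall>s\<in>{0..\<tau>}. \<forall>s'\<in>{0..\<tau>}.
          t - \<delta> < s \<longrightarrow> s \<le> s' \<longrightarrow> s' < t + \<delta> \<longrightarrow> w \<bullet> (x s' - x s) \<le> b * (s' - s))"
      using krasovskii_solution_exists[where v = v and M = M and T = \<tau> and ?x0.0 = z, OF vM] by (elim exE conjE, intro that)
    have xB: "x t \<in> ball z (r / 2)" if "t \<in> {0..\<tau>}" for t
    proof -
      have "dist (x 0) (x t) \<le> M * dist 0 t" by (rule lipschitz_onD[OF x(2)]) (use that \<tau> in auto)
      also have "\<dots> \<le> M * \<tau>" using that M by (intro mult_left_mono) auto
      also have "\<dots> < r / 2" using M r by (simp add: \<tau>_def)
      finally show ?thesis using x(1) by simp
    qed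
    have xr: "x t \<in> ball z r" "x t \<in> \<phi> ` U" if "t \<in> {0..\<tau>}" for t
      using xB[OF that] r by auto
    define \<gamma> where "\<gamma> t = mul g (\<psi> (x t))" for t
    have contx: "continuous_on {0..\<tau>} x" using x(2) by (rule lipschitz_on_continuous_on)
    have cont: "continuous_on {0..\<tau>} \<gamma>"
      unfolding \<gamma>_def
      by (intro continuous_mul continuous_on_const continuous_on_compose2[OF chart_inv_cont[OF c0(1)] contx]) (use xr in blast)
    have lip: "\<exists>c\<in>A. chart_lipschitz_at c {0..\<tau>} \<gamma> t" if t: "t \<in> {0..\<tau>}" for t
    proof -
      have "M-lipschitz_on ({0..\<tau>} \<inter> ball t 1) (\<lambda>s. \<phi> (\<psi> (x s)))"
      proof (rule lipschitz_onI)
        fix s s' assume s: "s \<in> {0..\<tau>} \<inter> ball t 1" "s' \<in> {0..\<tau>} \<inter> ball t 1"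
        then have "dist (x s) (x s') \<le> M * dist s s'" by (intro lipschitz_onD[OF x(2)]) auto
        moreover have "\<phi> (\<psi> (x s)) = x s" "\<phi> (\<psi> (x s')) = x s'"
          using s by (auto intro!: chart_chart_inv[OF c0(1)] xr(2))
        ultimately show "dist (\<phi> (\<psi> (x s))) (\<phi> (\<psi> (x s'))) \<le> M * dist s s'" by simp
      qed (use M in simp)
      moreover have "(\<lambda>s. \<psi> (x s)) ` ({0..\<tau>} \<inter> ball t 1) \<subseteq> U"
        using chart_inv_in[OF c0(1) xr(2)] by auto
      ultimately have "chart_lipschitz_at c0 {0..\<tau>} (\<lambda>s. \<psi> (x s)) t"
        unfolding chart_lipschitz_at_def by (intro exI[of _ 1] exI[of _ M] conjI) auto
      then have "chart_lipschitz_at (chart_at A (\<gamma> t)) {0..\<tau>} \<gamma> t"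
        unfolding \<gamma>_def by (intro chart_lipschitz_at_translate[OF c0(1) chart_at_chart(1) _ t] chart_at_chart(2))
      then show ?thesis using chart_at_chart(1) by blast
    qed
    \<comment> \<open>Freezing \<open>x\<close> outside \<open>{0..\<tau>}\<close> gives a Lipschitz
      function on the line, as the theorem on differentiability almost everywhere requires.\<close>
    define clamp where "clamp t = max 0 (min \<tau> t)" for t :: real
    have clamp: "clamp t \<in> {0..\<tau>}" "\<bar>clamp t - clamp s\<bar> \<le> \<bar>t - s\<bar>" for s t
      using \<tau> by (auto simp: clamp_def)
    have clamp_id: "clamp t = t" if "t \<in> {0..\<tau>}" for t using that by (auto simp: clamp_def)
    define X where "X t = x (clamp t)" for t
    have Xlip: "M-lipschitz_on UNIV X"
    proof (rule lipschitz_onI)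
      fix s t :: real
      have "dist (X s) (X t) \<le> M * dist (clamp s) (clamp t)"
        unfolding X_def by (rule lipschitz_onD[OF x(2) clamp(1) clamp(1)])
      also have "\<dots> \<le> M * dist s t" using clamp(2) M by (intro mult_left_mono) (auto simp: dist_real_def)
      finally show "dist (X s) (X t) \<le> M * dist s t" .
    qed (use M in simp)
    define N where "N = {t. \<not> X differentiable (at t)}"
    have N: "negligible N" unfolding N_def by (rule lipschitz_differentiable_ae[OF Xlip])
    have der: "\<exists>u\<in>maximizers K \<xi> (\<gamma> t). lderiv \<gamma> t u" if t: "t \<in> {0<..<\<tau>} - N" for t
    proof -
      have t': "t \<in> {0..\<tau>}" using t by auto
      define y where "y = x t"
      note yr = xr[OF t', folded y_def]
      obtain w where w: "(X has_vector_derivative w) (at t)"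
        using t unfolding N_def vector_derivative_works by blast
      have xw: "(x has_vector_derivative w) (at t)"
        by (rule has_vector_derivative_transform_within_open[OF w, of "{0<..<\<tau>}"])
           (use t in \<open>auto simp: X_def clamp_id\<close>)
      let ?F = "maximizers K \<xi> (\<gamma> t)"
      \<comment> \<open>If the velocity came from no maximizer at \<open>y\<close>, a hyperplane
        would strictly separate it from the compact convex set of admissible velocities, while the
        field near \<open>y\<close> stays on the side of that set.\<close>
      have "w \<in> lframe y ` ?F"
      proof (rule ccontr)
        assume nw: "w \<notin> lframe y ` ?F"
        have "bounded_linear (lframe y)" using linear_lframe[OF yr(2)] by (simp add: linear_conv_bounded_linear)
        then have "compact (lframe y ` ?F)"
          by (intro compact_continuous_image linear_continuous_on compact_maximizers[OF K \<xi>])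
        moreover have "convex (lframe y ` ?F)"
          by (intro convex_linear_image linear_lframe yr(2) convex_maximizers[OF K \<xi>])
        ultimately obtain a b where ab: "a \<bullet> w < b" "\<And>s. s \<in> lframe y ` ?F \<Longrightarrow> b < a \<bullet> s"
          using separating_hyperplane_closed_point[of "lframe y ` ?F" w] nw compact_imp_closed by metis
        \<comment> \<open>Upper semicontinuity, by contradiction: controls selected at points
          tending to \<open>y\<close> have a cluster point in the compact set \<open>K\<close>; it
          is a maximizer at \<open>y\<close>, yet its velocity lies on the wrong side.\<close>
        have "\<exists>\<epsilon>>0. \<forall>q\<in>ball y \<epsilon>. (- a) \<bullet> v q \<le> - b"
        proof (rule ccontr)
          assume neg: "\<not> (\<exists>\<epsilon>>0. \<forall>q\<in>ball y \<epsilon>. (- a) \<bullet> v q \<le> - b)"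
          have "\<exists>q. q \<in> ball y (1 / Suc n) \<and> a \<bullet> v q < b" for n
          proof -
            have "\<not> (\<forall>q\<in>ball y (1 / Suc n). (- a) \<bullet> v q \<le> - b)"
              using neg by (metis of_nat_0_less_iff zero_less_Suc zero_less_divide_1_iff)
            then show ?thesis by (auto simp: not_le)
          qed
          then obtain q where q: "\<And>n. q n \<in> ball y (1 / Suc n)" "\<And>n. a \<bullet> v (q n) < b" by metis
          have qy: "q \<longlonglongrightarrow> y"
          proof (rule metric_LIMSEQ_I)
            fix e :: real assume "0 < e"
            then obtain n0 where n0: "1 / Suc n0 < e" using nat_approx_posE by metis
            have "dist (q n) y < e" if "n \<ge> n0" for n
            proof -
              have "dist (q n) y < 1 / Suc n" using q(1)[of n] by (simp add: dist_commute)
              also have "\<dots> \<le> 1 / Suc n0" using that by (simp add: frac_le)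
              finally show ?thesis using n0 by simp
            qed
            then show "\<exists>no. \<forall>n\<ge>no. dist (q n) y < e" by blast
          qed
          obtain u j where u: "u \<in> K" "strict_mono (j :: nat \<Rightarrow> nat)" "(\<lambda>n. f (q (j n))) \<longlonglongrightarrow> u"
            using K(1)[unfolded compact_def, rule_format, of "\<lambda>n. f (q n)"] fK by (auto simp: o_def)
          have qj: "(\<lambda>n. q (j n)) \<longlonglongrightarrow> y" using LIMSEQ_subseq_LIMSEQ[OF qy u(2)] by (simp add: o_def)
          have evB: "\<forall>\<^sub>F n in sequentially. q (j n) \<in> ball z (r / 2)"
            by (rule topological_tendstoD[OF qj open_ball]) (use xB[OF t'] in \<open>simp add: y_def\<close>)
          have evr: "\<forall>\<^sub>F n in sequentially. q (j n) \<in> ball z r"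
            by (rule eventually_mono[OF evB]) (use r in auto)
          have "u \<in> ?F"
            unfolding maximizers_def
          proof (intro CollectI conjI ballI)
            show "u \<in> K" by (rule u(1))
            fix w' assume w': "w' \<in> K"
            have bl: "bounded_linear (\<lambda>v. \<xi> (Ad g v))"
              using linear_compose[OF linear_Ad \<xi>, of g] by (simp add: o_def linear_conv_bounded_linear)
            have l1: "(\<lambda>n. \<xi> (Ad g (Ad (\<psi> (q (j n))) w'))) \<longlonglongrightarrow> \<xi> (Ad g (Ad (\<psi> y) w'))"
              by (intro bounded_linear.tendsto[OF bl] tendsto_family_apply[where T = "\<lambda>x. Ad (\<psi> x)", OF AdL linear_Ad yr(1) evr qj] tendsto_const)
            have l2: "(\<lambda>n. \<xi> (Ad g (Ad (\<psi> (q (j n))) (f (q (j n)))))) \<longlonglongrightarrow> \<xi> (Ad g (Ad (\<psi> y) u))"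
              by (intro bounded_linear.tendsto[OF bl] tendsto_family_apply[where T = "\<lambda>x. Ad (\<psi> x)", OF AdL linear_Ad yr(1) evr qj] u(3))
            have "\<xi> (Ad g (Ad (\<psi> y) w')) \<le> \<xi> (Ad g (Ad (\<psi> y) u))"
              by (rule LIMSEQ_le[OF l1 l2]) (use f w' in \<open>auto simp: maximizers_def Ad_mul\<close>)
            then show "\<xi> (Ad (\<gamma> t) w') \<le> \<xi> (Ad (\<gamma> t) u)" by (simp add: \<gamma>_def y_def Ad_mul)
          qed
          then have "b < a \<bullet> lframe y u" using ab(2) by blast
          moreover have "a \<bullet> lframe y u \<le> b"
          proof (rule tendsto_upperbound)
            show "(\<lambda>n. a \<bullet> lframe (q (j n)) (f (q (j n)))) \<longlonglongrightarrow> a \<bullet> lframe y u"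
              by (intro tendsto_inner tendsto_const tendsto_family_apply[where T = lframe, OF PL linear_lframe yr(1) evr qj u(3)]) (use yr in auto)
            show "\<forall>\<^sub>F n in sequentially. a \<bullet> lframe (q (j n)) (f (q (j n))) \<le> b"
            proof (rule eventually_mono[OF evB])
              fix n assume "q (j n) \<in> ball z (r / 2)"
              then have "closest_point B (q (j n)) = q (j n)" by (intro closest_point_self) (auto simp: B_def)
              then show "a \<bullet> lframe (q (j n)) (f (q (j n))) \<le> b" using q(2)[of "j n"] by (simp add: v_def)
            qed
          qed simp
          ultimately show False by simp
        qed
        then obtain \<epsilon> where \<epsilon>: "0 < \<epsilon>" "\<forall>q\<in>ball (x t) \<epsilon>. (- a) \<bullet> v q \<le> - b" unfolding y_def by blast
        \<comment> \<open>With the signs \<open>- a\<close> and \<open>- b\<close>, the half-space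
          estimate bounds the right difference quotients of \<open>a \<bullet> x\<close> below by
          \<open>b\<close>, against \<open>a \<bullet> w < b\<close>.\<close>
        obtain \<delta> where \<delta>: "0 < \<delta>" "\<forall>s\<in>{0..\<tau>}. \<forall>s'\<in>{0..\<tau>}. t - \<delta> < s \<longrightarrow> s \<le> s' \<longrightarrow> s' < t + \<delta> \<longrightarrow> (- a) \<bullet> (x s' - x s) \<le> - b * (s' - s)"
          using kras[rule_format, OF t' \<epsilon>(1) \<epsilon>(2)[rule_format]] by blast
        have "((\<lambda>s. a \<bullet> x s) has_real_derivative a \<bullet> w) (at t)"
          unfolding has_real_derivative_iff_has_vector_derivative
          by (rule bounded_linear.has_vector_derivative[OF bounded_linear_inner_right xw])
        then have "((\<lambda>h. (a \<bullet> x (t + h) - a \<bullet> x t) / h) \<longlongrightarrow> a \<bullet> w) (at_right 0)"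
          unfolding DERIV_def by (rule filterlim_mono[OF _ order_refl at_le]) simp
        moreover have "\<forall>\<^sub>F h in at_right 0. b \<le> (a \<bullet> x (t + h) - a \<bullet> x t) / h"
          unfolding eventually_at_right_field
        proof (intro exI[of _ "min \<delta> (\<tau> - t)"] conjI allI impI)
          show "0 < min \<delta> (\<tau> - t)" using \<delta> t by auto
          fix h :: real assume h: "0 < h" "h < min \<delta> (\<tau> - t)"
          have "(- a) \<bullet> (x (t + h) - x t) \<le> - b * (t + h - t)"
            using \<delta>(2)[rule_format, of t "t + h"] \<delta>(1) h t' by auto
          then have "b * h \<le> a \<bullet> x (t + h) - a \<bullet> x t" by (simp add: inner_diff_right)
          then show "b \<le> (a \<bullet> x (t + h) - a \<bullet> x t) / h" using h by (simp add: pos_le_divide_eq)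
        qed
        ultimately have "b \<le> a \<bullet> w" by (rule tendsto_lowerbound) simp
        then show False using ab(1) by simp
      qed
      then obtain u where u: "u \<in> ?F" "w = lframe y u" by auto
      have 1: "chart_deriv c0 c0 (mul (\<psi> y)) unit (lframe y)" by (rule lframe_chart_deriv[OF yr(2)])
      have \<psi>y: "\<psi> y \<in> U" by (rule chart_inv_in[OF c0(1) yr(2)])
      \<comment> \<open>\<open>D\<close> undoes \<open>lframe y\<close> and so recovers the control
        \<open>u\<close> from the coordinate velocity \<open>w\<close>.\<close>
      obtain D where D: "chart_deriv c0 c0 (mul (ginv (\<psi> y))) (\<psi> y) D"
        using left_translation_chart_deriv[OF chart_at_chart(1) c0(1) c0(1) chart_at_chart(2) \<psi>y, of "ginv (\<psi> y)"] c0(2)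
        by auto
      have "chart_deriv c0 c0 (\<lambda>q. mul (ginv (\<psi> y)) (mul (\<psi> y) q)) unit (\<lambda>v. D (lframe y v))"
        by (rule chart_deriv_compose[OF 1 _ c0(1) c0(1)]) (use D in \<open>auto intro!: continuous_intros\<close>)
      moreover have "(\<lambda>q. mul (ginv (\<psi> y)) (mul (\<psi> y) q)) = (\<lambda>q. q)" by (simp add: assoc[symmetric])
      ultimately have "(\<lambda>v. D (lframe y v)) = (\<lambda>v. v)"
        using chart_deriv_unique[OF _ chart_deriv_id[OF c0]] by metis
      then have Dw: "D w = u" using u(2) by metis
      have "((\<phi> \<circ> mul (ginv (\<psi> y)) \<circ> \<psi>) has_derivative D) (at (x t))"
        using D chart_chart_inv[OF c0(1) yr(2)] by (simp add: chart_deriv_def y_def)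
      from has_derivative_compose[OF xw[unfolded has_vector_derivative_def] this]
      have "((\<lambda>s. \<phi> (mul (ginv (\<psi> y)) (\<psi> (x s)))) has_derivative (\<lambda>h. D (h *\<^sub>R w))) (at t)" by simp
      moreover have "(\<lambda>h. D (h *\<^sub>R w)) = (\<lambda>h. h *\<^sub>R u)"
      proof -
        have "linear D" using D unfolding chart_deriv_def by (intro has_derivative_linear) blast
        then show ?thesis by (simp add: linear_cmul Dw)
      qed
      moreover have "mul (ginv (\<gamma> t)) (\<gamma> s) = mul (ginv (\<psi> y)) (\<psi> (x s))" for s
      proof -
        have "mul (ginv (\<gamma> t)) (\<gamma> s) = mul (ginv (\<psi> y)) (mul (mul (ginv g) g) (\<psi> (x s)))"
          unfolding \<gamma>_def y_def by (simp only: inverse_distrib_swap assoc)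
        then show ?thesis by simp
      qed
      ultimately have "lderiv \<gamma> t u" by (simp add: lderiv_def has_vector_derivative_def)
      then show ?thesis using u(1) by blast
    qed
    have ham: "hamiltonian K \<xi> (\<gamma> t) = hamiltonian K \<xi> (\<gamma> 0)" if t0: "t \<in> {0..\<tau>}" for t
    proof -
      define H where "H s = hamiltonian K \<xi> (\<gamma> (clamp s))" for s
      have bl: "bounded_linear (\<lambda>v. \<xi> (Ad g v))"
        using linear_compose[OF linear_Ad \<xi>, of g] by (simp add: o_def linear_conv_bounded_linear)
      obtain C where C: "0 < C" "\<And>v. \<bar>\<xi> (Ad g v)\<bar> \<le> norm v * C"
        using bounded_linear.pos_bounded[OF bl] by auto
      \<comment> \<open>The maximizer at \<open>s\<close> competes at \<open>s'\<close>, so the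
        difference of the maxima is at most the change of one linear functional of
        \<open>Ad\<close>.\<close>
      have one: "H s - H s' \<le> C * L * M * k * \<bar>s - s'\<bar>" for s s'
      proof -
        obtain u where u: "u \<in> maximizers K \<xi> (\<gamma> (clamp s))" using maximizers_nonempty[OF K \<xi>] by blast
        then have uK: "u \<in> K" by (simp add: maximizers_def)
        have "H s - H s' \<le> \<xi> (Ad (\<gamma> (clamp s)) u) - \<xi> (Ad (\<gamma> (clamp s')) u)"
          unfolding H_def using hamiltonian_maximizers[OF K \<xi> u] hamiltonian_upper[OF K \<xi> uK] by (simp add: diff_left_mono)
        also have "\<dots> = \<xi> (Ad g (Ad (\<psi> (X s)) u - Ad (\<psi> (X s')) u))"
          by (simp add: \<gamma>_def X_def Ad_mul linear_diff[OF linear_Ad] linear_diff[OF \<xi>])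
        also have "\<dots> \<le> norm (Ad (\<psi> (X s)) u - Ad (\<psi> (X s')) u) * C" using C(2) abs_le_D1 by blast
        also have "\<dots> \<le> (L * norm (X s - X s') * norm u) * C"
          using AdL[OF xr(1)[OF clamp(1)] xr(1)[OF clamp(1)]] C by (intro mult_right_mono) (auto simp: X_def)
        also have "\<dots> \<le> (L * (M * \<bar>s - s'\<bar>) * k) * C"
          using lipschitz_onD[OF Xlip, of s s'] k(2)[OF uK] r C M
          by (intro mult_right_mono mult_mono mult_left_mono) (auto simp: dist_norm)
        finally show ?thesis by (simp add: mult_ac)
      qed
      have Hlip: "(C * L * M * k)-lipschitz_on UNIV H"
      proof (rule lipschitz_onI)
        fix s s' :: real
        show "dist (H s) (H s') \<le> C * L * M * k * dist s s'"
          using one[of s s'] one[of s' s] by (simp add: dist_real_def abs_le_iff abs_minus_commute)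
      qed (use C r M k in simp)
      define N' where "N' = {s. \<not> H differentiable (at s)}"
      have N': "negligible N'" unfolding N'_def by (rule lipschitz_real_differentiable_ae[OF Hlip])
      have "H t = H 0"
      proof (rule lipschitz_derivative_zero_ae[OF Hlip _ negligible_Un[OF N N']])
        show "0 \<le> t" using t0 by simp
        fix s assume s: "s \<in> {0<..<t} - (N \<union> N')"
        then have s\<tau>: "s \<in> {0<..<\<tau>} - N" "s \<in> {0..\<tau>}" using t0 by auto
        obtain u where u: "u \<in> maximizers K \<xi> (\<gamma> s)" "lderiv \<gamma> s u" using der[OF s\<tau>(1)] by blast
        have uK: "u \<in> K" using u(1) by (simp add: maximizers_def)
        obtain d where d: "(H has_real_derivative d) (at s)" using s real_differentiable_def[of H s] unfolding N'_def by blast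
        have "isCont \<gamma> s"
          by (rule continuous_on_interior[OF cont]) (use s\<tau> in simp)
        have "bounded_linear \<xi>" using \<xi> by (simp add: linear_conv_bounded_linear)
        from bounded_linear.has_vector_derivative[OF this Ad_lderiv[OF u(2) \<open>isCont \<gamma> s\<close>]]
        have "((\<lambda>s'. \<xi> (Ad (\<gamma> s') u)) has_real_derivative 0) (at s)"
          by (simp add: linear_0[OF \<xi>] has_real_derivative_iff_has_vector_derivative)
        from DERIV_diff[OF d this]
        have d': "((\<lambda>s'. H s' - \<xi> (Ad (\<gamma> s') u)) has_real_derivative d) (at s)" by simp
        \<comment> \<open>With \<open>u\<close> frozen at time \<open>s\<close>, the difference
          \<open>H s' - \<xi> (Ad (\<gamma> s') u)\<close> is nonnegative near \<open>s\<close> and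
          zero at \<open>s' = s\<close>; its derivative there is \<open>d\<close>, because the
          subtracted term is stationary.\<close>
        have "d = 0"
        proof (rule DERIV_local_min[OF d'])
          show "0 < min s (\<tau> - s)" using s\<tau> by auto
          show "\<forall>s'. \<bar>s - s'\<bar> < min s (\<tau> - s) \<longrightarrow> H s - \<xi> (Ad (\<gamma> s) u) \<le> H s' - \<xi> (Ad (\<gamma> s') u)"
          proof (intro allI impI)
            fix s' assume "\<bar>s - s'\<bar> < min s (\<tau> - s)"
            then have s': "s' \<in> {0..\<tau>}" by auto
            have "H s = \<xi> (Ad (\<gamma> s) u)" using hamiltonian_maximizers[OF K \<xi> u(1)] by (simp add: H_def clamp_id[OF s\<tau>(2)])
            moreover have "\<xi> (Ad (\<gamma> s') u) \<le> H s'" using hamiltonian_upper[OF K \<xi> uK] by (simp add: H_def clamp_id[OF s'])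
            ultimately show "H s - \<xi> (Ad (\<gamma> s) u) \<le> H s' - \<xi> (Ad (\<gamma> s') u)" by simp
          qed
        qed
        then show "(H has_real_derivative 0) (at s)" using d by simp
      qed
      then show ?thesis using clamp_id[OF t0] clamp_id[of 0] \<tau> by (simp add: H_def)
    qed
    have "\<gamma> 0 = g" using chart_inv_chart[OF c0] by (simp add: \<gamma>_def x(1))
    moreover have "extremal K \<xi> \<tau> \<gamma>"
      unfolding extremal_def using cont lip N der ham by blast
    ultimately show ?thesis by blast
  qed
  then show ?thesis using \<tau> that by blast
qed

text \<open>Since \<open>\<tau>\<close> is the same at every starting point, restarting at each end
  point reaches time 1 after finitely many steps; the surplus is cut off.\<close>

lemma extremal_exists:
  assumes K: "compact K" "convex K" "K \<noteq> {}" and \<xi>: "linear \<xi>"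
  obtains \<gamma> where "\<gamma> 0 = g" "extremal K \<xi> 1 \<gamma>"
proof -
  obtain \<tau> where \<tau>: "0 < \<tau>" "\<And>g. \<exists>\<gamma>. \<gamma> 0 = g \<and> extremal K \<xi> \<tau> \<gamma>"
    using local_extremal_exists[OF assms] by metis
  have steps: "\<exists>\<gamma>. \<gamma> 0 = g \<and> extremal K \<xi> (Suc n * \<tau>) \<gamma>" for n
  proof (induction n)
    case 0
    then show ?case using \<tau>(2) by simp
  next
    case (Suc n)
    then obtain \<gamma>1 where 1: "\<gamma>1 0 = g" "extremal K \<xi> (Suc n * \<tau>) \<gamma>1" by blast
    obtain \<gamma>2 where 2: "\<gamma>2 0 = \<gamma>1 (Suc n * \<tau>)" "extremal K \<xi> \<tau> \<gamma>2" using \<tau>(2) by blast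
    have pos: "0 < Suc n * \<tau>" using \<tau>(1) by simp
    have eq: "Suc n * \<tau> + \<tau> = Suc (Suc n) * \<tau>" by (simp add: algebra_simps)
    have "extremal K \<xi> (Suc (Suc n) * \<tau>) (\<lambda>t. if t \<le> Suc n * \<tau> then \<gamma>1 t else \<gamma>2 (t - Suc n * \<tau>))"
      using extremal_concat[OF 1(2) 2(2) pos \<tau>(1) 2(1)] unfolding eq .
    then show ?case using pos 1(1)
      by (intro exI[of _ "\<lambda>t. if t \<le> Suc n * \<tau> then \<gamma>1 t else \<gamma>2 (t - Suc n * \<tau>)"]) simp
  qed
  obtain n where "1 / \<tau> < real n" using reals_Archimedean2 by blast
  then have "1 \<le> Suc n * \<tau>" using \<tau>(1) by (simp add: field_simps)
  then show ?thesis using steps[of n] extremal_restrict[of K \<xi> "Suc n * \<tau>" _ 1] that by auto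
qed

end

section \<open>Normal curves\<close>

lemma AE_lebesgue_on_negligible:
  assumes "negligible Z" "S \<in> sets lebesgue" "\<And>t. t \<in> S - Z \<Longrightarrow> R t"
  shows "AE t in lebesgue_on S. R t"
proof -
  have "AE t in lebesgue. t \<notin> Z"
    using assms(1) by (intro AE_not_in) (simp add: negligible_iff_null_sets)
  then have "AE t in lebesgue. t \<in> S \<longrightarrow> R t" by (rule AE_mp) (use assms(3) in auto)
  then show ?thesis using assms(2) by (subst AE_restrict_space_iff) auto
qed

text \<open>Completeness of Lebesgue measure. The auxiliary function equals \<open>h\<close> outside
  \<open>S\<close>, so it differs from \<open>h\<close> at most on \<open>Z\<close>.\<close>

lemma borel_measurable_lebesgue_on_negligible:
  fixes f :: "real \<Rightarrow> 'a::euclidean_space"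
  assumes "negligible Z" "h \<in> borel_measurable lebesgue" "\<And>t. t \<in> S - Z \<Longrightarrow> f t = h t"
  shows "f \<in> borel_measurable (lebesgue_on S)"
proof -
  define f' where "f' t = (if t \<in> S then f t else h t)" for t
  have "AE t in lebesgue. t \<notin> Z"
    using assms(1) by (intro AE_not_in) (simp add: negligible_iff_null_sets)
  then have "AE t in lebesgue. h t = f' t" by (rule AE_mp) (use assms(3) in \<open>auto simp: f'_def\<close>)
  with assms(2) have "f' \<in> borel_measurable lebesgue" by (rule borel_measurable_AE)
  then have "f' \<in> borel_measurable (lebesgue_on S)" by (rule measurable_restrict_space1)
  then show ?thesis
    by (rule measurable_cong[THEN iffD1, rotated]) (auto simp: f'_def)
qed

lemma has_vector_derivative_difference_quotient:
  assumes "(f has_vector_derivative u) (at t)"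
  shows "((\<lambda>h. (f (t + h) - f t) /\<^sub>R h) \<longlongrightarrow> u) (at 0)"
proof -
  have "((\<lambda>h. norm (f (t + h) - f t - h *\<^sub>R u) / norm h) \<longlongrightarrow> 0) (at 0)"
    using assms unfolding has_vector_derivative_def has_derivative_at by blast
  moreover have "\<forall>\<^sub>F h in at 0. norm ((f (t + h) - f t) /\<^sub>R h - u) \<le> norm (f (t + h) - f t - h *\<^sub>R u) / norm h"
  proof (rule eventually_mono)
    show "\<forall>\<^sub>F h::real in at 0. h \<noteq> 0" by (simp add: eventually_at_filter)
    fix h :: real assume "h \<noteq> 0"
    then have "(f (t + h) - f t) /\<^sub>R h - u = (f (t + h) - f t - h *\<^sub>R u) /\<^sub>R h"
      by (simp add: scaleR_diff_right)
    then show "norm ((f (t + h) - f t) /\<^sub>R h - u) \<le> norm (f (t + h) - f t - h *\<^sub>R u) / norm h"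
      by (simp add: divide_inverse_commute)
  qed
  ultimately have "((\<lambda>h. (f (t + h) - f t) /\<^sub>R h - u) \<longlongrightarrow> 0) (at 0)"
    by (rule Lim_null_comparison[rotated])
  then show ?thesis by (simp add: LIM_zero_iff)
qed

text \<open>Compactness turns the local Lipschitz bounds into one constant and one length
  scale.\<close>

lemma locally_lipschitz_abs_continuous_on:
  fixes f :: "real \<Rightarrow> 'a::metric_space"
  assumes loc: "\<And>t. t \<in> {a..b} \<Longrightarrow> \<exists>\<delta>>0. \<exists>L. L-lipschitz_on ({a..b} \<inter> ball t \<delta>) f"
  shows "abs_continuous_on a b f"
proof -
  have "\<forall>t\<in>{a..b}. \<exists>\<delta> L. 0 < \<delta> \<and> L-lipschitz_on ({a..b} \<inter> ball t \<delta>) f" using loc by blast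
  then obtain \<delta> where "\<forall>t\<in>{a..b}. \<exists>L. 0 < \<delta> t \<and> L-lipschitz_on ({a..b} \<inter> ball t (\<delta> t)) f"
    unfolding bchoice_iff by blast
  then obtain L where \<delta>L: "\<And>t. t \<in> {a..b} \<Longrightarrow> 0 < \<delta> t \<and> (L t)-lipschitz_on ({a..b} \<inter> ball t (\<delta> t)) f"
    unfolding bchoice_iff by blast
  \<comment> \<open>Halved radii: an interval shorter than \<open>e\<close> that starts in a
    half-ball stays in the full ball, so \<open>e\<close> acts as a Lebesgue number.\<close>
  have cover: "{a..b} \<subseteq> (\<Union>t\<in>{a..b}. ball t (\<delta> t / 2))" using \<delta>L by force
  obtain T where T: "T \<subseteq> {a..b}" "finite T" "{a..b} \<subseteq> (\<Union>t\<in>T. ball t (\<delta> t / 2))"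
    using compactE_image[OF compact_Icc _ cover] by (metis open_ball)
  define e where "e = Min (insert 1 ((\<lambda>t. \<delta> t / 2) ` T))"
  have e: "0 < e" using T \<delta>L by (auto simp: e_def subset_iff)
  have et: "e \<le> \<delta> t / 2" if "t \<in> T" for t unfolding e_def using that T(2) by (intro Min_le) auto
  define M where "M = (\<Sum>t\<in>T. L t)"
  have L0: "0 \<le> L t" if "t \<in> T" for t using \<delta>L T(1) that lipschitz_on_nonneg by blast
  have M: "0 \<le> M" unfolding M_def by (rule sum_nonneg) (rule L0)
  have LM: "L t \<le> M" if "t \<in> T" for t unfolding M_def using that T(2) L0 by (intro member_le_sum) auto
  have lip: "dist (f x) (f y) \<le> M * (y - x)" if xy: "a \<le> x" "x < y" "y \<le> b" "y - x < e" for x y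
  proof -
    have "x \<in> {a..b}" using xy by simp
    then obtain t where t: "t \<in> T" "x \<in> ball t (\<delta> t / 2)" using T(3) by blast
    have "\<bar>t - x\<bar> < \<delta> t / 2" using t(2) by (simp add: dist_real_def)
    then have "\<bar>t - x\<bar> < \<delta> t" "\<bar>t - y\<bar> < \<delta> t" using et[OF t(1)] xy by arith+
    then have "x \<in> {a..b} \<inter> ball t (\<delta> t)" "y \<in> {a..b} \<inter> ball t (\<delta> t)"
      using xy by (auto simp: dist_real_def)
    then have "dist (f x) (f y) \<le> L t * dist x y" using \<delta>L T(1) t(1) lipschitz_onD by blast
    also have "\<dots> \<le> M * dist x y" using LM[OF t(1)] by (intro mult_right_mono) auto
    finally show ?thesis using xy by (simp add: dist_real_def)
  qed
  show ?thesis
    unfolding abs_continuous_on_def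
  proof (intro allI impI)
    fix \<epsilon> :: real assume "0 < \<epsilon>"
    \<comment> \<open>The bound \<open>e\<close> makes each single interval short enough for the
      local estimate; the other bound makes the sum small.\<close>
    define d where "d = min e (\<epsilon> / (M + 1))"
    have d: "0 < d" using e M \<open>0 < \<epsilon>\<close> by (simp add: d_def)
    have "(\<Sum>(x, y)\<in>D. dist (f x) (f y)) < \<epsilon>"
      if D: "finite D" "\<forall>(x, y)\<in>D. a \<le> x \<and> x < y \<and> y \<le> b" "(\<Sum>(x, y)\<in>D. y - x) < d" for D
    proof -
      have "(\<Sum>(x, y)\<in>D. dist (f x) (f y)) \<le> (\<Sum>(x, y)\<in>D. M * (y - x))"
      proof (rule sum_mono)
        fix p assume p: "p \<in> D"
        obtain x y where xy: "p = (x, y)" by fastforce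
        have "(\<lambda>(x, y). y - x) p \<le> (\<Sum>(x, y)\<in>D. y - x)"
          using D(1,2) p by (intro member_le_sum) auto
        then have "y - x < e" using D(3) xy by (simp add: d_def)
        then show "(case p of (x, y) \<Rightarrow> dist (f x) (f y)) \<le> (case p of (x, y) \<Rightarrow> M * (y - x))"
          using lip[of x y] D(2) p xy by auto
      qed
      also have "\<dots> = M * (\<Sum>(x, y)\<in>D. y - x)" by (simp add: sum_distrib_left case_prod_beta)
      also have "\<dots> \<le> M * d" using D(3) M by (intro mult_left_mono) auto
      also have "\<dots> \<le> M * (\<epsilon> / (M + 1))" using M by (intro mult_left_mono) (auto simp: d_def)
      also have "\<dots> < \<epsilon>" using M \<open>0 < \<epsilon>\<close> by (simp add: field_simps)
      finally show ?thesis .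
    qed
    then show "\<exists>\<delta>>0. \<forall>D. finite D \<and> (\<forall>(x, y)\<in>D. a \<le> x \<and> x < y \<and> y \<le> b) \<and>
        disjoint_family_on (\<lambda>(x, y). {x<..<y}) D \<and> (\<Sum>(x, y)\<in>D. y - x) < \<delta>
        \<longrightarrow> (\<Sum>(x, y)\<in>D. dist (f x) (f y)) < \<epsilon>"
      using d by blast
  qed
qed

section \<open>Norms on a subspace of a Euclidean space\<close>

lemma norm_on_sum_le:
  assumes V: "subspace V" and N: "norm_on V N" and B: "finite B" "B \<subseteq> V"
  shows "N (\<Sum>b\<in>B. c b *\<^sub>R b) \<le> (\<Sum>b\<in>B. \<bar>c b\<bar> * N b)"
  using B
proof (induction B rule: finite_induct)
  case empty
  have "N 0 = 0" using N subspace_0[OF V] unfolding norm_on_def by blast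
  then show ?case by simp
next
  case (insert b B)
  have "(\<Sum>b\<in>B. c b *\<^sub>R b) \<in> V" using insert V by (intro subspace_sum subspace_scale) auto
  moreover have "c b *\<^sub>R b \<in> V" using insert V by (simp add: subspace_scale)
  ultimately have "N (c b *\<^sub>R b + (\<Sum>b\<in>B. c b *\<^sub>R b)) \<le> N (c b *\<^sub>R b) + N (\<Sum>b\<in>B. c b *\<^sub>R b)"
    using N by (simp add: norm_on_def)
  also have "N (c b *\<^sub>R b) = \<bar>c b\<bar> * N b" using N insert by (simp add: norm_on_def)
  finally show ?case using insert by simp
qed

text \<open>\<open>N\<close> is constrained on \<open>V\<close> alone, so \<open>v\<close> is
  expanded in an orthonormal basis of \<open>V\<close> itself, where the Euclidean norm bounds the
  coefficients.\<close>

lemma norm_on_le_norm: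
  fixes V :: "'a::euclidean_space set"
  assumes V: "subspace V" and N: "norm_on V N"
  obtains M where "0 \<le> M" "\<And>v. v \<in> V \<Longrightarrow> N v \<le> M * norm v"
proof -
  obtain B where B: "B \<subseteq> V" "pairwise orthogonal B" "\<And>x. x \<in> B \<Longrightarrow> norm x = 1" "independent B" "span B = V"
    using orthonormal_basis_subspace[OF V] by metis
  have fB: "finite B" using B(4) by (rule independent_imp_finite)
  have N0: "0 \<le> N b" if "b \<in> B" for b using N B(1) that by (auto simp: norm_on_def)
  show ?thesis
  proof (rule that[of "\<Sum>b\<in>B. N b"])
    show "0 \<le> (\<Sum>b\<in>B. N b)" using N0 by (rule sum_nonneg)
    fix v assume "v \<in> V"
    then have "v = (\<Sum>b\<in>B. (v \<bullet> b) *\<^sub>R b)"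
      using orthonormal_basis_expand[OF B(2,3) _ fB, of v] B(5) by simp
    then have "N v \<le> (\<Sum>b\<in>B. \<bar>v \<bullet> b\<bar> * N b)" using norm_on_sum_le[OF V N fB B(1)] by metis
    also have "\<dots> \<le> (\<Sum>b\<in>B. norm v * N b)"
    proof (intro sum_mono mult_right_mono)
      fix b assume b: "b \<in> B"
      show "\<bar>v \<bullet> b\<bar> \<le> norm v" using Cauchy_Schwarz_ineq2[of v b] B(3)[OF b] by simp
      show "0 \<le> N b" by (rule N0[OF b])
    qed
    finally show "N v \<le> (\<Sum>b\<in>B. N b) * norm v" by (simp add: sum_distrib_left mult.commute)
  qed
qed

lemma norm_on_continuous_on:
  fixes V :: "'a::euclidean_space set"
  assumes V: "subspace V" and N: "norm_on V N"
  shows "continuous_on V N"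
proof -
  obtain M where M: "0 \<le> M" "\<And>v. v \<in> V \<Longrightarrow> N v \<le> M * norm v" using norm_on_le_norm[OF V N] by metis
  have one: "N v - N w \<le> M * norm (v - w)" if "v \<in> V" "w \<in> V" for v w
  proof -
    have "N (w + (v - w)) \<le> N w + N (v - w)"
      using N that subspace_diff[OF V that] unfolding norm_on_def by blast
    then show ?thesis using M(2)[OF subspace_diff[OF V that]] by simp
  qed
  have "M-lipschitz_on V N"
  proof (rule lipschitz_onI)
    fix v w assume "v \<in> V" "w \<in> V"
    then show "dist (N v) (N w) \<le> M * dist v w"
      using one[of v w] one[of w v] by (simp add: dist_real_def dist_norm norm_minus_commute abs_le_iff)
  qed (rule M(1))
  then show ?thesis by (rule lipschitz_on_continuous_on)
qed

text \<open>\<open>N\<close> attains a positive minimum on the Euclidean unit sphere of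
  \<open>V\<close>, and homogeneity turns it into a bound of the Euclidean norm. For
  \<open>V = {0}\<close> that sphere is empty, hence the case distinction.\<close>

lemma compact_norm_on_ball:
  fixes V :: "'a::euclidean_space set"
  assumes V: "subspace V" and N: "norm_on V N"
  shows "compact {v \<in> V. N v \<le> C}"
proof -
  have clV: "closed V" by (rule closed_subspace[OF V])
  have "closed (V \<inter> N -` {..C})"
    by (rule continuous_closed_preimage[OF norm_on_continuous_on[OF V N] clV]) simp
  moreover have "V \<inter> N -` {..C} = {v \<in> V. N v \<le> C}" by auto
  moreover have "bounded {v \<in> V. N v \<le> C}"
  proof (cases "V \<inter> sphere 0 1 = {}")
    case True
    have "v = 0" if "v \<in> V" for v
    proof (rule ccontr)
      assume "v \<noteq> 0"
      then have "(1 / norm v) *\<^sub>R v \<in> V \<inter> sphere 0 1" using that V by (simp add: subspace_scale)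
      then show False using True by blast
    qed
    then have "{v \<in> V. N v \<le> C} \<subseteq> {0}" by blast
    with bounded_insert[THEN iffD2, OF bounded_empty] show ?thesis by (rule bounded_subset)
  next
    case False
    have "compact (V \<inter> sphere 0 1)" using clV by (intro closed_Int_compact) auto
    moreover have "continuous_on (V \<inter> sphere 0 1) N"
      using norm_on_continuous_on[OF V N] by (rule continuous_on_subset) blast
    ultimately obtain v0 where v0: "v0 \<in> V \<inter> sphere 0 1" "\<And>v. v \<in> V \<inter> sphere 0 1 \<Longrightarrow> N v0 \<le> N v"
      using continuous_attains_inf[of "V \<inter> sphere 0 1" N] False by blast
    have "N v0 \<noteq> 0" "0 \<le> N v0" using N v0(1) unfolding norm_on_def by force+
    then have pos: "0 < N v0" by simp
    have bnd: "norm v \<le> C / N v0" if v: "v \<in> V" "N v \<le> C" for v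
    proof (cases "v = 0")
      case True
      have "0 \<le> N v" using N v(1) by (simp add: norm_on_def)
      then show ?thesis using True v pos by simp
    next
      case False
      have "(1 / norm v) *\<^sub>R v \<in> V \<inter> sphere 0 1" using False v V by (simp add: subspace_scale)
      then have "N v0 \<le> N ((1 / norm v) *\<^sub>R v)" by (rule v0(2))
      also have "\<dots> = \<bar>1 / norm v\<bar> * N v" using N v(1) unfolding norm_on_def by blast
      finally have "N v0 * norm v \<le> N v" using False by (simp add: field_simps)
      then have "N v0 * norm v \<le> C" using v(2) by linarith
      then show ?thesis using pos by (simp add: pos_le_divide_eq mult.commute)
    qed
    show ?thesis
    proof (rule boundedI)
      fix v assume "v \<in> {v \<in> V. N v \<le> C}"
      then show "norm v \<le> C / N v0" using bnd[of v] by blast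
    qed
  qed
  ultimately show ?thesis by (simp add: compact_eq_bounded_closed)
qed

lemma convex_norm_on_ball:
  assumes V: "subspace V" and N: "norm_on V N"
  shows "convex {v \<in> V. N v \<le> C}"
proof (rule convexI)
  fix v w and a b :: real
  assume vw: "v \<in> {v \<in> V. N v \<le> C}" "w \<in> {v \<in> V. N v \<le> C}" and ab: "0 \<le> a" "0 \<le> b" "a + b = 1"
  then have in_V: "a *\<^sub>R v \<in> V" "b *\<^sub>R w \<in> V" using V by (auto simp: subspace_scale)
  have "N (a *\<^sub>R v + b *\<^sub>R w) \<le> N (a *\<^sub>R v) + N (b *\<^sub>R w)" using N in_V by (simp add: norm_on_def)
  also have "\<dots> = a * N v + b * N w" using N vw ab by (simp add: norm_on_def)
  also have "\<dots> \<le> a * C + b * C" using vw ab by (intro add_mono mult_left_mono) auto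
  also have "\<dots> = C" using ab by (simp add: distrib_right[symmetric])
  finally show "a *\<^sub>R v + b *\<^sub>R w \<in> {v \<in> V. N v \<le> C}" using in_V V by (simp add: subspace_add)
qed

section \<open>From extremals to normal curves on the full model space\<close>

locale full_sub_finsler_lie_group = sub_finsler_lie_group E A mul unit ginv V N
  for E :: "'e::euclidean_space set"
    and A :: "('g::{t2_space, second_countable_topology}, 'e) chart set"
    and mul :: "'g \<Rightarrow> 'g \<Rightarrow> 'g" and unit :: 'g and ginv :: "'g \<Rightarrow> 'g"
    and V :: "'e set" and N :: "'e \<Rightarrow> real" +
  assumes full_model_space: "E = UNIV"

sublocale full_sub_finsler_lie_group \<subseteq> full_lie_group
  by unfold_locales (rule full_model_space)

context full_sub_finsler_lie_group
begin

text \<open>The link from \<open>lderiv\<close>, read at \<open>unit\<close>, to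
  \<open>velocity\<close> and \<open>control\<close>, which use the chart selected at the moving
  point.\<close>

lemma lderiv_velocity:
  assumes t: "t \<in> {0<..<1}" and cont: "continuous_on {0..1} \<gamma>" and u: "lderiv \<gamma> t u"
  shows "has_velocity_at A {0..1} \<gamma> t" and "velocity A {0..1} \<gamma> t = dL (\<gamma> t) u"
    and "control {0..1} \<gamma> t = u"
proof -
  have at: "at t within {0..1} = at t" using t by (intro at_within_Icc_at) auto
  have "isCont \<gamma> t" by (rule continuous_on_interior[OF cont]) (use t in simp)
  note vd = lderiv_chart[OF u this]
  show "has_velocity_at A {0..1} \<gamma> t"
    unfolding has_velocity_at_def at using vd by (rule differentiableI_vector)
  show vel: "velocity A {0..1} \<gamma> t = dL (\<gamma> t) u"
    unfolding velocity_def at using vd by (rule vector_derivative_at)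
  have "inj_on (dL (\<gamma> t)) E" using inj_dL by (rule inj_on_subset) simp
  moreover have "u \<in> E" using full_model_space by simp
  ultimately show "control {0..1} \<gamma> t = u"
    unfolding control_def vel by (rule inv_into_f_f)
qed

text \<open>The charts selected along the curve vary without any regularity. Measurability therefore
  comes from difference quotients of the curve translated back to \<open>unit\<close> and read in
  the single chart \<open>c0\<close>, which converge to the control almost everywhere.\<close>

lemma control_measurable:
  assumes cont: "continuous_on {0..1} \<gamma>" and Z: "negligible Z"
    and der: "\<And>t. t \<in> {0<..<1} - Z \<Longrightarrow> \<exists>u. lderiv \<gamma> t u"
  shows "control {0..1} \<gamma> \<in> borel_measurable (lebesgue_on {0..1})"
proof -
  \<comment> \<open>Clamped times make \<open>q n\<close> continuous on the whole line, so each
    \<open>w n\<close> is Borel.\<close>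
  define cl where "cl t = max 0 (min 1 t)" for t :: real
  define q where "q n t = mul (ginv (\<gamma> (cl t))) (\<gamma> (cl (t + 1 / Suc n)))" for n t
  \<comment> \<open>The value 0 is a default for increments outside \<open>U\<close>; at the times
    considered below it occurs for finitely many \<open>n\<close> only.\<close>
  define w where "w n t = (if t \<in> q n -` U then Suc n *\<^sub>R (\<phi> (q n t) - z) else 0)" for n t
  have contcl: "continuous_on UNIV (\<lambda>t. \<gamma> (cl t))"
    by (rule continuous_on_compose2[OF cont]) (auto simp: cl_def intro!: continuous_intros)
  have contcl': "continuous_on UNIV (\<lambda>t. \<gamma> (cl (t + 1 / Suc n)))" for n
    by (rule continuous_on_compose2[OF contcl]) (auto intro!: continuous_intros)
  have contq: "continuous_on UNIV (q n)" for n
    unfolding q_def by (intro continuous_mul continuous_ginv contcl contcl')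
  have "w n \<in> borel_measurable borel" for n
    unfolding w_def
  proof (rule borel_measurable_continuous_on_if)
    show "q n -` U \<in> sets borel"
      using open_vimage[OF open_chart[OF c0(1)] contq] by (rule borel_open)
    show "continuous_on (q n -` U) (\<lambda>t. Suc n *\<^sub>R (\<phi> (q n t) - z))"
      by (intro continuous_on_scaleR continuous_on_diff continuous_on_const
          continuous_on_compose2[OF chart_cont[OF c0(1)] continuous_on_subset[OF contq]]) auto
  qed simp
  then have "(\<lambda>t. lim (\<lambda>n. w n t)) \<in> borel_measurable borel" by (rule borel_measurable_lim_metric)
  then have "(\<lambda>t. lim (\<lambda>n. w n t)) \<in> borel_measurable lborel" by simp
  then have meas: "(\<lambda>t. lim (\<lambda>n. w n t)) \<in> borel_measurable lebesgue" by (rule measurable_completion)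
  show ?thesis
  proof (rule borel_measurable_lebesgue_on_negligible[OF _ meas])
    show "negligible (Z \<union> {0, 1})" using Z by (simp add: negligible_Un)
    fix t assume "t \<in> {0..1} - (Z \<union> {0, 1})"
    then have t: "t \<in> {0<..<1} - Z" by auto
    obtain u where u: "lderiv \<gamma> t u" using der[OF t] by blast
    have ctrl: "control {0..1} \<gamma> t = u" using lderiv_velocity(3)[OF _ cont u] t by blast
    have lim0: "(\<lambda>n. 1 / real (Suc n)) \<longlonglongrightarrow> 0" by (rule LIMSEQ_inverse_real_of_nat[unfolded inverse_eq_divide])
    define y where "y = (\<lambda>s. \<phi> (mul (ginv (\<gamma> t)) (\<gamma> s)))"
    have y: "(y has_vector_derivative u) (at t)" using u by (simp add: lderiv_def y_def)
    have yt: "y t = z" by (simp add: y_def)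
    have "(\<lambda>n. (y (t + 1 / Suc n) - y t) /\<^sub>R (1 / Suc n)) \<longlonglongrightarrow> u"
      by (rule filterlim_compose[OF has_vector_derivative_difference_quotient[OF y]])
         (intro filterlim_atI lim0 always_eventually, simp)
    moreover have "\<forall>\<^sub>F n in sequentially. (y (t + 1 / Suc n) - y t) /\<^sub>R (1 / Suc n) = w n t"
    proof -
      have e1: "\<forall>\<^sub>F n in sequentially. 1 / real (Suc n) < 1 - t"
        using order_tendstoD(2)[OF lim0, of "1 - t"] t by simp
      have clt: "cl t = t" using t by (simp add: cl_def)
      have "(\<lambda>n. t + 1 / Suc n) \<longlonglongrightarrow> t" using tendsto_add[OF tendsto_const lim0, of t] by simp
      then have "(\<lambda>n. mul (ginv (\<gamma> (cl t))) (\<gamma> (cl (t + 1 / Suc n)))) \<longlonglongrightarrow> mul (ginv (\<gamma> (cl t))) (\<gamma> (cl t))"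
      proof (rule isCont_tendsto_compose[rotated])
        have "continuous_on UNIV (\<lambda>s. mul (ginv (\<gamma> (cl t))) (\<gamma> (cl s)))"
          by (intro continuous_mul continuous_on_const contcl)
        then show "isCont (\<lambda>s. mul (ginv (\<gamma> (cl t))) (\<gamma> (cl s))) t" by (simp add: continuous_on_eq_continuous_at)
      qed
      from topological_tendstoD[OF this open_chart[OF c0(1)]] have e2: "\<forall>\<^sub>F n in sequentially. q n t \<in> U"
        using c0(2) by (simp add: q_def)
      show ?thesis
      proof (rule eventually_mono[OF eventually_conj[OF e1 e2]])
        fix n assume n: "1 / real (Suc n) < 1 - t \<and> q n t \<in> U"
        then have "cl (t + 1 / Suc n) = t + 1 / Suc n" using t by (simp add: cl_def)
        then have "q n t = mul (ginv (\<gamma> t)) (\<gamma> (t + 1 / Suc n))" by (simp add: q_def clt)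
        then show "(y (t + 1 / Suc n) - y t) /\<^sub>R (1 / Suc n) = w n t"
          using n unfolding w_def yt by (simp add: y_def)
      qed
    qed
    ultimately have "(\<lambda>n. w n t) \<longlonglongrightarrow> u" by (rule Lim_transform_eventually)
    then show "control {0..1} \<gamma> t = lim (\<lambda>n. w n t)" unfolding ctrl by (rule limI[symmetric])
  qed
qed

text \<open>The conditions on \<open>u\<close> say that the dual norm of the transported covector is
  at most \<open>C\<close>, that \<open>u\<close> has norm \<open>C\<close>, and that their pairing
  is as large as these bounds allow. Constancy of \<open>N u\<close> also gives square
  integrability.\<close>

lemma normal_curveI:
  assumes \<xi>: "linear \<xi>" and cont: "continuous_on {0..1} \<gamma>"
    and lip: "\<And>t. t \<in> {0..1} \<Longrightarrow> \<exists>c\<in>A. chart_lipschitz_at c {0..1} \<gamma> t" and Z: "negligible Z"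
    and der: "\<And>t. t \<in> {0<..<1} - Z \<Longrightarrow> \<exists>u\<in>V. lderiv \<gamma> t u \<and> N u = C \<and> \<xi> (Ad (\<gamma> t) u) = C\<^sup>2 \<and>
      (\<forall>v\<in>V. \<xi> (Ad (\<gamma> t) v) \<le> C * N v)"
  shows "normal_curve {0..1} \<gamma> \<xi>"
proof -
  have Z': "negligible (Z \<union> {0, 1})" using Z by (simp add: negligible_Un)
  have I: "{0..1::real} \<in> sets lebesgue" by simp
  have ZI: "t \<in> {0<..<1} - Z" "t \<in> {0<..<1}" if "t \<in> {0..1} - (Z \<union> {0, 1})" for t using that by auto
  have ac: "abs_continuous_curve A {0..1} \<gamma>"
    unfolding abs_continuous_curve_def
  proof (intro conjI ballI allI impI cont)
    fix c a b assume c: "c \<in> A" and ab: "a \<le> b \<and> {a..b} \<subseteq> {0..1} \<and> \<gamma> ` {a..b} \<subseteq> fst c"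
    show "abs_continuous_on a b (snd c \<circ> \<gamma>)"
    proof (rule locally_lipschitz_abs_continuous_on)
      fix t assume t: "t \<in> {a..b}"
      then have t01: "t \<in> {0..1}" and tc: "\<gamma> t \<in> fst c" using ab by blast+
      obtain d where d: "d \<in> A" "chart_lipschitz_at d {0..1} \<gamma> t" using lip[OF t01] by blast
      have "chart_lipschitz_at c {0..1} \<gamma> t" by (rule chart_lipschitz_at_change[OF d(1) c d(2) t01 tc])
      then obtain \<delta> L where \<delta>: "0 < \<delta>" "L-lipschitz_on ({0..1} \<inter> ball t \<delta>) (\<lambda>s. snd c (\<gamma> s))"
        by (auto simp: chart_lipschitz_at_def)
      have "L-lipschitz_on ({a..b} \<inter> ball t \<delta>) (snd c \<circ> \<gamma>)"
        unfolding o_def by (rule lipschitz_on_subset[OF \<delta>(2)]) (use ab in blast)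
      then show "\<exists>\<delta>>0. \<exists>L. L-lipschitz_on ({a..b} \<inter> ball t \<delta>) (snd c \<circ> \<gamma>)" using \<delta>(1) by blast
    qed
  qed
  show ?thesis
    unfolding normal_curve_def horizontal_curve_def
  proof (intro conjI)
    show "is_interval {0..1::real}" by (rule is_interval_cc)
    show "abs_continuous_curve A {0..1} \<gamma>" by (rule ac)
    show "AE t in lebesgue_on {0..1}. has_velocity_at A {0..1} \<gamma> t \<and> velocity A {0..1} \<gamma> t \<in> dL (\<gamma> t) ` V"
    proof (rule AE_lebesgue_on_negligible[OF Z' I])
      fix t assume "t \<in> {0..1} - (Z \<union> {0, 1})"
      note t = ZI[OF this]
      obtain u where u: "u \<in> V" "lderiv \<gamma> t u" using der[OF t(1)] by blast
      show "has_velocity_at A {0..1} \<gamma> t \<and> velocity A {0..1} \<gamma> t \<in> dL (\<gamma> t) ` V"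
        using lderiv_velocity(1,2)[OF t(2) cont u(2)] u(1) by simp
    qed
    show meas: "control {0..1} \<gamma> \<in> borel_measurable (lebesgue_on {0..1})"
      by (rule control_measurable[OF cont Z]) (use der in blast)
    have const: "(N (control {0..1} \<gamma> t))\<^sup>2 = C\<^sup>2" if "t \<in> {0..1} - (Z \<union> {0, 1})" for t
    proof -
      note t = ZI[OF that]
      obtain u where "lderiv \<gamma> t u" "N u = C" using der[OF t(1)] by blast
      then show ?thesis using lderiv_velocity(3)[OF t(2) cont] by simp
    qed
    show "integrable (lebesgue_on {0..1}) (\<lambda>t. (N (control {0..1} \<gamma> t))\<^sup>2)"
    proof (rule integrable_cong_AE_imp)
      show "integrable (lebesgue_on {0..1}) (\<lambda>t::real. C\<^sup>2)" by (rule finite_measure.integrable_const[OF finite_measure_lebesgue_on[OF lmeasurable_interval(1)]])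
      show "(\<lambda>t. (N (control {0..1} \<gamma> t))\<^sup>2) \<in> borel_measurable (lebesgue_on {0..1})"
        by (rule borel_measurable_lebesgue_on_negligible[OF Z', of "\<lambda>t. C\<^sup>2"]) (use const in auto)
      show "AE t in lebesgue_on {0..1}. C\<^sup>2 = (N (control {0..1} \<gamma> t))\<^sup>2"
        by (rule AE_lebesgue_on_negligible[OF Z' I]) (rule const[symmetric])
    qed
    show "AE t in lebesgue_on {0..1}. \<xi> \<circ> Ad (\<gamma> t) \<in> subdifferential (control {0..1} \<gamma> t)"
    proof (rule AE_lebesgue_on_negligible[OF Z' I])
      fix t assume "t \<in> {0..1} - (Z \<union> {0, 1})"
      note t = ZI[OF this]
      obtain u where u: "u \<in> V" "lderiv \<gamma> t u" "N u = C" "\<xi> (Ad (\<gamma> t) u) = C\<^sup>2"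
        "\<And>v. v \<in> V \<Longrightarrow> \<xi> (Ad (\<gamma> t) v) \<le> C * N v" using der[OF t(1)] by blast
      have lin: "linear (\<xi> \<circ> Ad (\<gamma> t))" using linear_Ad \<xi> by (rule linear_compose)
      have "\<xi> (Ad (\<gamma> t) (v - u)) \<le> energy v - energy u" if "v \<in> V" for v
      proof -
        have "\<xi> (Ad (\<gamma> t) (v - u)) = \<xi> (Ad (\<gamma> t) v) - C\<^sup>2"
          using linear_diff[OF lin, of v u] u(4) by simp
        also have "\<dots> \<le> C * N v - C\<^sup>2" using u(5)[OF that] by simp
        also have "\<dots> \<le> energy v - energy u"
          \<comment> \<open>The claim rearranges to nonnegativity of the square of
            \<open>N v - C\<close>.\<close>
          using zero_le_power2[of "N v - C"] by (simp add: energy_def u(3) power2_eq_square algebra_simps)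
        finally show ?thesis .
      qed
      moreover have "\<xi> \<circ> Ad (\<gamma> t) \<in> dual_space V"
        unfolding dual_space_def using linear_add[OF lin] linear_cmul[OF lin] by auto
      ultimately show "\<xi> \<circ> Ad (\<gamma> t) \<in> subdifferential (control {0..1} \<gamma> t)"
        unfolding lderiv_velocity(3)[OF t(2) cont u(2)] subdifferential_def by simp
    qed
  qed
qed

lemma normal_curve_exists:
  assumes \<xi>: "linear \<xi>"
  shows "\<exists>\<gamma>. \<gamma> 0 = g \<and> normal_curve {0..1} \<gamma> \<xi>"
proof -
  let ?B = "\<lambda>C. {v \<in> V. N v \<le> C}"
  have N0: "N 0 = 0" and zV: "0 \<in> V" using norm_V subspace_0[OF polarization(1)] by (auto simp: norm_on_def)
  have N_nonneg: "0 \<le> N v" if "v \<in> V" for v using norm_V that by (simp add: norm_on_def)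
  have N_pos: "0 < N v" if "v \<in> V" "v \<noteq> 0" for v
    using norm_V that N_nonneg[OF that(1)] unfolding norm_on_def by force
  have N_scale: "N (r *\<^sub>R v) = \<bar>r\<bar> * N v" if "v \<in> V" for r v using norm_V that by (simp add: norm_on_def)
  have scale: "r *\<^sub>R v \<in> V" if "v \<in> V" for r v using polarization(1) that by (rule subspace_scale)
  have B: "compact (?B C)" "convex (?B C)" for C
    by (rule compact_norm_on_ball[OF polarization(1) norm_V]) (rule convex_norm_on_ball[OF polarization(1) norm_V])
  have lin: "linear (\<lambda>v. \<xi> (Ad h v))" for h
    using linear_compose[OF linear_Ad \<xi>, of h] by (simp add: o_def)
  obtain m where m: "m \<in> maximizers (?B 1) \<xi> g"
    using maximizers_nonempty[OF B _ \<xi>, of 1 g] zV N0 by fastforce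
  define C where "C = \<xi> (Ad g m)"
  have mV: "m \<in> V" "N m \<le> 1" and mmax: "\<And>w. w \<in> V \<Longrightarrow> N w \<le> 1 \<Longrightarrow> \<xi> (Ad g w) \<le> C"
    using m by (auto simp: maximizers_def C_def)
  have C0: "0 \<le> C" using mmax[OF zV] by (simp add: N0 linear_0[OF lin])
  have dual: "\<xi> (Ad g v) \<le> C * N v" if "v \<in> V" for v
  proof (cases "v = 0")
    case True
    then show ?thesis by (simp add: N0 linear_0[OF lin])
  next
    case False
    have "\<xi> (Ad g ((1 / N v) *\<^sub>R v)) \<le> C"
      using N_pos[OF that False] by (intro mmax scale that) (simp add: N_scale[OF that])
    then show ?thesis using N_pos[OF that False] by (simp add: linear_cmul[OF lin] field_simps)
  qed
  show ?thesis
  \<comment> \<open>For \<open>C = 0\<close> the ball is a point and the divisions by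
    \<open>C\<close> below fail; zero control is then optimal, because \<open>dual\<close> makes the
    functional nonpositive on \<open>V\<close>.\<close>
  proof (cases "C = 0")
    case True
    have "normal_curve {0..1} (\<lambda>_. g) \<xi>"
    proof (rule normal_curveI[OF \<xi> _ _ negligible_empty, of _ 0])
      show "\<exists>c\<in>A. chart_lipschitz_at c {0..1} (\<lambda>_. g) t" for t
        unfolding chart_lipschitz_at_def using chart_at_chart[of g]
        by (intro bexI[of _ "chart_at A g"] exI[of _ 1] exI[of _ 0]) (auto simp: lipschitz_on_def)
      show "\<exists>u\<in>V. lderiv (\<lambda>_. g) t u \<and> N u = 0 \<and> \<xi> (Ad g u) = 0\<^sup>2 \<and> (\<forall>v\<in>V. \<xi> (Ad g v) \<le> 0 * N v)" for t
        using dual True by (intro bexI[OF _ zV]) (simp add: lderiv_def N0 linear_0[OF lin])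
    qed simp
    then show ?thesis by (intro exI[of _ "\<lambda>_. g"]) simp
  next
    case False
    then have C: "0 < C" using C0 by simp
    have ne: "?B C \<noteq> {}" using zV N0 C by auto
    obtain \<gamma> where \<gamma>: "\<gamma> 0 = g" "extremal (?B C) \<xi> 1 \<gamma>" using extremal_exists[OF B ne \<xi>] by blast
    \<comment> \<open>By homogeneity the maximum over the ball of radius \<open>C\<close> is
      attained here, with value \<open>C * C\<close>; this fixes the conserved quantity.\<close>
    have "C *\<^sub>R m \<in> maximizers (?B C) \<xi> g"
    proof -
      have "\<xi> (Ad g w) \<le> \<xi> (Ad g (C *\<^sub>R m))" if "w \<in> ?B C" for w
      proof -
        have "\<xi> (Ad g w) \<le> C * N w" using that by (intro dual) simp
        also have "\<dots> \<le> C * C" using that C by (intro mult_left_mono) auto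
        finally show ?thesis by (simp add: linear_cmul[OF lin] C_def)
      qed
      moreover have "C *\<^sub>R m \<in> ?B C"
        using mV C mult_left_mono[OF mV(2), of C] by (simp add: scale N_scale)
      ultimately show ?thesis by (simp add: maximizers_def)
    qed
    from hamiltonian_maximizers[OF B ne \<xi> this]
    have Hg: "hamiltonian (?B C) \<xi> g = C\<^sup>2"
      by (simp add: linear_cmul[OF lin] C_def power2_eq_square)
    obtain Z where Z: "negligible Z" "\<And>t. t \<in> {0<..<1} - Z \<Longrightarrow> \<exists>u\<in>maximizers (?B C) \<xi> (\<gamma> t). lderiv \<gamma> t u"
      using extremal_lderiv[OF \<gamma>(2)] by blast
    have "normal_curve {0..1} \<gamma> \<xi>"
    proof (rule normal_curveI[OF \<xi> extremal_continuous[OF \<gamma>(2)] extremal_lipschitz[OF \<gamma>(2)] Z(1), of C])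
      fix t assume t: "t \<in> {0<..<1} - Z"
      obtain u where u: "u \<in> maximizers (?B C) \<xi> (\<gamma> t)" "lderiv \<gamma> t u" using Z(2)[OF t] by blast
      have uB: "u \<in> V" "N u \<le> C" using u(1) by (auto simp: maximizers_def)
      have "t \<in> {0..1}" using t by auto
      from extremal_hamiltonian[OF \<gamma>(2) this] have Ht: "hamiltonian (?B C) \<xi> (\<gamma> t) = C\<^sup>2" by (simp add: \<gamma>(1) Hg)
      then have uC: "\<xi> (Ad (\<gamma> t) u) = C\<^sup>2" using hamiltonian_maximizers[OF B ne \<xi> u(1)] by simp
      \<comment> \<open>Rescaled to norm \<open>C\<close>, the vector \<open>v\<close> becomes a
        competitor at time \<open>t\<close>, where the maximum is still
        \<open>C * C\<close>.\<close>
      have dual_t: "\<xi> (Ad (\<gamma> t) v) \<le> C * N v" if v: "v \<in> V" for v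
      proof (cases "v = 0")
        case True
        then show ?thesis by (simp add: N0 linear_0[OF lin])
      next
        case False
        note Nv = N_pos[OF v False]
        have "\<xi> (Ad (\<gamma> t) ((C / N v) *\<^sub>R v)) \<le> C\<^sup>2"
          unfolding Ht[symmetric] using Nv C by (intro hamiltonian_upper[OF B ne \<xi>]) (simp add: scale v N_scale)
        then have "C * \<xi> (Ad (\<gamma> t) v) \<le> C * (C * N v)"
          using Nv by (simp add: linear_cmul[OF lin] field_simps power2_eq_square)
        then show ?thesis using C by simp
      qed
      \<comment> \<open>With dual norm at most \<open>C\<close>, the pairing \<open>C * C\<close> is
        reached only on the boundary of the ball.\<close>
      have "C * C \<le> C * N u" using dual_t[OF uB(1)] uC by (simp add: power2_eq_square)
      then have "N u = C" using C uB(2) by simp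
      then show "\<exists>u\<in>V. lderiv \<gamma> t u \<and> N u = C \<and> \<xi> (Ad (\<gamma> t) u) = C\<^sup>2 \<and> (\<forall>v\<in>V. \<xi> (Ad (\<gamma> t) v) \<le> C * N v)"
        using u(2) uB(1) uC dual_t by blast
    qed
    then show ?thesis using \<gamma>(1) by blast
  qed
qed

end

section \<open>Dimension zero\<close>

text \<open>Here \<open>V = {0}\<close>, so a constant curve is horizontal with zero control. The
  filter \<open>at x within {0}\<close> is trivial and derivatives are not unique; what is used of
  the selected one is that it is linear and thus sends 0 to 0.\<close>

lemma normal_curve_exists_dim_zero:
  assumes sf: "sub_finsler_lie_group E A mul unit ginv V N" and E: "E = {0}"
    and \<xi>: "\<xi> \<in> dual_space E"
  shows "sub_finsler_lie_group.normal_curve E A mul unit ginv V N {0..1} (\<lambda>_. g) \<xi>"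
proof -
  interpret sub_finsler_lie_group E A mul unit ginv V N by (rule sf)
  have V: "V = {0}" using polarization subspace_0[OF polarization(1)] E by auto
  have N0: "N 0 = 0" using norm_V by (simp add: V norm_on_def)
  have frechet: "frechet_derivative f (at x within {0}) 0 = 0" for f :: "'a \<Rightarrow> 'a" and x
  proof -
    have "at x within {0} = bot"
      using trivial_limit_within[of x "{0}"] islimpt_finite[of "{0}" x] by simp
    then have "(f has_derivative (\<lambda>_. 0)) (at x within {0})"
      by (simp add: has_derivative_def)
    then have "(f has_derivative frechet_derivative f (at x within {0})) (at x within {0})"
      using differentiableI frechet_derivative_works by blast
    from linear_0[OF has_derivative_linear[OF this]] show ?thesis .
  qed
  have dL0: "dL h 0 = 0" for h unfolding dL_def differential_def unfolding E by (rule frechet)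
  have Ad0: "Ad h 0 = 0" for h unfolding Ad_def differential_def unfolding E by (rule frechet)
  have \<xi>0: "\<xi> 0 = 0"
  proof -
    have "\<xi> (0 *\<^sub>R 0) = 0 * \<xi> 0" using \<xi> E unfolding dual_space_def by blast
    then show ?thesis by simp
  qed
  have hv: "has_velocity_at A {0..1} (\<lambda>_. g) t" for t
    by (simp add: has_velocity_at_def o_def)
  have vel: "velocity A {0..1} (\<lambda>_. g) t = 0" if "t \<in> {0..1}" for t
    unfolding velocity_def o_def using that
    by (intro vector_derivative_within_cbox[of 0 1, unfolded cbox_interval]) (auto intro: has_vector_derivative_const)
  have ctrl: "control {0..1} (\<lambda>_. g) t = 0" if "t \<in> {0..1}" for t
  proof -
    \<comment> \<open>Any map is injective on the singleton \<open>E\<close>, so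
      \<open>inv_into\<close> sends the velocity \<open>dL g 0\<close> back to 0.\<close>
    have "inj_on h E" "0 \<in> E" for h :: "'a \<Rightarrow> 'a" unfolding E by simp_all
    then have "inv_into E (dL g) (dL g 0) = 0" by (rule inv_into_f_f)
    then show ?thesis unfolding control_def vel[OF that] dL0 .
  qed
  have sub: "\<xi> \<circ> Ad g \<in> subdifferential 0"
    unfolding subdifferential_def dual_space_def unfolding V by (simp add: Ad0 \<xi>0)
  show ?thesis
    unfolding normal_curve_def horizontal_curve_def
  proof (intro conjI)
    show "abs_continuous_curve A {0..1} (\<lambda>_. g)"
      by (auto simp: abs_continuous_curve_def abs_continuous_on_def intro!: exI[of _ 1])
    show "AE t in lebesgue_on {0..1}. has_velocity_at A {0..1} (\<lambda>_. g) t \<and> velocity A {0..1} (\<lambda>_. g) t \<in> dL g ` V"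
      by (rule AE_I2) (auto simp: hv vel V dL0)
    show "control {0..1} (\<lambda>_. g) \<in> borel_measurable (lebesgue_on {0..1})"
      by (rule measurable_cong[THEN iffD1, of _ "\<lambda>_. 0"]) (auto simp: ctrl)
    have "integrable (lebesgue_on {0..1}) (\<lambda>t::real. (N 0)\<^sup>2)"
      by (rule finite_measure.integrable_const[OF finite_measure_lebesgue_on[OF lmeasurable_interval(1)]])
    then show "integrable (lebesgue_on {0..1}) (\<lambda>t. (N (control {0..1} (\<lambda>_. g) t))\<^sup>2)"
      by (rule Bochner_Integration.integrable_cong[THEN iffD1, rotated 2]) (auto simp: ctrl)
    show "AE t in lebesgue_on {0..1}. \<xi> \<circ> Ad g \<in> subdifferential (control {0..1} (\<lambda>_. g) t)"
      by (rule AE_I2) (use sub ctrl in simp)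
  qed (rule is_interval_cc)
qed

theorem proposition3p5:
  fixes E :: "'e::euclidean_space set"
    and A :: "('g::{t2_space, second_countable_topology}, 'e) chart set"
    and mul :: "'g \<Rightarrow> 'g \<Rightarrow> 'g" and unit :: 'g and ginv :: "'g \<Rightarrow> 'g"
    and V :: "'e set" and N :: "'e \<Rightarrow> real"
    and \<xi> :: "'e \<Rightarrow> real" and g :: 'g
  assumes "sub_finsler_lie_group E A mul unit ginv V N"
    and "\<xi> \<in> dual_space E"
  shows "\<exists>\<gamma>. \<gamma> 0 = g \<and>
           sub_finsler_lie_group.normal_curve E A mul unit ginv V N {0..1} \<gamma> \<xi>"
proof -
  interpret S: sub_finsler_lie_group E A mul unit ginv V N by (rule assms(1))
  show ?thesis
  proof (cases "E = UNIV")
    case True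
    interpret full_sub_finsler_lie_group E A mul unit ginv V N
      by unfold_locales (rule True)
    have "linear \<xi>"
      using assms(2) by (intro linearI) (auto simp: True dual_space_def)
    then show ?thesis by (rule normal_curve_exists)
  next
    case False
    then have "E = {0}" using S.model_space by blast
    from normal_curve_exists_dim_zero[OF assms(1) this assms(2)] show ?thesis
      by (intro exI[of _ "\<lambda>_. g"]) simp
  qed
qed

end
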